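(* Consider the generalized SQG equation $\partial_t\theta+u\cdot\nabla\theta=0$ on the half-plane $\mathbb R\times\mathbb R^+$, where $$u(t,x)=\int_{\mathbb R\times\mathbb R^+}\left(\frac{(x-y)^\perp}{|x-y|^{2+2\alpha}}-\frac{(x-\bar y)^\perp}{|x-\bar y|^{2+2\alpha}}\right)\theta(t,y)\,dy ,$$ and let $X_\beta:=W^{1,\infty}_\beta(\mathbb R\times\mathbb R^+)\cap L^1(\mathbb R\times\mathbb R^+)$. This equation is ill-posed in $X_\beta$ for any $\alpha\in(0,\frac12)$ and $\beta\in[0,1)\setminus[2\alpha,1-2\alpha]$ (with $[2\alpha,1-2\alpha]:=\emptyset$ when $\alpha>\frac14$), in the following sense: (a) if $\beta\in[0,2\alpha)$, then there is $\theta_0\in X_\beta$ such that for no $T>0$ does there exist a classical solution $\theta\in L^\infty([0,T];X_\beta)$ with $\theta(0,\cdot)=\theta_0$; (b) if $\beta\in(1-2\alpha,1)$, then there are $\theta_0\in X_\beta$ and a sequence $(\theta_{0,n})_{n\ge1}$ in $X_\beta$ with $\theta_{0,n}\to\theta_0$ in $X_\beta$ such that for no $T>0$ do there exist classical solutions $\theta,\theta_n\in L^\infty([0,T];X_\beta)$ ($n\ge1$) with $\theta(0,\cdot)=\theta_0$, $\theta_n(0,\cdot)=\theta_{0,n}$ for all $n$, and $\theta_n\to\theta$ in $L^\infty([0,T];X_\beta)$.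
   Context: Notation: $\mathbb R^+=(0,\infty)$; for $y=(y_1,y_2)\in\mathbb R^2$, $\bar y:=(y_1,-y_2)$ and $y^\perp:=(y_2,-y_1)$. For $\beta\in[0,1)$, $W^{1,\infty}_\beta(\mathbb R\times\mathbb R^+)$ is the space of all $\theta:\mathbb R\times\mathbb R^+\to\mathbb R$ such that $\|\theta\|_{L^\infty}<\infty$ and $$\|\theta\|_{\dot W^{1,\infty}_\beta}:=\|\partial_{x_1}\theta\|_{L^\infty}+\|\min\{x_2^\beta,1\}\,\partial_{x_2}\theta\|_{L^\infty}<\infty,$$ with norm $\|\theta\|_{W^{1,\infty}_\beta}:=\|\theta\|_{L^\infty}+\|\theta\|_{\dot W^{1,\infty}_\beta}$. The intersection $X_\beta$ carries the norm $\|\theta\|_{X_\beta}=\|\theta\|_{W^{1,\infty}_\beta}+\|\theta\|_{L^1}$. A classical solution is a locally Lipschitz function for which the equation holds almost everywhere. *)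

theory Defs
  imports "HOL-Analysis.Analysis" "HOL-Probability.Essential_Supremum"
begin

text \<open>Functions on the half-plane are functions on the whole of \<open>real \<times> real\<close> whose values
  outside \<open>halfplane\<close> are irrelevant to every notion below.\<close>

definition halfplane :: "(real \<times> real) set" where
  "halfplane = UNIV \<times> {0<..}"

definition reflect :: "real \<times> real \<Rightarrow> real \<times> real" where
  "reflect y = (fst y, - snd y)"

definition perp :: "real \<times> real \<Rightarrow> real \<times> real" where
  "perp y = (snd y, - fst y)"

definition gsqg_velocity :: "real \<Rightarrow> (real \<times> real \<Rightarrow> real) \<Rightarrow> real \<times> real \<Rightarrow> real \<times> real" where
  "gsqg_velocity \<alpha> \<theta> x =
     (LINT y|lebesgue_on halfplane. \<theta> y *\<^sub>R
        (perp (x - y) /\<^sub>R (norm (x - y) powr (2 + 2 * \<alpha>))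
       - perp (x - reflect y) /\<^sub>R (norm (x - reflect y) powr (2 + 2 * \<alpha>))))"


subsection \<open>Weak derivatives\<close>

text \<open>For first-order weak derivatives, compactly supported \<open>C\<^sup>1\<close> test functions define
  the same notion as smooth ones.\<close>

definition test_functions :: "(real \<times> real \<Rightarrow> real) set" where
  "test_functions = {\<phi>. (\<forall>x. \<phi> differentiable (at x))
     \<and> (\<forall>v. continuous_on UNIV (\<lambda>x. frechet_derivative \<phi> (at x) v))
     \<and> compact (closure {x. \<phi> x \<noteq> 0}) \<and> closure {x. \<phi> x \<noteq> 0} \<subseteq> halfplane}"

definition locally_integrable :: "(real \<times> real \<Rightarrow> real) \<Rightarrow> bool" where
  "locally_integrable f \<longleftrightarrow> (\<forall>K. compact K \<and> K \<subseteq> halfplane \<longrightarrow> f absolutely_integrable_on K)"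

definition has_weak_deriv ::
    "real \<times> real \<Rightarrow> (real \<times> real \<Rightarrow> real) \<Rightarrow> (real \<times> real \<Rightarrow> real) \<Rightarrow> bool" where
  "has_weak_deriv v f g \<longleftrightarrow> locally_integrable f \<and> locally_integrable g
     \<and> (\<forall>\<phi>\<in>test_functions.
          (LINT x|lebesgue_on halfplane. f x * frechet_derivative \<phi> (at x) v)
            = - (LINT x|lebesgue_on halfplane. g x * \<phi> x))"


subsection \<open>Function spaces\<close>

definition Linf_norm :: "(real \<times> real \<Rightarrow> real) \<Rightarrow> ennreal" where
  "Linf_norm f = esssup (lebesgue_on halfplane) (\<lambda>x. ennreal \<bar>f x\<bar>)"

definition L1_norm :: "(real \<times> real \<Rightarrow> real) \<Rightarrow> ennreal" where
  "L1_norm f = (\<integral>\<^sup>+x. ennreal \<bar>f x\<bar> \<partial>lebesgue_on halfplane)"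

text \<open>A weak derivative is unique up to null sets, so each infimum below ranges over a single
  value if the weak derivative exists, and it is \<open>\<infinity>\<close> (infimum of the empty set) otherwise.\<close>

definition W_seminorm :: "real \<Rightarrow> (real \<times> real \<Rightarrow> real) \<Rightarrow> ennreal" where
  "W_seminorm \<beta> \<theta> =
     (INF g\<in>{g. has_weak_deriv (1, 0) \<theta> g}. Linf_norm g)
   + (INF g\<in>{g. has_weak_deriv (0, 1) \<theta> g}. Linf_norm (\<lambda>x. min (snd x powr \<beta>) 1 * g x))"

definition W_norm :: "real \<Rightarrow> (real \<times> real \<Rightarrow> real) \<Rightarrow> ennreal" where
  "W_norm \<beta> \<theta> = Linf_norm \<theta> + W_seminorm \<beta> \<theta>"

definition W_space :: "real \<Rightarrow> (real \<times> real \<Rightarrow> real) set" where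
  "W_space \<beta> = {\<theta>. Linf_norm \<theta> < \<infinity> \<and> W_seminorm \<beta> \<theta> < \<infinity>}"

definition X_space :: "real \<Rightarrow> (real \<times> real \<Rightarrow> real) set" where
  "X_space \<beta> = W_space \<beta> \<inter> {\<theta>. integrable (lebesgue_on halfplane) \<theta>}"

definition X_norm :: "real \<Rightarrow> (real \<times> real \<Rightarrow> real) \<Rightarrow> ennreal" where
  "X_norm \<beta> \<theta> = W_norm \<beta> \<theta> + L1_norm \<theta>"

text \<open>The essential supremum in time is written out as the least essential upper bound, because
  \<open>esssup\<close> is \<open>\<infinity>\<close> by convention on non-measurable functions.\<close>

definition LinfX_norm :: "real \<Rightarrow> real \<Rightarrow> (real \<Rightarrow> real \<times> real \<Rightarrow> real) \<Rightarrow> ennreal" where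
  "LinfX_norm T \<beta> \<theta> = Inf {C. AE t in lebesgue_on {0..T}. X_norm \<beta> (\<theta> t) \<le> C}"

definition LinfX_space :: "real \<Rightarrow> real \<Rightarrow> (real \<Rightarrow> real \<times> real \<Rightarrow> real) set" where
  "LinfX_space T \<beta> = {\<theta>. (AE t in lebesgue_on {0..T}. \<theta> t \<in> X_space \<beta>) \<and> LinfX_norm T \<beta> \<theta> < \<infinity>}"


subsection \<open>Classical solutions\<close>

definition locally_lipschitz_on ::
    "'a::metric_space set \<Rightarrow> ('a \<Rightarrow> 'b::metric_space) \<Rightarrow> bool" where
  "locally_lipschitz_on S f \<longleftrightarrow> (\<forall>p\<in>S. \<exists>r>0. \<exists>L. L-lipschitz_on (ball p r \<inter> S) f)"

text \<open>By Rademacher's theorem, a locally Lipschitz function is differentiable almost everywhere;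
  \<open>D\<close> is its derivative in \<open>(t, x)\<close>, so \<open>D (1, 0)\<close> is the time derivative
  and \<open>D (0, v)\<close> is \<open>v \<bullet> \<nabla>\<theta>\<close>.\<close>

definition classical_solution :: "real \<Rightarrow> real \<Rightarrow> (real \<Rightarrow> real \<times> real \<Rightarrow> real) \<Rightarrow> bool" where
  "classical_solution \<alpha> T \<theta> \<longleftrightarrow>
     locally_lipschitz_on ({0..T} \<times> halfplane) (\<lambda>(t, x). \<theta> t x)
   \<and> (AE (t, x) in lebesgue_on ({0..T} \<times> halfplane).
        \<exists>D. ((\<lambda>(s, y). \<theta> s y) has_derivative D) (at (t, x))
          \<and> D (1, 0) + D (0, gsqg_velocity \<alpha> (\<theta> t) x) = 0)"

text \<open>Elements of \<open>X_space\<close> are taken up to null sets, so initial data are attained almost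
  everywhere. Pointwise equality would be too strong: changing a datum on a null set would then
  destroy all of its solutions.\<close>

definition has_initial_data ::
    "(real \<Rightarrow> real \<times> real \<Rightarrow> real) \<Rightarrow> (real \<times> real \<Rightarrow> real) \<Rightarrow> bool" where
  "has_initial_data \<theta> \<theta>0 \<longleftrightarrow> (AE x in lebesgue_on halfplane. \<theta> 0 x = \<theta>0 x)"

end

(* Both parts test the equation on a compactly supported Lipschitz datum built from tents.

   (a) Since the odd extension of theta jumps across the boundary, u_1(x_1,h) - u_1(x_1,0) behaves like
   a positive constant times theta(x_1,0) h^(1-2 alpha).  A solution in X_beta varies only by O(h^(1-beta))
   over the strip of height h.  Averaging the equation over two such strips and subtracting, this shear
   would have to be O(h^(1-beta)) + o(h^(1-2 alpha)), which is impossible when beta < 2 alpha.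

   (b) A solution in X_beta has a velocity that is continuous up to t = 0 at an interior point x0, so near
   (0, x0) the solution is the datum transported with the frozen velocity u(0, x0), up to o(t).  A datum with
   a gradient jump (a kink) at x0 therefore has its kink transported by t u(0, x0).  Perturbing the datum by
   1/n changes that velocity, so the two kinks separate by a distance of order t/n, and between them the
   gradients of theta_n and theta differ by a fixed amount. *)
theory Submission
  imports Defs
begin

section \<open>Averaged increments\<close>

text \<open>A solution is only locally Lipschitz: the equation holds almost everywhere, the bounds
  of \<open>X_space\<close> for almost every time, and nothing is given on the boundary. There are
  no traces to use, and an a.e. statement says nothing along a single trajectory. Hence every
  derivative is tested through translation difference quotients. In (a), neither the time derivative
  nor the transport by the boundary velocity is small by itself. Their averages over two strips are
  close because derivatives along the boundary can be moved onto a cutoff and onto the boundary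
  velocity, which is Lipschitz in x_1, and what remains is the vertical oscillation of the solution.
  The shear term is quadratic, \<theta> d_1 \<theta> = d_1 (\<theta>^2) / 2, so uniform closeness of
  \<theta> to the datum bounds it below without any closeness of gradients; it dominates as the
  strip shrinks while the time window stays fixed. In (b), the time at which the gap is read off
  shrinks with n, but the gap does not: the difference of the solutions changes by an amount
  comparable to the separation of the kinks over exactly that separation.\<close>

definition ddir :: "('a::euclidean_space \<Rightarrow> real) \<Rightarrow> 'a \<Rightarrow> 'a \<Rightarrow> real" where
  "ddir f v x = lim (\<lambda>n. (f (x + (1 / real (Suc n)) *\<^sub>R v) - f x) / (1 / real (Suc n)))"

text \<open>A limit along the fixed sequence 1/(n+1) is a Borel function whether or not
  \<open>f\<close> is differentiable, and it is the directional derivative wherever one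
  exists.\<close>

lemma borel_measurable_ddir [measurable]:
  assumes [measurable]: "f \<in> borel_measurable borel"
  shows "ddir f v \<in> borel_measurable borel"
  unfolding ddir_def by measurable

lemma has_derivative_imp_diff_quotient:
  fixes f :: "'a::euclidean_space \<Rightarrow> real"
  assumes "(f has_derivative D) (at x)"
  shows "((\<lambda>k. (f (x + k *\<^sub>R v) - f x) / k) \<longlongrightarrow> D v) (at 0)"
proof -
  interpret D: bounded_linear D using assms by (rule has_derivative_bounded_linear)
  have "(f has_derivative D) (at (x + 0 *\<^sub>R v))" using assms by simp
  then have "((\<lambda>k. f (x + k *\<^sub>R v)) has_derivative (\<lambda>k. D (k *\<^sub>R v))) (at 0)"
    by (rule has_derivative_compose[rotated]) (auto intro!: derivative_eq_intros)
  moreover have "(\<lambda>k. D (k *\<^sub>R v)) = (*) (D v)"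
    by (simp add: fun_eq_iff D.scaleR mult.commute)
  ultimately have "((\<lambda>k. f (x + k *\<^sub>R v)) has_field_derivative D v) (at 0)"
    by (simp add: has_field_derivative_def)
  then show ?thesis by (simp add: has_field_derivative_iff)
qed

lemma inverse_Suc_filterlim: "filterlim (\<lambda>n. 1 / real (Suc n)) (at 0) sequentially"
  using LIMSEQ_Suc[OF lim_1_over_n[where 'a=real]] by (auto simp: filterlim_at)

lemma ddir_eq:
  assumes "(f has_derivative D) (at x)"
  shows "ddir f v x = D v"
  unfolding ddir_def
  by (rule limI, rule filterlim_compose[OF has_derivative_imp_diff_quotient[OF assms] inverse_Suc_filterlim])

text \<open>One-sided increments determine \<open>D v\<close>, so small positive \<open>k\<close>
  suffice. Vertical increments of a solution will be controlled only upwards.\<close>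

lemma ddir_lipschitz_bound:
  fixes f :: "'a::euclidean_space \<Rightarrow> real"
  assumes "(f has_derivative D) (at x)"
    and "eventually (\<lambda>k. \<bar>f (x + k *\<^sub>R v) - f x\<bar> \<le> L * \<bar>k\<bar>) (at_right 0)"
  shows "\<bar>D v\<bar> \<le> L"
proof -
  have "((\<lambda>k. \<bar>(f (x + k *\<^sub>R v) - f x) / k\<bar>) \<longlongrightarrow> \<bar>D v\<bar>) (at_right 0)"
    by (intro tendsto_rabs filterlim_mono[OF has_derivative_imp_diff_quotient[OF assms(1)] order_refl] at_le) auto
  moreover have "eventually (\<lambda>k. \<bar>(f (x + k *\<^sub>R v) - f x) / k\<bar> \<le> L) (at_right 0)"
    using assms(2) eventually_at_right_less[of 0]
    by eventually_elim (auto simp: abs_div divide_simps)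
  ultimately show ?thesis
    by (rule tendsto_upperbound) simp
qed

lemma lborel_integral_translate:
  fixes f :: "'a::euclidean_space \<Rightarrow> real"
  assumes [measurable]: "f \<in> borel_measurable borel"
  shows "(LINT x|lborel. f (x + a)) = (LINT x|lborel. f x)"
proof -
  have "(LINT x|lborel. f x) = (LINT x|distr lborel borel ((+) a). f x)"
    by (simp add: lborel_distr_plus)
  also have "\<dots> = (LINT x|lborel. f (a + x))" by (subst integral_distr) auto
  finally show ?thesis by (simp add: add.commute)
qed

lemma integrable_bounded_compact_support:
  fixes f :: "'a::euclidean_space \<Rightarrow> real"
  assumes [measurable]: "f \<in> borel_measurable borel" and "\<And>x. \<bar>f x\<bar> \<le> B"
    and "bounded K" and "\<And>x. x \<notin> K \<Longrightarrow> f x = 0"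
  shows "integrable lborel f"
proof -
  obtain a b where ab: "K \<subseteq> cbox a b" using bounded_subset_cbox_symmetric[OF assms(3)] by blast
  have "integrable lborel (\<lambda>x. B * indicator (cbox a b) x)"
    by (intro integrable_mult_right integrable_real_indicator[OF _ emeasure_lborel_cbox_finite]) auto
  then show ?thesis
  proof (rule Bochner_Integration.integrable_bound)
    show "AE x in lborel. norm (f x) \<le> norm (B * indicator (cbox a b) x)"
    proof (intro always_eventually allI)
      fix x show "norm (f x) \<le> norm (B * indicator (cbox a b) x)"
        using assms(2)[of x] assms(4)[of x] ab by (cases "x \<in> K") (auto simp: indicator_def)
    qed
  qed simp
qed

text \<open>Integration by parts by translation: substituting \<open>x + k v\<close> moves the
  quotient from \<phi> to \<open>f\<close>, where the Lipschitz constant dominates it. Thus \<phi>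
  may be any bounded Borel function vanishing off a compact set, in particular one with the sharp
  edges of a strip.\<close>

lemma integral_diff_quotient_tendsto:
  fixes f \<phi> :: "'a::euclidean_space \<Rightarrow> real"
  assumes f[measurable]: "f \<in> borel_measurable borel" and lip: "L-lipschitz_on S f" and S: "open S"
    and \<phi>[measurable]: "\<phi> \<in> borel_measurable borel" and B: "\<And>x. \<bar>\<phi> x\<bar> \<le> B"
    and K: "compact K" "K \<subseteq> S" "\<And>x. x \<notin> K \<Longrightarrow> \<phi> x = 0"
    and diff: "AE x in lborel. x \<in> K \<longrightarrow> (\<exists>D. (f has_derivative D) (at x))"
  shows "integrable lborel (\<lambda>x. ddir f v x * \<phi> x)"
    and "((\<lambda>k. LINT x|lborel. f x * ((\<phi> (x - k *\<^sub>R v) - \<phi> x) / k))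
           \<longlongrightarrow> (LINT x|lborel. ddir f v x * \<phi> x)) (at 0)"
proof -
  have L0: "L \<ge> 0" using lip by (rule lipschitz_on_nonneg)
  have B0: "B \<ge> 0" using B[of 0] by linarith
  obtain e where e: "e > 0" "(\<Union>x\<in>K. ball x e) \<subseteq> S"
    using compact_subset_open_imp_ball_epsilon_subset[OF K(1) S K(2)] by metis
  define e' where "e' = e / (norm v + 1)"
  have e': "e' > 0" using e by (simp add: e'_def add_nonneg_pos)
  have inS: "x + k *\<^sub>R v \<in> S" if "x \<in> K" "\<bar>k\<bar> < e'" for x k
  proof -
    have "\<bar>k\<bar> * norm v \<le> \<bar>k\<bar> * (norm v + 1)" by (simp add: mult_left_mono)
    also have "\<dots> < e" using that(2) by (simp add: e'_def pos_less_divide_eq add_nonneg_pos)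
    finally have "x + k *\<^sub>R v \<in> ball x e" by (simp add: dist_norm)
    then show ?thesis using e(2) that(1) by blast
  qed
  have lipb: "\<bar>f (x + k *\<^sub>R v) - f x\<bar> \<le> L * norm v * \<bar>k\<bar>" if "x \<in> K" "\<bar>k\<bar> < e'" for x k
    using lipschitz_onD[OF lip inS[OF that], of x] that(1) K(2)
    by (auto simp: dist_norm mult_ac)
  have "bounded (f ` K)"
    using compact_continuous_image[OF continuous_on_subset[OF lipschitz_on_continuous_on[OF lip] K(2)] K(1)]
    by (rule compact_imp_bounded)
  then obtain F where F: "\<And>x. x \<in> K \<Longrightarrow> \<bar>f x\<bar> \<le> F" by (auto simp: bounded_iff)
  define F' where "F' = \<bar>F\<bar> + L * norm v * e'"
  have Fk: "\<bar>f (x + k *\<^sub>R v)\<bar> \<le> F'" if "x \<in> K" "\<bar>k\<bar> < e'" for x k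
  proof -
    have "L * norm v * \<bar>k\<bar> \<le> L * norm v * e'" using that L0 by (intro mult_left_mono) auto
    then show ?thesis unfolding F'_def using lipb[OF that] F[OF that(1)] by linarith
  qed
  have F'0: "F' \<ge> 0" using L0 e' by (simp add: F'_def)
  have int: "integrable lborel (\<lambda>x. f (x + k *\<^sub>R v) * \<phi> x)" if "\<bar>k\<bar> < e'" for k
  proof (rule integrable_bounded_compact_support[where K=K and B="F' * B"])
    fix x show "\<bar>f (x + k *\<^sub>R v) * \<phi> x\<bar> \<le> F' * B"
      using Fk[OF _ that, of x] B[of x] K(3)[of x] F'0 B0
      by (cases "x \<in> K") (auto simp: abs_mult intro!: mult_mono)
  qed (use K in \<open>auto intro: compact_imp_bounded\<close>)
  have eq: "(LINT x|lborel. f x * ((\<phi> (x - k *\<^sub>R v) - \<phi> x) / k))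
      = (LINT x|lborel. (f (x + k *\<^sub>R v) - f x) / k * \<phi> x)" if "\<bar>k\<bar> < e'" for k
  proof -
    have i1: "integrable lborel (\<lambda>x. f x * \<phi> (x - k *\<^sub>R v))"
    proof -
      have "integrable (distr lborel borel ((+) (- k *\<^sub>R v))) (\<lambda>x. f (x + k *\<^sub>R v) * \<phi> x)"
        using int[OF that] by (simp add: lborel_distr_plus)
      then show ?thesis by (subst (asm) integrable_distr_eq) (auto simp: algebra_simps)
    qed
    have "(LINT x|lborel. f x * ((\<phi> (x - k *\<^sub>R v) - \<phi> x) / k))
       = ((LINT x|lborel. f x * \<phi> (x - k *\<^sub>R v)) - (LINT x|lborel. f x * \<phi> x)) / k"
      using i1 int[of 0] e' by (simp add: right_diff_distrib diff_divide_distrib)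
    also have "(LINT x|lborel. f x * \<phi> (x - k *\<^sub>R v)) = (LINT x|lborel. f (x + k *\<^sub>R v) * \<phi> x)"
      using lborel_integral_translate[of "\<lambda>x. f x * \<phi> (x - k *\<^sub>R v)" "k *\<^sub>R v"] by simp
    also have "((LINT x|lborel. f (x + k *\<^sub>R v) * \<phi> x) - (LINT x|lborel. f x * \<phi> x)) / k
       = (LINT x|lborel. (f (x + k *\<^sub>R v) - f x) / k * \<phi> x)"
      using int[OF that] int[of 0] e' by (simp add: left_diff_distrib diff_divide_distrib)
    finally show ?thesis .
  qed
  obtain a b where ab: "K \<subseteq> cbox a b" using bounded_subset_cbox_symmetric[OF compact_imp_bounded[OF K(1)]] by blast
  define w where "w x = L * norm v * B * indicator (cbox a b) x" for x :: 'a
  have w: "integrable lborel w" unfolding w_def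
    by (intro integrable_mult_right integrable_real_indicator[OF _ emeasure_lborel_cbox_finite]) auto
  have dom: "norm ((f (x + k *\<^sub>R v) - f x) / k * \<phi> x) \<le> w x" if "\<bar>k\<bar> < e'" "k \<noteq> 0" for x k
  proof (cases "x \<in> K")
    case True
    have "\<bar>(f (x + k *\<^sub>R v) - f x) / k\<bar> \<le> L * norm v"
      using lipb[OF True that(1)] that(2) by (simp add: divide_simps)
    then have "\<bar>(f (x + k *\<^sub>R v) - f x) / k\<bar> * \<bar>\<phi> x\<bar> \<le> L * norm v * B"
      using B[of x] L0 by (intro mult_mono) auto
    then show ?thesis using True ab by (auto simp: w_def abs_mult)
  next
    case False
    then show ?thesis using K(3)[of x] L0 B0 by (simp add: w_def)
  qed
  have lim: "AE x in lborel. (\<lambda>n. (f (x + X n *\<^sub>R v) - f x) / X n * \<phi> x) \<longlonglongrightarrow> ddir f v x * \<phi> x"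
    if "filterlim X (at 0) sequentially" for X
    using diff
  proof eventually_elim
    case (elim x)
    show ?case
    proof (cases "x \<in> K")
      case True
      then obtain D where D: "(f has_derivative D) (at x)" using elim by blast
      show ?thesis unfolding ddir_eq[OF D]
        by (intro tendsto_mult tendsto_const filterlim_compose[OF has_derivative_imp_diff_quotient[OF D] that])
    qed (use K(3)[of x] in simp)
  qed
  have dct: "integrable lborel (\<lambda>x. ddir f v x * \<phi> x) \<and>
    (\<lambda>n. LINT x|lborel. (f (x + X n *\<^sub>R v) - f x) / X n * \<phi> x) \<longlonglongrightarrow> (LINT x|lborel. ddir f v x * \<phi> x)"
    if X: "filterlim X (at 0) sequentially" "\<And>n. \<bar>X n\<bar> < e'" for X
  proof -
    \<comment> \<open>Convergence in \<open>at 0\<close> excludes \<open>X n = 0\<close> only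
      eventually; there the quotient is 0 by the convention on division and the bound still
      holds.\<close>
    have dom': "norm ((f (x + X n *\<^sub>R v) - f x) / X n * \<phi> x) \<le> w x" for n x
      using dom[OF X(2)[of n], of x] L0 B0 by (cases "X n = 0") (auto simp: w_def)
    have m: "(\<lambda>x. (f (x + X n *\<^sub>R v) - f x) / X n * \<phi> x) \<in> borel_measurable lborel" for n
      by simp
    have m': "(\<lambda>x. ddir f v x * \<phi> x) \<in> borel_measurable lborel"
      by simp
    note dc = m' m w lim[OF X(1)] always_eventually[OF allI[OF dom']]
    show ?thesis
      using integrable_dominated_convergence[OF dc] integral_dominated_convergence[OF dc] ..
  qed
  \<comment> \<open>One concrete null sequence inside the margin \<open>e'\<close> is enough to
    extract integrability of the limit.\<close>
  define X0 where "X0 n = e' / 2 * (1 / real (Suc n))" for n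
  have "integrable lborel (\<lambda>x. ddir f v x * \<phi> x)"
  proof (rule dct[THEN conjunct1, of X0])
    have "X0 \<longlonglongrightarrow> e'/2 * 0" unfolding X0_def
      by (intro tendsto_mult tendsto_const LIMSEQ_Suc[OF lim_1_over_n[where 'a=real]])
    then show "filterlim X0 (at 0) sequentially" using e' by (auto simp: filterlim_at X0_def)
    show "\<bar>X0 n\<bar> < e'" for n
    proof -
      have "e'/2 * (1 / real (Suc n)) \<le> e'/2 * 1" using e' by (intro mult_left_mono) auto
      moreover have "0 \<le> e'/2 * (1 / real (Suc n))" using e' by simp
      ultimately show ?thesis using e' unfolding X0_def by linarith
    qed
  qed
  then show "integrable lborel (\<lambda>x. ddir f v x * \<phi> x)" .
  have ev: "eventually (\<lambda>k. (LINT x|lborel. (f (x + k *\<^sub>R v) - f x) / k * \<phi> x)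
      = (LINT x|lborel. f x * ((\<phi> (x - k *\<^sub>R v) - \<phi> x) / k))) (at 0)"
  proof -
    have "eventually (\<lambda>k. \<bar>k\<bar> < e') (at 0)"
      unfolding eventually_at using e' by (intro exI[of _ e']) (auto simp: dist_norm)
    then show ?thesis by eventually_elim (rule eq[symmetric])
  qed
  have "((\<lambda>k. LINT x|lborel. (f (x + k *\<^sub>R v) - f x) / k * \<phi> x)
           \<longlongrightarrow> (LINT x|lborel. ddir f v x * \<phi> x)) (at 0)"
    unfolding tendsto_at_iff_sequentially comp_def
  proof (intro allI impI)
    fix X :: "nat \<Rightarrow> real" assume X: "\<forall>i. X i \<in> UNIV - {0}" "X \<longlonglongrightarrow> 0"
    obtain N where N: "\<And>n. n \<ge> N \<Longrightarrow> \<bar>X n\<bar> < e'"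
      using LIMSEQ_D[OF X(2) e'] by auto
    have "filterlim (\<lambda>n. X (n + N)) (at 0) sequentially"
      using X LIMSEQ_ignore_initial_segment[OF X(2), of N] by (auto simp: filterlim_at)
    from dct[OF this] N
    have "(\<lambda>n. LINT x|lborel. (f (x + X (n + N) *\<^sub>R v) - f x) / X (n + N) * \<phi> x) \<longlonglongrightarrow> (LINT x|lborel. ddir f v x * \<phi> x)"
      by simp
    then show "(\<lambda>n. LINT x|lborel. (f (x + X n *\<^sub>R v) - f x) / X n * \<phi> x) \<longlonglongrightarrow> (LINT x|lborel. ddir f v x * \<phi> x)"
      by (rule LIMSEQ_offset)
  qed
  then show "((\<lambda>k. LINT x|lborel. f x * ((\<phi> (x - k *\<^sub>R v) - \<phi> x) / k))
           \<longlongrightarrow> (LINT x|lborel. ddir f v x * \<phi> x)) (at 0)"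
    by (rule Lim_transform_eventually[OF _ ev])
qed



section \<open>Averages against C^1 bumps\<close>

definition bump :: "'a::euclidean_space \<Rightarrow> real \<Rightarrow> 'a \<Rightarrow> real" where
  "bump q \<rho> x = (max 0 (\<rho>\<^sup>2 - (x - q) \<bullet> (x - q)))\<^sup>2"

lemma bump_nonneg [simp]: "bump q \<rho> x \<ge> 0"
  by (simp add: bump_def)

lemma bump_eq_0:
  assumes "x \<notin> cball q \<rho>" "\<rho> > 0" shows "bump q \<rho> x = 0"
proof -
  have "\<rho>\<^sup>2 \<le> (norm (x - q))\<^sup>2"
    using assms by (intro power_mono) (auto simp: dist_norm norm_minus_commute)
  then show ?thesis by (simp add: bump_def power2_norm_eq_inner)
qed

lemma bump_shift: "bump q \<rho> (x - a) = bump (q + a) \<rho> x"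
  by (simp add: bump_def algebra_simps)

lemma continuous_on_bump [continuous_intros]: "continuous_on A (bump q \<rho>)"
  unfolding bump_def by (intro continuous_intros)

lemma borel_measurable_bump [measurable]: "bump q \<rho> \<in> borel_measurable borel"
  by (intro borel_measurable_continuous_onI continuous_on_bump)

lemma bump_le: "bump q \<rho> x \<le> \<rho> ^ 4"
proof -
  have "bump q \<rho> x \<le> (\<rho>\<^sup>2)\<^sup>2" unfolding bump_def by (intro power_mono) auto
  then show ?thesis by simp
qed

lemma integrable_bump: "\<rho> > 0 \<Longrightarrow> integrable lborel (bump q \<rho>)"
  by (rule integrable_bounded_compact_support[where K="cball q \<rho>" and B="\<rho> ^ 4"])
     (auto intro: bump_le bump_eq_0)

lemma integral_bump_pos:
  assumes "\<rho> > 0"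
  shows "(LINT x|lborel. bump q \<rho> x) > 0"
proof -
  have "0 < measure lborel (cball q (\<rho>/2)) * (\<rho>\<^sup>2/2)\<^sup>2"
    using assms by (simp add: content_cball_pos)
  also have "\<dots> = (LINT x|lborel. indicator (cball q (\<rho>/2)) x * (\<rho>\<^sup>2/2)\<^sup>2)"
    by simp
  also have "\<dots> \<le> (LINT x|lborel. bump q \<rho> x)"
  proof (rule integral_mono)
    show "integrable lborel (\<lambda>x. indicator (cball q (\<rho>/2)) x * (\<rho>\<^sup>2/2)\<^sup>2)"
      by (intro integrable_mult_left integrable_real_indicator[OF _ emeasure_lborel_cball_finite]) auto
    fix x
    show "indicator (cball q (\<rho>/2)) x * (\<rho>\<^sup>2/2)\<^sup>2 \<le> bump q \<rho> x"
    proof (cases "x \<in> cball q (\<rho>/2)")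
      case True
      then have "(norm (x - q))\<^sup>2 \<le> (\<rho>/2)\<^sup>2"
        by (intro power_mono) (auto simp: dist_norm norm_minus_commute)
      also have "\<dots> \<le> \<rho>\<^sup>2 / 2" by (simp add: power2_eq_square)
      finally have "\<rho>\<^sup>2 / 2 \<le> \<rho>\<^sup>2 - (x - q) \<bullet> (x - q)"
        unfolding power2_norm_eq_inner by linarith
      then have "\<rho>\<^sup>2 / 2 \<le> max 0 (\<rho>\<^sup>2 - (x - q) \<bullet> (x - q))" by (rule max.coboundedI2)
      then have "(\<rho>\<^sup>2 / 2)\<^sup>2 \<le> bump q \<rho> x" unfolding bump_def by (intro power_mono) auto
      then show ?thesis using True by simp
    qed simp
  qed (rule integrable_bump[OF assms])
  finally show ?thesis .
qed

text \<open>The square makes the truncated paraboloid in \<open>bump\<close> C^1 across its bounding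
  sphere, which is the regularity asked of \<open>test_functions\<close>.\<close>

lemma has_real_derivative_max_0_squared:
  "((\<lambda>r. (max 0 r)\<^sup>2) has_real_derivative 2 * max 0 r) (at (r::real))"
proof -
  consider "r < 0" | "r > 0" | "r = 0" by linarith
  then show ?thesis
  proof cases
    case 1
    have "((\<lambda>r. 0) has_real_derivative 0) (at r)" by simp
    then have "((\<lambda>r. (max 0 r)\<^sup>2) has_real_derivative 0) (at r)"
      by (rule has_field_derivative_transform_within_open[of _ _ _ "{..<0}"]) (use 1 in auto)
    then show ?thesis using 1 by simp
  next
    case 2
    have "((\<lambda>r. r\<^sup>2) has_real_derivative 2 * r) (at r)" by (auto intro!: derivative_eq_intros)
    then have "((\<lambda>r. (max 0 r)\<^sup>2) has_real_derivative 2 * r) (at r)"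
      by (rule has_field_derivative_transform_within_open[of _ _ _ "{0<..}"]) (use 2 in auto)
    then show ?thesis using 2 by simp
  next
    case 3
    have "((\<lambda>h. (max 0 h)\<^sup>2 / h) \<longlongrightarrow> 0) (at (0::real))"
    proof (rule Lim_null_comparison)
      show "\<forall>\<^sub>F h in at 0. norm ((max 0 h)\<^sup>2 / h) \<le> norm (h::real)"
        by (intro always_eventually allI) (auto simp: max_def power2_eq_square)
      show "((\<lambda>h. norm h) \<longlongrightarrow> 0) (at (0::real))"
        by (intro tendsto_norm_zero tendsto_ident_at)
    qed
    then show ?thesis using 3 by (simp add: has_field_derivative_iff)
  qed
qed

lemma has_derivative_bump:
  "(bump q \<rho> has_derivative (\<lambda>v. - 4 * max 0 (\<rho>\<^sup>2 - (x - q) \<bullet> (x - q)) * ((x - q) \<bullet> v))) (at x)"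
proof -
  have "((\<lambda>x. \<rho>\<^sup>2 - (x - q) \<bullet> (x - q)) has_derivative (\<lambda>v. - 2 * ((x - q) \<bullet> v))) (at x)"
    by (auto intro!: derivative_eq_intros simp: inner_commute)
  from DERIV_compose_FDERIV[OF has_real_derivative_max_0_squared this]
  show ?thesis by (simp add: bump_def[abs_def] mult_ac)
qed

text \<open>Translation by \<open>s v\<close> makes the average of \<open>f\<close> against a bump differentiable in \<open>s\<close>, so the
  mean value theorem bounds its increment; letting the bump shrink recovers \<open>f\<close>.\<close>

lemma averaged_increment_bound:
  fixes f :: "'a::euclidean_space \<Rightarrow> real"
  assumes S: "open S" "convex S" and [measurable]: "f \<in> borel_measurable borel"
    and cont: "continuous_on S f" and p: "p \<in> S" "p + t *\<^sub>R v \<in> S" and t: "t > 0"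
    and deriv: "\<And>q \<rho>. \<rho> > 0 \<Longrightarrow> cball q \<rho> \<subseteq> S \<Longrightarrow> \<exists>A'. \<bar>A'\<bar> \<le> \<epsilon> * (LINT x|lborel. bump q \<rho> x) \<and>
        ((\<lambda>k. LINT x|lborel. f x * ((bump q \<rho> (x - k *\<^sub>R v) - bump q \<rho> x) / k)) \<longlongrightarrow> A') (at 0)"
  shows "\<bar>f (p + t *\<^sub>R v) - f p\<bar> \<le> \<epsilon> * t"
proof (rule field_le_epsilon)
  fix e :: real assume e: "e > 0"
  obtain r1 r2 where r: "r1 > 0" "cball p r1 \<subseteq> S" "r2 > 0" "cball (p + t *\<^sub>R v) r2 \<subseteq> S"
    using S(1) p by (meson open_contains_cball)
  obtain d1 where d1: "d1 > 0" "\<And>x. x \<in> S \<Longrightarrow> dist x p < d1 \<Longrightarrow> dist (f x) (f p) < e/2"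
    using cont p(1) e unfolding continuous_on_iff by (metis half_gt_zero)
  obtain d2 where d2: "d2 > 0" "\<And>x. x \<in> S \<Longrightarrow> dist x (p + t *\<^sub>R v) < d2 \<Longrightarrow> dist (f x) (f (p + t *\<^sub>R v)) < e/2"
    using cont p(2) e unfolding continuous_on_iff by (metis half_gt_zero)
  define r where "r = min r1 r2"
  define \<rho> where "\<rho> = min (r/2) (min (d1/2) (d2/2))"
  have \<rho>: "\<rho> > 0" "\<rho> < r" "\<rho> < d1" "\<rho> < d2" using r d1 d2 by (auto simp: \<rho>_def r_def)
  define \<phi> where "\<phi> = bump p \<rho>"
  define b where "b = (LINT x|lborel. \<phi> x)"
  have b: "b > 0" unfolding b_def \<phi>_def by (rule integral_bump_pos[OF \<rho>(1)])
  have i\<phi>: "integrable lborel \<phi>" unfolding \<phi>_def by (rule integrable_bump[OF \<rho>(1)])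
  have sub: "cball (p + s *\<^sub>R v) r \<subseteq> S" if s: "0 \<le> s" "s \<le> t" for s
  proof
    fix y assume y: "y \<in> cball (p + s *\<^sub>R v) r"
    define z where "z = y - (p + s *\<^sub>R v)"
    have "norm z \<le> r" using y by (simp add: z_def dist_norm norm_minus_commute)
    then have 1: "p + z \<in> S" "p + t *\<^sub>R v + z \<in> S" using r by (auto simp: subset_iff dist_norm r_def)
    \<comment> \<open>A ball about an intermediate point is swept out by segments joining the two
      end balls, so convexity keeps it inside \<open>S\<close>.\<close>
    have "(1 - s / t) *\<^sub>R (p + z) + (s / t) *\<^sub>R (p + t *\<^sub>R v + z) \<in> S"
      using s t by (intro convexD_alt[OF S(2) 1]) auto
    also have "(1 - s / t) *\<^sub>R (p + z) + (s / t) *\<^sub>R (p + t *\<^sub>R v + z) = y"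
      using t by (simp add: z_def algebra_simps)
    finally show "y \<in> S" .
  qed
  have \<phi>s: "\<phi> (x - s *\<^sub>R v) = bump (p + s *\<^sub>R v) \<rho> x" for x s
    by (simp add: \<phi>_def bump_shift)
  have int: "integrable lborel (\<lambda>x. f x * bump q \<rho> x)" if q: "cball q \<rho> \<subseteq> S" for q
  proof -
    have "bounded (f ` cball q \<rho>)"
      by (intro compact_imp_bounded compact_continuous_image continuous_on_subset[OF cont q]) auto
    then obtain F where F: "\<And>x. x \<in> cball q \<rho> \<Longrightarrow> \<bar>f x\<bar> \<le> F"
      by (metis bounded_iff imageI real_norm_def)
    show ?thesis
    proof (rule integrable_bounded_compact_support[where K="cball q \<rho>" and B="\<bar>F\<bar> * \<rho> ^ 4"])
      fix x show "\<bar>f x * bump q \<rho> x\<bar> \<le> \<bar>F\<bar> * \<rho> ^ 4"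
        using F[of x] bump_le[of q \<rho> x] bump_eq_0[of x q \<rho>] \<rho>(1)
        by (cases "x \<in> cball q \<rho>") (auto simp: abs_mult intro!: mult_mono)
    qed (auto simp: bump_eq_0 \<rho>(1))
  qed
  define A where "A s = (LINT x|lborel. f x * \<phi> (x - s *\<^sub>R v))" for s
  have der: "\<exists>A'. (A has_real_derivative A') (at s) \<and> \<bar>A'\<bar> \<le> \<epsilon> * b"
    if s: "0 \<le> s" "s \<le> t" for s
  proof -
    let ?q = "p + s *\<^sub>R v"
    have q: "cball ?q \<rho> \<subseteq> S" using sub[OF s] \<rho> by (auto simp: subset_iff)
    have "(LINT x|lborel. bump ?q \<rho> x) = b"
      using lborel_integral_translate[of \<phi> "- (s *\<^sub>R v)"] by (simp add: b_def \<phi>_def bump_shift)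
    then obtain A' where A': "\<bar>A'\<bar> \<le> \<epsilon> * b"
      "((\<lambda>k. LINT x|lborel. f x * ((bump ?q \<rho> (x - k *\<^sub>R v) - bump ?q \<rho> x) / k)) \<longlongrightarrow> A') (at 0)"
      using deriv[OF \<rho>(1) q] by auto
    have "eventually (\<lambda>k. \<bar>k\<bar> < (r - \<rho>) / (norm v + 1)) (at 0)"
      unfolding eventually_at using \<rho>
      by (intro exI[of _ "(r - \<rho>) / (norm v + 1)"]) (auto simp: add_nonneg_pos)
    then have "eventually (\<lambda>k. (LINT x|lborel. f x * ((bump ?q \<rho> (x - k *\<^sub>R v) - bump ?q \<rho> x) / k)) = (A (s + k) - A s) / k) (at 0)"
    proof eventually_elim
      case (elim k)
      have "\<bar>k\<bar> * norm v \<le> \<bar>k\<bar> * (norm v + 1)" by (simp add: mult_left_mono)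
      also have "\<dots> < r - \<rho>" using elim by (simp add: pos_less_divide_eq add_nonneg_pos)
      finally have k: "norm (k *\<^sub>R v) < r - \<rho>" by simp
      have "cball (p + (s + k) *\<^sub>R v) \<rho> \<subseteq> cball ?q r"
      proof
        fix y assume "y \<in> cball (p + (s + k) *\<^sub>R v) \<rho>"
        moreover have "dist ?q y \<le> dist ?q (p + (s + k) *\<^sub>R v) + dist (p + (s + k) *\<^sub>R v) y"
          by (rule dist_triangle)
        moreover have "dist ?q (p + (s + k) *\<^sub>R v) = norm (k *\<^sub>R v)"
          by (simp add: dist_norm algebra_simps)
        ultimately show "y \<in> cball ?q r" using k by simp
      qed
      then have q': "cball (p + (s + k) *\<^sub>R v) \<rho> \<subseteq> S" using sub[OF s] by blast
      have "(A (s + k) - A s) / k = (LINT x|lborel. (f x * bump (p + (s + k) *\<^sub>R v) \<rho> x - f x * bump ?q \<rho> x) / k)"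
        unfolding A_def \<phi>s using int[OF q] int[OF q'] by simp
      also have "\<dots> = (LINT x|lborel. f x * ((bump ?q \<rho> (x - k *\<^sub>R v) - bump ?q \<rho> x) / k))"
        by (intro Bochner_Integration.integral_cong refl) (simp add: bump_shift algebra_simps)
      finally show ?case by (rule sym)
    qed
    from Lim_transform_eventually[OF A'(2) this] A'(1) show ?thesis
      by (auto simp: DERIV_def)
  qed
  then obtain A' where A': "\<And>s. 0 \<le> s \<Longrightarrow> s \<le> t \<Longrightarrow> (A has_real_derivative A' s) (at s)"
    "\<And>s. 0 \<le> s \<Longrightarrow> s \<le> t \<Longrightarrow> \<bar>A' s\<bar> \<le> \<epsilon> * b" by metis
  obtain z where z: "z > 0" "z < t" "A t - A 0 = (t - 0) * A' z"
    using MVT2[OF t, of A A'] A' by auto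
  have A: "\<bar>A t - A 0\<bar> \<le> t * (\<epsilon> * b)"
    using A'(2)[of z] z t by (simp add: abs_mult)
  have qt: "cball (p + t *\<^sub>R v) \<rho> \<subseteq> S" "cball p \<rho> \<subseteq> S"
    using sub[of t] sub[of 0] t \<rho> by (auto simp: subset_iff)
  have At: "A t = (LINT x|lborel. f (x + t *\<^sub>R v) * \<phi> x)"
    using lborel_integral_translate[of "\<lambda>x. f x * \<phi> (x - t *\<^sub>R v)" "t *\<^sub>R v"] by (simp add: A_def \<phi>_def)
  have iAt: "integrable lborel (\<lambda>x. f (x + t *\<^sub>R v) * \<phi> x)"
  proof -
    have "integrable (distr lborel borel ((+) (t *\<^sub>R v))) (\<lambda>x. f x * bump (p + t *\<^sub>R v) \<rho> x)"
      using int[OF qt(1)] by (simp add: lborel_distr_plus)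
    then show ?thesis
      by (subst (asm) integrable_distr_eq) (auto simp: \<phi>_def bump_shift[symmetric] algebra_simps)
  qed
  have A0: "A 0 = (LINT x|lborel. f x * \<phi> x)" by (simp add: A_def)
  have iA0: "integrable lborel (\<lambda>x. f x * \<phi> x)" using int[OF qt(2)] by (simp add: \<phi>_def)
  define d where "d = f (p + t *\<^sub>R v) - f p"
  \<comment> \<open>The pointwise increment \<open>d\<close> is compared with the averaged one: on
    the support of the bump each endpoint value changes by less than e/2, so the discrepancy is at
    most \<open>e * b\<close>.\<close>
  have "d * b = (LINT x|lborel. d * \<phi> x)" by (simp add: b_def)
  also have "\<dots> = (A t - A 0) + (LINT x|lborel. (d - (f (x + t *\<^sub>R v) - f x)) * \<phi> x)"
    using iAt iA0 i\<phi> by (simp add: At A0 left_diff_distrib)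
  finally have "\<bar>d * b\<bar> \<le> \<bar>A t - A 0\<bar> + \<bar>LINT x|lborel. (d - (f (x + t *\<^sub>R v) - f x)) * \<phi> x\<bar>"
    by linarith
  also have "\<bar>LINT x|lborel. (d - (f (x + t *\<^sub>R v) - f x)) * \<phi> x\<bar> \<le> (LINT x|lborel. e * \<phi> x)"
  proof (rule order_trans[OF integral_abs_bound], rule integral_mono)
    have "integrable lborel (\<lambda>x. (d - (f (x + t *\<^sub>R v) - f x)) * \<phi> x)"
      using iAt iA0 i\<phi> by (simp add: left_diff_distrib)
    then show "integrable lborel (\<lambda>x. \<bar>(d - (f (x + t *\<^sub>R v) - f x)) * \<phi> x\<bar>)" by (rule integrable_abs)
    fix x
    show "\<bar>(d - (f (x + t *\<^sub>R v) - f x)) * \<phi> x\<bar> \<le> e * \<phi> x"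
    proof (cases "x \<in> cball p \<rho>")
      case True
      have xS: "x \<in> S" "x + t *\<^sub>R v \<in> S"
        using True qt by (auto simp: subset_iff dist_norm)
      have "\<bar>f x - f p\<bar> < e/2"
        using d1(2)[OF xS(1)] True \<rho> by (auto simp: dist_real_def dist_commute)
      moreover have "\<bar>f (x + t *\<^sub>R v) - f (p + t *\<^sub>R v)\<bar> < e/2"
        using d2(2)[OF xS(2)] True \<rho> by (auto simp: dist_real_def dist_commute)
      ultimately have "\<bar>d - (f (x + t *\<^sub>R v) - f x)\<bar> \<le> e"
        unfolding d_def by linarith
      then show ?thesis by (simp add: abs_mult mult_right_mono \<phi>_def)
    qed (simp add: \<phi>_def bump_eq_0 \<rho>(1))
  qed (use i\<phi> in simp)
  also have "(LINT x|lborel. e * \<phi> x) = e * b" by (simp add: b_def)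
  finally have "\<bar>d\<bar> * b \<le> (\<epsilon> * t + e) * b"
    using A b by (simp add: abs_mult algebra_simps)
  then show "\<bar>f (p + t *\<^sub>R v) - f p\<bar> \<le> \<epsilon> * t + e" using b by (simp add: d_def)
qed

text \<open>A segment can be a null set, so an a.e. bound on the derivative cannot be integrated
  along it. Averaging over nearby parallel segments sees the bound, and continuity brings it back to
  the given one.\<close>

lemma directional_derivative_bound:
  fixes f :: "'a::euclidean_space \<Rightarrow> real"
  assumes S: "open S" "convex S" and lip: "L-lipschitz_on S f"
    and diff: "AE x in lborel. x \<in> S \<longrightarrow> (\<exists>D. (f has_derivative D) (at x) \<and> \<bar>D v\<bar> \<le> \<epsilon>)"
    and p: "p \<in> S" "p + t *\<^sub>R v \<in> S" and t: "t > 0"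
  shows "\<bar>f (p + t *\<^sub>R v) - f p\<bar> \<le> \<epsilon> * t"
proof -
  define f' where "f' x = indicator S x *\<^sub>R f x" for x
  have f'S: "f' x = f x" if "x \<in> S" for x using that by (simp add: f'_def)
  have f'm[measurable]: "f' \<in> borel_measurable borel"
    unfolding f'_def[abs_def]
    using borel_measurable_continuous_on_indicator[OF _ lipschitz_on_continuous_on[OF lip]] S by auto
  have lip': "L-lipschitz_on S f'"
    using lip by (simp add: lipschitz_on_def f'S)
  have diff': "AE x in lborel. x \<in> S \<longrightarrow> (\<exists>D. (f' has_derivative D) (at x) \<and> \<bar>D v\<bar> \<le> \<epsilon>)"
    using diff
  proof eventually_elim
    case (elim x)
    show ?case
    proof
      assume x: "x \<in> S"
      then obtain D where D: "(f has_derivative D) (at x)" "\<bar>D v\<bar> \<le> \<epsilon>" using elim by blast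
      have "(f' has_derivative D) (at x)"
        by (rule has_derivative_transform_within_open[OF D(1) S(1) x]) (simp add: f'S)
      then show "\<exists>D. (f' has_derivative D) (at x) \<and> \<bar>D v\<bar> \<le> \<epsilon>" using D(2) by blast
    qed
  qed
  have "\<bar>f' (p + t *\<^sub>R v) - f' p\<bar> \<le> \<epsilon> * t"
  proof (rule averaged_increment_bound[OF S f'm lipschitz_on_continuous_on[OF lip'] p t])
    fix q :: 'a and \<rho> :: real assume q: "\<rho> > 0" "cball q \<rho> \<subseteq> S"
    have d: "AE x in lborel. x \<in> cball q \<rho> \<longrightarrow> (\<exists>D. (f' has_derivative D) (at x))"
      using diff' by eventually_elim (use q in blast)
    have "\<bar>bump q \<rho> x\<bar> \<le> \<rho> ^ 4" for x using bump_le[of q \<rho> x] by simp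
    note L = integral_diff_quotient_tendsto[OF f'm lip' S(1) borel_measurable_bump this compact_cball q(2) bump_eq_0[OF _ q(1)] d, of v]
    have "\<bar>LINT x|lborel. ddir f' v x * bump q \<rho> x\<bar> \<le> (LINT x|lborel. \<bar>ddir f' v x * bump q \<rho> x\<bar>)"
      by (rule integral_abs_bound)
    also have "\<dots> \<le> (LINT x|lborel. \<epsilon> * bump q \<rho> x)"
    proof (rule integral_mono_AE)
      show "AE x in lborel. \<bar>ddir f' v x * bump q \<rho> x\<bar> \<le> \<epsilon> * bump q \<rho> x"
        using diff'
      proof eventually_elim
        case (elim x)
        show ?case
        proof (cases "x \<in> cball q \<rho>")
          case True
          then obtain D where D: "(f' has_derivative D) (at x)" "\<bar>D v\<bar> \<le> \<epsilon>" using q elim by blast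
          show ?thesis using D(2)
            by (simp add: ddir_eq[OF D(1)] abs_mult mult_right_mono)
        qed (simp add: bump_eq_0 q)
      qed
    qed (use L(1) integrable_bump[OF q(1)] in auto)
    also have "\<dots> = \<epsilon> * (LINT x|lborel. bump q \<rho> x)" by simp
    finally show "\<exists>A'. \<bar>A'\<bar> \<le> \<epsilon> * (LINT x|lborel. bump q \<rho> x) \<and>
        ((\<lambda>k. LINT x|lborel. f' x * ((bump q \<rho> (x - k *\<^sub>R v) - bump q \<rho> x) / k)) \<longlongrightarrow> A') (at 0)"
      using L(2) by blast
  qed
  then show ?thesis by (simp add: f'S p)
qed

declare split_paired_All [simp del] split_paired_Ex [simp del]

section \<open>Weak derivatives on the half-plane\<close>

lemma open_halfplane: "open halfplane"
  unfolding halfplane_def by (intro open_Times open_UNIV open_greaterThan)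

lemma convex_halfplane: "convex halfplane"
  unfolding halfplane_def by (intro convex_Times) auto

lemma halfplane_iff: "x \<in> halfplane \<longleftrightarrow> snd x > 0"
  by (auto simp: halfplane_def mem_Times_iff)

lemma halfplane_sets [measurable]: "halfplane \<in> sets borel"
  using open_halfplane by (rule borel_open)

text \<open>The definitions use completed Lebesgue measure on the half-plane, while translations and
  affine substitutions are done for \<open>lborel\<close>; a Borel extension by zero passes between
  the two.\<close>

lemma integral_halfplane_eq:
  fixes g h :: "real \<times> real \<Rightarrow> real"
  assumes "h \<in> borel_measurable borel" "\<And>x. x \<notin> halfplane \<Longrightarrow> h x = 0"
    "\<And>x. x \<in> halfplane \<Longrightarrow> g x = h x"
  shows "(LINT x|lebesgue_on halfplane. g x) = (LINT x|lborel. h x)"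
proof -
  have "(LINT x|lebesgue_on halfplane. g x) = (LINT x|lebesgue. indicator halfplane x *\<^sub>R g x)"
    by (rule integral_restrict_space) auto
  also have "(\<lambda>x. indicator halfplane x *\<^sub>R g x) = h"
    using assms(2,3) by (auto simp: fun_eq_iff indicator_def)
  also have "(LINT x|lebesgue. h x) = (LINT x|lborel. h x)"
    using assms(1) by (intro integral_completion) auto
  finally show ?thesis .
qed

lemma AE_halfplane_iff: "(AE x in lebesgue_on halfplane. P x) \<longleftrightarrow> (AE x in lborel. x \<in> halfplane \<longrightarrow> P x)"
  by (simp add: AE_restrict_space_iff AE_completion_iff)

lemma test_function_facts:
  assumes \<phi>: "\<phi> \<in> test_functions"
  obtains K B where "compact K" "K \<subseteq> halfplane" "\<And>x. x \<notin> K \<Longrightarrow> \<phi> x = 0"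
    "\<And>x. x \<notin> K \<Longrightarrow> frechet_derivative \<phi> (at x) v = 0"
    "\<And>x. \<bar>frechet_derivative \<phi> (at x) v\<bar> \<le> B" "\<And>x. \<bar>\<phi> x\<bar> \<le> B"
    "\<phi> \<in> borel_measurable borel" "(\<lambda>x. frechet_derivative \<phi> (at x) v) \<in> borel_measurable borel"
    "\<And>x k. \<bar>\<phi> (x - k *\<^sub>R v) - \<phi> x\<bar> \<le> B * \<bar>k\<bar>"
proof -
  define K where "K = closure {x. \<phi> x \<noteq> 0}"
  have K: "compact K" "K \<subseteq> halfplane" and diff: "\<And>x. \<phi> differentiable (at x)"
    and cont: "continuous_on UNIV (\<lambda>x. frechet_derivative \<phi> (at x) v)"
    using assms[unfolded test_functions_def mem_Collect_eq, folded K_def] by blast+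
  have \<phi>0: "\<phi> x = 0" if "x \<notin> K" for x
    using that closure_subset[of "{x. \<phi> x \<noteq> 0}"] by (auto simp: K_def)
  have d0: "frechet_derivative \<phi> (at x) v = 0" if "x \<notin> K" for x
  proof -
    have o: "open (- K)" using compact_imp_closed[OF K(1)] by (simp add: open_Compl)
    have "((\<lambda>x. 0::real) has_derivative (\<lambda>v. 0)) (at x)" by simp
    then have "(\<phi> has_derivative (\<lambda>v. 0)) (at x)"
      by (rule has_derivative_transform_within_open[OF _ o]) (use that \<phi>0 in auto)
    from frechet_derivative_at[OF this] show ?thesis by metis
  qed
  have contphi: "continuous_on UNIV \<phi>"
    by (meson continuous_at_imp_continuous_on diff differentiable_imp_continuous_within)
  have "bounded ((\<lambda>x. frechet_derivative \<phi> (at x) v) ` K)"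
    using compact_imp_bounded[OF compact_continuous_image[OF continuous_on_subset[OF cont subset_UNIV] K(1)]] .
  then obtain B1 where B1: "\<forall>x\<in>K. \<bar>frechet_derivative \<phi> (at x) v\<bar> \<le> B1"
    by (auto simp: bounded_iff)
  have "bounded (\<phi> ` K)"
    using compact_imp_bounded[OF compact_continuous_image[OF continuous_on_subset[OF contphi subset_UNIV] K(1)]] .
  then obtain B2 where B2: "\<forall>x\<in>K. \<bar>\<phi> x\<bar> \<le> B2"
    by (auto simp: bounded_iff)
  define B where "B = max 0 (max B1 B2)"
  have b1: "\<bar>frechet_derivative \<phi> (at x) v\<bar> \<le> B" for x
    using B1 d0[of x] by (cases "x \<in> K") (auto simp: B_def)
  have b2: "\<bar>\<phi> x\<bar> \<le> B" for x
    using B2 \<phi>0[of x] by (cases "x \<in> K") (auto simp: B_def)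
  have b3: "\<bar>\<phi> (x - k *\<^sub>R v) - \<phi> x\<bar> \<le> B * \<bar>k\<bar>" for x k
  proof -
    have der: "((\<lambda>s. \<phi> (x - s *\<^sub>R v)) has_field_derivative - frechet_derivative \<phi> (at (x - s *\<^sub>R v)) v) (at s)" for s
    proof -
      let ?D = "frechet_derivative \<phi> (at (x - s *\<^sub>R v))"
      have D: "(\<phi> has_derivative ?D) (at (x - s *\<^sub>R v))"
        using diff frechet_derivative_works by blast
      interpret D: bounded_linear ?D using D by (rule has_derivative_bounded_linear)
      have "((\<lambda>s. \<phi> (x - s *\<^sub>R v)) has_derivative (\<lambda>k. ?D (- (k *\<^sub>R v)))) (at s)"
        by (rule has_derivative_compose[where f="\<lambda>s. x - s *\<^sub>R v" and g=\<phi>, OF _ D]) (auto intro!: derivative_eq_intros)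
      moreover have "(\<lambda>k. ?D (- (k *\<^sub>R v))) = (*) (- ?D v)"
        by (simp add: fun_eq_iff linear_neg[OF D.linear] D.scaleR)
      ultimately show ?thesis by (simp add: has_field_derivative_def)
    qed
    have "norm (\<phi> (x - k *\<^sub>R v) - \<phi> (x - 0 *\<^sub>R v)) \<le> B * norm (k - 0)"
      by (rule field_differentiable_bound[OF convex_UNIV der]) (simp_all add: b1)
    then show ?thesis by simp
  qed
  have m: "\<phi> \<in> borel_measurable borel" "(\<lambda>x. frechet_derivative \<phi> (at x) v) \<in> borel_measurable borel"
    by (intro borel_measurable_continuous_onI contphi cont)+
  show ?thesis
    by (rule that[OF K \<phi>0 d0 b1 b2 m b3])
qed

text \<open>The counterpart of \<open>integral_diff_quotient_tendsto\<close>: here the quotient is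
  resolved on the test function and \<open>f\<close> is merely continuous. Equating the two limits
  gives integration by parts for Lipschitz functions.\<close>

lemma test_function_diff_quotient_tendsto:
  assumes \<phi>: "\<phi> \<in> test_functions" and fm[measurable]: "f \<in> borel_measurable borel"
    and cont: "continuous_on halfplane f"
  shows "((\<lambda>k. LINT x|lborel. f x * ((\<phi> (x - k *\<^sub>R v) - \<phi> x) / k))
     \<longlongrightarrow> - (LINT x|lborel. f x * frechet_derivative \<phi> (at x) v)) (at 0)"
proof -
  obtain K B where K: "compact K" "K \<subseteq> halfplane" "\<And>x. x \<notin> K \<Longrightarrow> \<phi> x = 0"
    "\<And>x. x \<notin> K \<Longrightarrow> frechet_derivative \<phi> (at x) v = 0"
    and B: "\<And>x. \<bar>frechet_derivative \<phi> (at x) v\<bar> \<le> B" "\<And>x. \<bar>\<phi> x\<bar> \<le> B"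
    and m[measurable]: "\<phi> \<in> borel_measurable borel" "(\<lambda>x. frechet_derivative \<phi> (at x) v) \<in> borel_measurable borel"
    and lip: "\<And>x k. \<bar>\<phi> (x - k *\<^sub>R v) - \<phi> x\<bar> \<le> B * \<bar>k\<bar>"
    using test_function_facts[OF \<phi>, of v] by blast
  have B0: "B \<ge> 0" using B(2)[of 0] by linarith
  obtain e where e: "e > 0" "(\<Union>x\<in>K. cball x e) \<subseteq> halfplane"
    using compact_subset_open_imp_cball_epsilon_subset[OF K(1) open_halfplane K(2)] by metis
  \<comment> \<open>The closed \<open>e\<close>-neighbourhood of \<open>K\<close> carries every
    quotient with \<open>norm (k *\<^sub>R v) \<le> e\<close>, which yields one integrable majorant
    for all of them.\<close>
  define K' where "K' = {x + y |x y. x \<in> K \<and> y \<in> cball 0 e}"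
  have K': "compact K'" unfolding K'_def by (intro compact_sums K(1) compact_cball)
  have K'iff: "z \<in> K'" if "x \<in> K" "norm (z - x) \<le> e" for x z
    unfolding K'_def using that by (intro CollectI exI[of _ x] exI[of _ "z - x"]) simp
  have K'H: "K' \<subseteq> halfplane"
  proof
    fix z assume "z \<in> K'"
    then obtain x y where "x \<in> K" "norm y \<le> e" "z = x + y" by (auto simp: K'_def)
    then have "z \<in> cball x e" by (simp add: dist_norm)
    then show "z \<in> halfplane" using e(2) \<open>x \<in> K\<close> by blast
  qed
  have "bounded (f ` K')"
    using compact_imp_bounded[OF compact_continuous_image[OF continuous_on_subset[OF cont K'H] K']] .
  then obtain F where F: "\<forall>x\<in>K'. \<bar>f x\<bar> \<le> F" by (auto simp: bounded_iff)
  define w where "w x = \<bar>F\<bar> * B * indicator K' x" for x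
  have w: "integrable lborel w" unfolding w_def
    by (intro integrable_mult_right integrable_real_indicator)
       (use K' emeasure_bounded_finite[OF compact_imp_bounded[OF K']] in \<open>auto simp: compact_imp_closed\<close>)
  have dom: "norm (f x * ((\<phi> (x - k *\<^sub>R v) - \<phi> x) / k)) \<le> w x" if k: "norm (k *\<^sub>R v) \<le> e" for x k
  proof (cases "x \<in> K'")
    case True
    have "\<bar>(\<phi> (x - k *\<^sub>R v) - \<phi> x) / k\<bar> \<le> B" using lip[of x k] B0
      by (cases "k = 0") (auto simp: abs_div divide_simps)
    then have "\<bar>f x\<bar> * \<bar>(\<phi> (x - k *\<^sub>R v) - \<phi> x) / k\<bar> \<le> \<bar>F\<bar> * B"
      using bspec[OF F True] by (intro mult_mono) auto
    then show ?thesis using True by (simp add: w_def abs_mult)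
  next
    case False
    have "x \<notin> K" using False e(1) K'iff[of x x] by auto
    moreover have "x - k *\<^sub>R v \<notin> K" using False k K'iff[of "x - k *\<^sub>R v" x] by auto
    ultimately show ?thesis using K(3) B0 by (simp add: w_def)
  qed
  have lim: "((\<lambda>k. (\<phi> (x - k *\<^sub>R v) - \<phi> x) / k) \<longlongrightarrow> - frechet_derivative \<phi> (at x) v) (at 0)" for x
  proof -
    have D: "(\<phi> has_derivative frechet_derivative \<phi> (at x)) (at x)"
      using assms(1)[unfolded test_functions_def mem_Collect_eq] frechet_derivative_works by blast
    have "((\<lambda>k. (\<phi> (x + k *\<^sub>R (- v)) - \<phi> x) / k) \<longlongrightarrow> frechet_derivative \<phi> (at x) (- v)) (at 0)"
      by (rule has_derivative_imp_diff_quotient[OF D])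
    then show ?thesis
      using bounded_linear.linear[OF has_derivative_bounded_linear[OF D]] by (simp add: linear_neg)
  qed
  show ?thesis
    unfolding tendsto_at_iff_sequentially comp_def
  proof (intro allI impI)
    fix X :: "nat \<Rightarrow> real" assume X: "\<forall>i. X i \<in> UNIV - {0}" "X \<longlonglongrightarrow> 0"
    have "(\<lambda>n. norm (X n *\<^sub>R v)) \<longlonglongrightarrow> norm (0 *\<^sub>R v)"
      by (intro tendsto_intros X(2))
    then have "eventually (\<lambda>n. norm (X n *\<^sub>R v) < e) sequentially"
      using e(1) by (intro order_tendstoD(2)[of _ "norm (0 *\<^sub>R v)"]) auto
    then obtain N where N: "\<And>n. n \<ge> N \<Longrightarrow> norm (X n *\<^sub>R v) \<le> e"
      by (auto simp: eventually_sequentially intro: less_imp_le)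
    have Xlim: "filterlim (\<lambda>n. X (n + N)) (at 0) sequentially"
      using X LIMSEQ_ignore_initial_segment[OF X(2), of N] by (auto simp: filterlim_at)
    have "(\<lambda>n. LINT x|lborel. f x * ((\<phi> (x - X (n + N) *\<^sub>R v) - \<phi> x) / X (n + N)))
       \<longlonglongrightarrow> (LINT x|lborel. f x * (- frechet_derivative \<phi> (at x) v))"
    proof (rule integral_dominated_convergence[where w=w])
      show "AE x in lborel. (\<lambda>n. f x * ((\<phi> (x - X (n + N) *\<^sub>R v) - \<phi> x) / X (n + N)))
          \<longlonglongrightarrow> f x * - frechet_derivative \<phi> (at x) v"
        by (intro always_eventually allI tendsto_mult tendsto_const filterlim_compose[OF lim Xlim])
      show "AE x in lborel. norm (f x * ((\<phi> (x - X (n + N) *\<^sub>R v) - \<phi> x) / X (n + N))) \<le> w x" for n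
        by (intro always_eventually allI dom N) simp
    qed (simp_all add: w)
    then have "(\<lambda>n. LINT x|lborel. f x * ((\<phi> (x - X n *\<^sub>R v) - \<phi> x) / X n))
       \<longlonglongrightarrow> (LINT x|lborel. f x * (- frechet_derivative \<phi> (at x) v))"
      by (rule LIMSEQ_offset)
    then show "(\<lambda>n. LINT x|lborel. f x * ((\<phi> (x - X n *\<^sub>R v) - \<phi> x) / X n))
       \<longlonglongrightarrow> - (LINT x|lborel. f x * frechet_derivative \<phi> (at x) v)" by simp
  qed
qed

lemma bump_test_function:
  fixes q :: "real \<times> real"
  assumes "\<rho> > 0" "cball q \<rho> \<subseteq> halfplane"
  shows "bump q \<rho> \<in> test_functions"
  unfolding test_functions_def mem_Collect_eq
proof (intro conjI allI)
  have fd: "frechet_derivative (bump q \<rho>) (at x) = (\<lambda>v. - 4 * max 0 (\<rho>\<^sup>2 - (x - q) \<bullet> (x - q)) * ((x - q) \<bullet> v))" for x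
    using frechet_derivative_at[OF has_derivative_bump] by metis
  show "bump q \<rho> differentiable at x" for x
    using has_derivative_bump by (rule differentiableI)
  show "continuous_on UNIV (\<lambda>x. frechet_derivative (bump q \<rho>) (at x) v)" for v
    unfolding fd by (intro continuous_intros)
  have "{x. bump q \<rho> x \<noteq> 0} \<subseteq> cball q \<rho>" using bump_eq_0 assms(1) by blast
  then have *: "closure {x. bump q \<rho> x \<noteq> 0} \<subseteq> cball q \<rho>" by (simp add: closure_minimal)
  then show "compact (closure {x. bump q \<rho> x \<noteq> 0})"
    by (metis bounded_cball bounded_subset closed_closure compact_eq_bounded_closed)
  show "closure {x. bump q \<rho> x \<noteq> 0} \<subseteq> halfplane" using * assms(2) by blast
qed

text \<open>The derivative of the bump average is read off from the weak-derivative identity.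
  Continuity selects the representative for which the increment bound holds at every point.\<close>

lemma weak_deriv_increment_bound:
  assumes wd: "has_weak_deriv v f g" and cont: "continuous_on halfplane f"
    and S: "open S" "convex S" "S \<subseteq> halfplane"
    and g: "AE x in lborel. x \<in> S \<longrightarrow> \<bar>g x\<bar> \<le> M"
    and p: "p \<in> S" "p + t *\<^sub>R v \<in> S" and t: "t > 0" and M: "M \<ge> 0"
  shows "\<bar>f (p + t *\<^sub>R v) - f p\<bar> \<le> M * t"
proof -
  define f' where "f' x = indicator halfplane x *\<^sub>R f x" for x
  have f'H: "f' x = f x" if "x \<in> halfplane" for x using that by (simp add: f'_def)
  have f'm[measurable]: "f' \<in> borel_measurable borel"
    unfolding f'_def[abs_def]
    using borel_measurable_continuous_on_indicator[OF _ cont] by auto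
  have cont': "continuous_on halfplane f'" using cont by (simp add: f'H cong: continuous_on_cong)
  have "\<bar>f' (p + t *\<^sub>R v) - f' p\<bar> \<le> M * t"
  proof (rule averaged_increment_bound[OF S(1,2) f'm continuous_on_subset[OF cont' S(3)] p t])
    fix q \<rho> assume q: "\<rho> > 0" "cball q \<rho> \<subseteq> S"
    have tf: "bump q \<rho> \<in> test_functions" using q S(3) by (intro bump_test_function) auto
    obtain K B where K: "\<And>x. x \<notin> K \<Longrightarrow> frechet_derivative (bump q \<rho>) (at x) v = 0" "K \<subseteq> halfplane"
      and fm[measurable]: "(\<lambda>x. frechet_derivative (bump q \<rho>) (at x) v) \<in> borel_measurable borel"
      using test_function_facts[OF tf, of v] by metis
    have "(LINT x|lborel. f' x * frechet_derivative (bump q \<rho>) (at x) v) =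
       (LINT x|lebesgue_on halfplane. f x * frechet_derivative (bump q \<rho>) (at x) v)"
    proof (rule integral_halfplane_eq[symmetric])
      show "(\<lambda>x. f' x * frechet_derivative (bump q \<rho>) (at x) v) \<in> borel_measurable borel"
        by (intro borel_measurable_times f'm fm)
    qed (simp_all add: f'_def)
    also have "\<dots> = - (LINT x|lebesgue_on halfplane. g x * bump q \<rho> x)"
      using wd tf by (simp add: has_weak_deriv_def)
    finally have eq: "- (LINT x|lborel. f' x * frechet_derivative (bump q \<rho>) (at x) v) = (LINT x|lebesgue_on halfplane. g x * bump q \<rho> x)"
      by simp
    \<comment> \<open>Only the majorant has to be integrable: a non-integrable integrand has
      integral 0 by convention, and the majorant is nonnegative.\<close>
    have "\<bar>LINT x|lebesgue_on halfplane. g x * bump q \<rho> x\<bar> \<le> (LINT x|lebesgue_on halfplane. M * bump q \<rho> x)"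
    proof (rule order_trans[OF integral_abs_bound], rule integral_mono_AE')
      have "integrable lborel (bump q \<rho>)" using q by (intro integrable_bump)
      then have "integrable lebesgue (\<lambda>x. M * bump q \<rho> x)"
        by (subst integrable_completion) auto
      then show "integrable (lebesgue_on halfplane) (\<lambda>x. M * bump q \<rho> x)"
        by (subst integrable_restrict_space) (use integrable_mult_indicator[of halfplane lebesgue "\<lambda>x. M * bump q \<rho> x"] in auto)
      show "AE x in lebesgue_on halfplane. \<bar>g x * bump q \<rho> x\<bar> \<le> M * bump q \<rho> x"
        unfolding AE_halfplane_iff using g
      proof eventually_elim
        case (elim x)
        show ?case
        proof (cases "x \<in> cball q \<rho>")
          case True
          then show ?thesis using elim q by (auto simp: abs_mult intro!: mult_right_mono)
        qed (simp add: bump_eq_0 q)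
      qed
    qed (use M in \<open>auto intro!: always_eventually\<close>)
    also have "\<dots> = (LINT x|lborel. M * bump q \<rho> x)"
    proof (rule integral_halfplane_eq)
      fix x assume "x \<notin> halfplane"
      then have "x \<notin> cball q \<rho>" using q S by blast
      then show "M * bump q \<rho> x = 0" using q by (simp add: bump_eq_0)
    qed auto
    also have "\<dots> = M * (LINT x|lborel. bump q \<rho> x)" by simp
    finally show "\<exists>A'. \<bar>A'\<bar> \<le> M * (LINT x|lborel. bump q \<rho> x) \<and>
        ((\<lambda>k. LINT x|lborel. f' x * ((bump q \<rho> (x - k *\<^sub>R v) - bump q \<rho> x) / k)) \<longlongrightarrow> A') (at 0)"
      using test_function_diff_quotient_tendsto[OF tf f'm cont', of v] unfolding eq by blast
  qed
  moreover have "p \<in> halfplane" "p + t *\<^sub>R v \<in> halfplane" using p S(3) by auto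
  ultimately show ?thesis by (simp add: f'H)
qed

section \<open>Lipschitz data\<close>

lemma borel_measurable_fst_snd [measurable]:
  "(fst :: 'a::euclidean_space \<times> 'b::euclidean_space \<Rightarrow> 'a) \<in> borel_measurable borel"
  "(snd :: 'a \<times> 'b \<Rightarrow> 'b) \<in> borel_measurable borel"
  by (intro borel_measurable_continuous_onI continuous_intros)+

text \<open>The same difference quotient converges to an integral with the a.e. derivative of
  \<open>f\<close> and to one with the derivative of the test function; their equality is the
  defining identity. Differentiability almost everywhere enters as an assumption and is checked by
  hand for tents.\<close>

lemma lipschitz_has_weak_deriv:
  assumes f[measurable]: "f \<in> borel_measurable borel" and lip: "L-lipschitz_on UNIV f"
    and diff: "AE x in lborel. \<exists>D. (f has_derivative D) (at x)"
  shows "has_weak_deriv v f (ddir f v)"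
proof -
  have cont: "continuous_on UNIV f" by (rule lipschitz_on_continuous_on[OF lip])
  have abs_int: "h absolutely_integrable_on K"
    if "integrable lborel (\<lambda>x. h x * indicator K x)" "h \<in> borel_measurable borel" "compact K"
    for h :: "real \<times> real \<Rightarrow> real" and K
  proof -
    have [measurable]: "K \<in> sets borel" using that(3) by (simp add: compact_imp_closed)
    note that(2)[measurable]
    have "integrable lebesgue (\<lambda>x. indicator K x *\<^sub>R h x)"
      using that(1) by (subst integrable_completion) (auto simp: mult.commute)
    then show ?thesis by (simp add: set_integrable_def)
  qed
  have 1: "locally_integrable f"
    unfolding locally_integrable_def
  proof (intro allI impI, elim conjE)
    fix K :: "(real \<times> real) set" assume K: "compact K"
    then have [measurable]: "K \<in> sets borel" by (simp add: compact_imp_closed)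
    have "bounded (f ` K)"
      using compact_imp_bounded[OF compact_continuous_image[OF continuous_on_subset[OF cont subset_UNIV] K]] .
    then obtain F where F: "\<forall>x\<in>K. \<bar>f x\<bar> \<le> F" by (auto simp: bounded_iff)
    have "integrable lborel (\<lambda>x. f x * indicator K x)"
      by (rule integrable_bounded_compact_support[where K=K and B="\<bar>F\<bar>"])
         (use F compact_imp_bounded[OF K] in \<open>auto simp: indicator_def abs_le_iff\<close>)
    then show "f absolutely_integrable_on K" using K by (intro abs_int) auto
  qed
  have 2: "locally_integrable (ddir f v)"
    unfolding locally_integrable_def
  proof (intro allI impI, elim conjE)
    fix K :: "(real \<times> real) set" assume K: "compact K"
    then have [measurable]: "K \<in> sets borel" by (simp add: compact_imp_closed)
    have "integrable lborel (\<lambda>x. ddir f v x * indicator K x)"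
      by (rule integral_diff_quotient_tendsto(1)[OF f lip open_UNIV, where B=1 and K=K])
         (use K diff in \<open>auto simp: indicator_def\<close>)
    then show "ddir f v absolutely_integrable_on K" using K by (intro abs_int) auto
  qed
  show ?thesis
    unfolding has_weak_deriv_def
  proof (intro conjI ballI 1 2)
    fix \<phi> assume \<phi>: "\<phi> \<in> test_functions"
    obtain K B where K: "compact K" "K \<subseteq> halfplane" "\<And>x. x \<notin> K \<Longrightarrow> \<phi> x = 0"
      "\<And>x. x \<notin> K \<Longrightarrow> frechet_derivative \<phi> (at x) v = 0"
      and B: "\<And>x. \<bar>\<phi> x\<bar> \<le> B"
      and m[measurable]: "\<phi> \<in> borel_measurable borel" "(\<lambda>x. frechet_derivative \<phi> (at x) v) \<in> borel_measurable borel"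
      using test_function_facts[OF \<phi>, of v] by metis
    have KH: "x \<notin> K" if "x \<notin> halfplane" for x using K(2) that by blast
    have d: "AE x in lborel. x \<in> K \<longrightarrow> (\<exists>D. (f has_derivative D) (at x))"
      using diff by eventually_elim blast
    have "((\<lambda>k. LINT x|lborel. f x * ((\<phi> (x - k *\<^sub>R v) - \<phi> x) / k))
           \<longlongrightarrow> (LINT x|lborel. ddir f v x * \<phi> x)) (at 0)"
      by (rule integral_diff_quotient_tendsto(2)[OF f lip open_UNIV m(1) B K(1) _ K(3) d]) simp_all
    moreover have "((\<lambda>k. LINT x|lborel. f x * ((\<phi> (x - k *\<^sub>R v) - \<phi> x) / k))
     \<longlongrightarrow> - (LINT x|lborel. f x * frechet_derivative \<phi> (at x) v)) (at 0)"
      by (rule test_function_diff_quotient_tendsto[OF \<phi> f continuous_on_subset[OF cont subset_UNIV]])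
    ultimately have eq: "(LINT x|lborel. ddir f v x * \<phi> x) = - (LINT x|lborel. f x * frechet_derivative \<phi> (at x) v)"
      by (rule tendsto_unique[rotated]) simp
    have "(LINT x|lebesgue_on halfplane. f x * frechet_derivative \<phi> (at x) v) = (LINT x|lborel. f x * frechet_derivative \<phi> (at x) v)"
      by (rule integral_halfplane_eq) (simp_all add: K KH)
    moreover have "(LINT x|lebesgue_on halfplane. ddir f v x * \<phi> x) = (LINT x|lborel. ddir f v x * \<phi> x)"
      by (rule integral_halfplane_eq) (simp_all add: K KH)
    ultimately show "(LINT x|lebesgue_on halfplane. f x * frechet_derivative \<phi> (at x) v) = - (LINT x|lebesgue_on halfplane. ddir f v x * \<phi> x)"
      using eq by simp
  qed
qed

lemma ddir_le_lipschitz: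
  fixes f :: "'a::euclidean_space \<Rightarrow> real"
  assumes "L-lipschitz_on UNIV f" "\<exists>D. (f has_derivative D) (at x)"
  shows "\<bar>ddir f v x\<bar> \<le> L * norm v"
proof -
  obtain D where D: "(f has_derivative D) (at x)" using assms(2) by blast
  have "\<bar>f (x + k *\<^sub>R v) - f x\<bar> \<le> L * norm v * \<bar>k\<bar>" for k
    using lipschitz_onD[OF assms(1), of "x + k *\<^sub>R v" x] by (auto simp: dist_norm mult_ac)
  then show ?thesis
    unfolding ddir_eq[OF D] by (intro ddir_lipschitz_bound[OF D] always_eventually allI)
qed

lemma measurable_lebesgue_halfplane:
  "f \<in> borel_measurable borel \<Longrightarrow> f \<in> borel_measurable (lebesgue_on halfplane)"
  by (intro measurable_restrict_space1 measurable_completion) simp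

lemma Linf_norm_le:
  assumes "f \<in> borel_measurable borel" "AE x in lborel. \<bar>f x\<bar> \<le> c"
  shows "Linf_norm f \<le> ennreal c"
  unfolding Linf_norm_def
proof (rule esssup_I)
  show "(\<lambda>x. ennreal \<bar>f x\<bar>) \<in> borel_measurable (lebesgue_on halfplane)"
    using measurable_lebesgue_halfplane[OF assms(1)] by measurable
  show "AE x in lebesgue_on halfplane. ennreal \<bar>f x\<bar> \<le> ennreal c"
    unfolding AE_halfplane_iff using assms(2) by eventually_elim (auto intro: ennreal_leI)
qed

text \<open>The weight in the seminorm is at most 1, so both derivative terms are bounded by the
  Lipschitz constant. The explicit bound later shows that the perturbed data converge in
  \<open>X_norm\<close>.\<close>

lemma lipschitz_compact_support_X_space:
  assumes lip: "L-lipschitz_on UNIV f" and diff: "AE x in lborel. \<exists>D. (f has_derivative D) (at x)"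
    and B: "\<And>x. \<bar>f x\<bar> \<le> B" and K: "\<And>x. x \<notin> cbox a b \<Longrightarrow> f x = 0"
  shows "f \<in> X_space \<beta>" "X_norm \<beta> f \<le> ennreal (B + (L + L) + B * measure lborel (cbox a b))"
proof -
  have f[measurable]: "f \<in> borel_measurable borel"
    by (intro borel_measurable_continuous_onI lipschitz_on_continuous_on[OF lip])
  have L0: "L \<ge> 0" using lip by (rule lipschitz_on_nonneg)
  have B0: "B \<ge> 0" using B[of 0] by linarith
  have Linf: "Linf_norm f \<le> ennreal B" by (rule Linf_norm_le[OF f]) (simp add: B)
  have "(INF g\<in>{g. has_weak_deriv (1, 0) f g}. Linf_norm g) \<le> Linf_norm (ddir f (1, 0))"
    by (rule INF_lower) (use lipschitz_has_weak_deriv[OF f lip diff] in simp)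
  also have "\<dots> \<le> ennreal L"
  proof (rule Linf_norm_le)
    show "AE x in lborel. \<bar>ddir f (1, 0) x\<bar> \<le> L"
      using diff by eventually_elim (drule ddir_le_lipschitz[OF lip, where v="(1,0)"], simp add: norm_Pair)
  qed simp
  finally have 1: "(INF g\<in>{g. has_weak_deriv (1, 0) f g}. Linf_norm g) \<le> ennreal L" .
  have "(INF g\<in>{g. has_weak_deriv (0, 1) f g}. Linf_norm (\<lambda>x. min (snd x powr \<beta>) 1 * g x)) \<le> Linf_norm (\<lambda>x. min (snd x powr \<beta>) 1 * ddir f (0, 1) x)"
    by (rule INF_lower) (use lipschitz_has_weak_deriv[OF f lip diff] in simp)
  also have "\<dots> \<le> ennreal L"
  proof (rule Linf_norm_le)
    show "AE x in lborel. \<bar>min (snd x powr \<beta>) 1 * ddir f (0, 1) x\<bar> \<le> L"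
      using diff
    proof eventually_elim
      case (elim x)
      have "\<bar>min (snd x powr \<beta>) 1\<bar> * \<bar>ddir f (0, 1) x\<bar> \<le> 1 * L"
        using ddir_le_lipschitz[OF lip elim, where v="(0,1)"] by (intro mult_mono) (auto simp: norm_Pair)
      then show ?case by (simp add: abs_mult)
    qed
  qed simp
  finally have 2: "(INF g\<in>{g. has_weak_deriv (0, 1) f g}. Linf_norm (\<lambda>x. min (snd x powr \<beta>) 1 * g x)) \<le> ennreal L" .
  have W: "W_seminorm \<beta> f \<le> ennreal (L + L)"
    unfolding W_seminorm_def ennreal_plus[OF L0 L0] by (rule add_mono[OF 1 2])
  have "L1_norm f \<le> (\<integral>\<^sup>+x. ennreal B * indicator (cbox a b) x \<partial>lborel)"
  proof -
    have "L1_norm f = (\<integral>\<^sup>+x. ennreal \<bar>f x\<bar> * indicator halfplane x \<partial>lborel)"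
      unfolding L1_norm_def
      by (subst nn_integral_restrict_space) (auto intro!: nn_integral_completion)
    also have "\<dots> \<le> (\<integral>\<^sup>+x. ennreal B * indicator (cbox a b) x \<partial>lborel)"
      using K B by (intro nn_integral_mono) (auto simp: indicator_def intro: ennreal_leI)
    finally show ?thesis .
  qed
  also have "\<dots> = ennreal (B * measure lborel (cbox a b))"
  proof -
    have "emeasure lborel (cbox a b) = ennreal (measure lborel (cbox a b))"
      by (rule emeasure_eq_ennreal_measure less_imp_neq[OF emeasure_lborel_cbox_finite[unfolded infinity_ennreal_def]])+
    then show ?thesis
      using B0 by (subst nn_integral_cmult_indicator) (simp_all only: ennreal_mult[OF B0 measure_nonneg] sets_lborel borel_closed closed_cbox)
  qed
  finally have L1: "L1_norm f \<le> ennreal (B * measure lborel (cbox a b))" .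
  have "integrable lborel f"
    by (rule integrable_bounded_compact_support[where K="cbox a b" and B=B]) (use B K in auto)
  then have "integrable lebesgue f" by (subst integrable_completion) auto
  then have "integrable (lebesgue_on halfplane) f"
    by (subst integrable_restrict_space) (use integrable_mult_indicator[of halfplane lebesgue f] in auto)
  then show "f \<in> X_space \<beta>"
    using Linf W by (auto simp: X_space_def W_space_def intro: le_less_trans)
  show "X_norm \<beta> f \<le> ennreal (B + (L + L) + B * measure lborel (cbox a b))"
    unfolding X_norm_def W_norm_def
    using add_mono[OF add_mono[OF Linf W] L1] L0 B0 by simp
qed

section \<open>Tents, the building blocks of the data\<close>

definition tent :: "real \<Rightarrow> real" where
  "tent s = max 0 (1 - \<bar>s\<bar>)"

lemma tent_nonneg [simp]: "tent s \<ge> 0" and tent_le_1 [simp]: "tent s \<le> 1"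
  by (auto simp: tent_def)

lemma tent_eq_0: "\<bar>s\<bar> \<ge> 1 \<Longrightarrow> tent s = 0"
  by (auto simp: tent_def)

lemma tent_lipschitz: "\<bar>tent s - tent s'\<bar> \<le> \<bar>s - s'\<bar>"
  unfolding tent_def by linarith

lemma continuous_on_tent [continuous_intros]: "continuous_on A f \<Longrightarrow> continuous_on A (\<lambda>x. tent (f x))"
  unfolding tent_def by (intro continuous_intros)

lemma borel_measurable_tent [measurable]: "tent \<in> borel_measurable borel"
  by (intro borel_measurable_continuous_onI continuous_on_tent continuous_on_id)

lemma tent_differentiable:
  assumes "s \<notin> {-1, 0, 1}"
  shows "\<exists>d. (tent has_real_derivative d) (at s)"
proof -
  consider "s < -1" | "-1 < s" "s < 0" | "0 < s" "s < 1" | "1 < s" using assms by force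
  then show ?thesis
  proof cases
    case 1
    have "((\<lambda>_. 0) has_real_derivative 0) (at s)" by simp
    then have "(tent has_real_derivative 0) (at s)"
      by (rule has_field_derivative_transform_within_open[of _ _ _ "{..<-1}"]) (use 1 in \<open>auto simp: tent_def\<close>)
    then show ?thesis by blast
  next
    case 2
    have "((\<lambda>s. 1 + s) has_real_derivative 1) (at s)" by (auto intro!: derivative_eq_intros)
    then have "(tent has_real_derivative 1) (at s)"
      by (rule has_field_derivative_transform_within_open[of _ _ _ "{-1<..<0}"]) (use 2 in \<open>auto simp: tent_def\<close>)
    then show ?thesis by blast
  next
    case 3
    have "((\<lambda>s. 1 - s) has_real_derivative -1) (at s)" by (auto intro!: derivative_eq_intros)
    then have "(tent has_real_derivative -1) (at s)"
      by (rule has_field_derivative_transform_within_open[of _ _ _ "{0<..<1}"]) (use 3 in \<open>auto simp: tent_def\<close>)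
    then show ?thesis by blast
  next
    case 4
    have "((\<lambda>_. 0) has_real_derivative 0) (at s)" by simp
    then have "(tent has_real_derivative 0) (at s)"
      by (rule has_field_derivative_transform_within_open[of _ _ _ "{1<..}"]) (use 4 in \<open>auto simp: tent_def\<close>)
    then show ?thesis by blast
  qed
qed

text \<open>A pyramid-like bump about \<open>(0, q)\<close>. With \<open>q = 0\<close> it is the
  datum of (a), nonzero on the boundary; \<open>q = 2\<close> and \<open>q = 5\<close> serve (b),
  with disjoint supports away from the boundary.\<close>

definition tent2 :: "real \<Rightarrow> real \<times> real \<Rightarrow> real" where
  "tent2 q x = tent (fst x) * tent (snd x - q)"

lemma tent2_bounds: "tent2 q x \<ge> 0" "\<bar>tent2 q x\<bar> \<le> 1"
  by (auto simp: tent2_def abs_mult mult_le_one)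

lemma tent2_eq_0: "x \<notin> cbox (-1, q - 1) (1, q + 1) \<Longrightarrow> tent2 q x = 0"
proof -
  assume "x \<notin> cbox (-1, q - 1) (1, q + 1)"
  then have "\<bar>fst x\<bar> \<ge> 1 \<or> \<bar>snd x - q\<bar> \<ge> 1" by (cases x) (auto simp: cbox_Pair_eq)
  then show ?thesis by (auto simp: tent2_def tent_eq_0)
qed

lemma tent2_lipschitz: "2-lipschitz_on UNIV (tent2 q)"
proof (rule lipschitz_onI)
  fix x y
  have "\<bar>tent2 q x - tent2 q y\<bar> = \<bar>(tent (fst x) - tent (fst y)) * tent (snd x - q) + tent (fst y) * (tent (snd x - q) - tent (snd y - q))\<bar>"
    by (simp add: tent2_def algebra_simps)
  also have "\<dots> \<le> \<bar>tent (fst x) - tent (fst y)\<bar> * \<bar>tent (snd x - q)\<bar> + \<bar>tent (fst y)\<bar> * \<bar>tent (snd x - q) - tent (snd y - q)\<bar>"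
    by (metis abs_mult abs_triangle_ineq)
  also have "\<dots> \<le> \<bar>fst x - fst y\<bar> * 1 + 1 * \<bar>snd x - snd y\<bar>"
    using tent_lipschitz[of "fst x" "fst y"] tent_lipschitz[of "snd x - q" "snd y - q"]
    by (intro add_mono mult_mono) auto
  also have "\<dots> \<le> 2 * dist x y"
    using dist_fst_le[of x y] dist_snd_le[of x y] by (simp add: dist_real_def)
  finally show "dist (tent2 q x) (tent2 q y) \<le> 2 * dist x y" by (simp add: dist_real_def)
qed simp

lemma AE_hyperplane:
  fixes b :: "'a::euclidean_space"
  assumes "b \<in> Basis"
  shows "AE x in lborel. x \<bullet> b \<noteq> c"
proof -
  have "negligible {x. x \<bullet> b = c}" using assms by (rule negligible_standard_hyperplane)
  then have "AE x in lebesgue. x \<bullet> b \<noteq> c"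
    by (auto simp: negligible_iff_null_sets intro: AE_I'[of "{x. x \<bullet> b = c}"])
  then show ?thesis by (simp add: AE_completion_iff)
qed

text \<open>The kinks lie on six axis-parallel lines, each of measure zero.\<close>

lemma tent2_AE_differentiable: "AE x in lborel. \<exists>D. (tent2 q has_derivative D) (at x)"
proof -
  have f: "AE x :: real \<times> real in lborel. fst x \<noteq> c" for c
    using AE_hyperplane[of "(1,0) :: real \<times> real" c] by (simp add: Basis_prod_def inner_prod_def)
  have s: "AE x :: real \<times> real in lborel. snd x \<noteq> c" for c
    using AE_hyperplane[of "(0,1) :: real \<times> real" c] by (simp add: Basis_prod_def inner_prod_def)
  show ?thesis
    using f[of "-1"] f[of 0] f[of 1] s[of "q - 1"] s[of q] s[of "q + 1"]
  proof eventually_elim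
    case (elim x)
    obtain d1 where d1: "(tent has_real_derivative d1) (at (fst x))"
      using tent_differentiable[of "fst x"] elim by auto
    obtain d2 where d2: "(tent has_real_derivative d2) (at (snd x - q))"
      using tent_differentiable[of "snd x - q"] elim by auto
    have t1: "((\<lambda>x. tent (fst x)) has_derivative (\<lambda>v. fst v * d1)) (at x)"
      by (rule DERIV_compose_FDERIV[where f=tent and g=fst, OF d1]) (auto intro!: derivative_eq_intros)
    have t2: "((\<lambda>x. tent (snd x - q)) has_derivative (\<lambda>v. snd v * d2)) (at x)"
      by (rule DERIV_compose_FDERIV[where f=tent and g="\<lambda>x. snd x - q", OF d2]) (auto intro!: derivative_eq_intros)
    show ?case
      unfolding tent2_def[abs_def] using has_derivative_mult[OF t1 t2] by blast
  qed
qed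

lemma cball_borel [measurable]: "cball (x :: 'a::euclidean_space) r \<in> sets borel"
  by (simp add: borel_closed)

section \<open>The singular kernel\<close>

lemma integrable_lborel_prod_mult:
  fixes f :: "'a::euclidean_space \<Rightarrow> real" and g :: "'b::euclidean_space \<Rightarrow> real"
  assumes "integrable lborel f" "integrable lborel g"
  shows "integrable lborel (\<lambda>z. f (fst z) * g (snd z))"
proof -
  have [measurable]: "f \<in> borel_measurable lborel" "g \<in> borel_measurable lborel" using assms by auto
  have "integrable (lborel \<Otimes>\<^sub>M lborel) (\<lambda>z. f (fst z) * g (snd z))"
  proof (rule lborel_pair.Fubini_integrable)
    have "(\<lambda>x. \<integral>y. norm (f (fst (x, y)) * g (snd (x, y))) \<partial>lborel) = (\<lambda>x. \<bar>f x\<bar> * (\<integral>y. \<bar>g y\<bar> \<partial>lborel))"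
      by (simp add: abs_mult)
    then show "integrable lborel (\<lambda>x. \<integral>y. norm (f (fst (x, y)) * g (snd (x, y))) \<partial>lborel)"
      using assms by simp
    show "AE x in lborel. integrable lborel (\<lambda>y. f (fst (x, y)) * g (snd (x, y)))"
      using assms by simp
  qed measurable
  then show ?thesis by (simp add: lborel_prod)
qed

lemma integrable_abs_symmetric:
  fixes f :: "real \<Rightarrow> real"
  assumes "integrable lborel f" "\<And>s. g s \<ge> 0" "\<And>s. g s \<le> \<bar>f s\<bar> + \<bar>f (- s)\<bar>" "g \<in> borel_measurable borel"
  shows "integrable lborel g"
proof (rule Bochner_Integration.integrable_bound)
  show "integrable lborel (\<lambda>s. \<bar>f s\<bar> + \<bar>f (- s)\<bar>)"
    using lborel_integrable_real_affine[OF assms(1), of "-1" 0] assms(1) by auto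
  show "AE s in lborel. norm (g s) \<le> norm (\<bar>f s\<bar> + \<bar>f (- s)\<bar>)"
    using assms(2,3) by (intro always_eventually allI) auto
qed (use assms(4) in simp)

lemma integrable_powr_near_0:
  fixes a :: real
  assumes "a < 1"
  shows "integrable lborel (\<lambda>s. \<bar>s\<bar> powr - a * indicator {-1..1} s)"
proof (rule integrable_abs_symmetric)
  have "(\<lambda>s. s powr - a) integrable_on {0..1}"
    using has_integral_powr_from_0[of "-a" 1] assms by (auto simp: integrable_on_def)
  then have "(\<lambda>s. s powr - a) absolutely_integrable_on {0..1}"
    by (rule nonnegative_absolutely_integrable_1) auto
  then show "integrable lborel (\<lambda>s. indicator {0..1} s *\<^sub>R s powr - a)"
    unfolding set_integrable_def by (subst (asm) integrable_completion) auto
qed (auto simp: indicator_def)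

lemma integrable_powr_at_infinity:
  fixes a :: real
  assumes "a > 1"
  shows "integrable lborel (\<lambda>s. (max 1 \<bar>s\<bar>) powr - a)"
proof (rule integrable_abs_symmetric)
  have "(\<lambda>s. s powr - a) integrable_on {1..}"
    using has_integral_powr_to_inf[of "-a" 1] assms by (auto simp: integrable_on_def)
  then have "(\<lambda>s. s powr - a) absolutely_integrable_on {1..}"
    by (rule nonnegative_absolutely_integrable_1) auto
  then have "integrable lborel (\<lambda>s. indicator {1..} s *\<^sub>R s powr - a)"
    unfolding set_integrable_def by (subst (asm) integrable_completion) auto
  moreover have "integrable lborel (indicator {-1..1} :: real \<Rightarrow> real)" by simp
  ultimately show "integrable lborel (\<lambda>s. indicator {1..} s *\<^sub>R s powr - a + indicator {-1..1} s)" by auto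
qed (auto simp: indicator_def max_def abs_if)

lemma AE_fst_snd_neq: "AE z :: real \<times> real in lborel. fst z \<noteq> c" "AE z :: real \<times> real in lborel. snd z \<noteq> c"
  using AE_hyperplane[of "(1,0) :: real \<times> real" c] AE_hyperplane[of "(0,1) :: real \<times> real" c]
  by (simp_all add: Basis_prod_def inner_prod_def)

text \<open>The norm dominates both coordinates, so sharing the exponent equally between them bounds
  the power by a product of one-variable powers with exponent \<open>b/2 < 1\<close>.\<close>

lemma integrable_norm_powr_near_0:
  fixes b :: real
  assumes "0 < b" "b < 2"
  shows "integrable lborel (\<lambda>z::real \<times> real. norm z powr - b * indicator (cball 0 1) z)"
proof (rule Bochner_Integration.integrable_bound)
  let ?g = "\<lambda>s::real. \<bar>s\<bar> powr - (b/2) * indicator {-1..1} s"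
  show "integrable lborel (\<lambda>z::real \<times> real. ?g (fst z) * ?g (snd z))"
    using assms by (intro integrable_lborel_prod_mult integrable_powr_near_0) auto
  show "AE z::real \<times> real in lborel. norm (norm z powr - b * indicator (cball 0 1) z) \<le> norm (?g (fst z) * ?g (snd z))"
    using AE_fst_snd_neq(1)[of 0] AE_fst_snd_neq(2)[of 0]
  proof eventually_elim
    case (elim z)
    show ?case
    proof (cases "z \<in> cball 0 1")
      case True
      have n: "\<bar>fst z\<bar> \<le> norm z" "\<bar>snd z\<bar> \<le> norm z"
        using norm_fst_le[of "fst z" "snd z"] norm_snd_le[of "snd z" "fst z"] by auto
      have "norm z powr - b = norm z powr - (b/2) * norm z powr - (b/2)"
        by (simp add: powr_add[symmetric])
      also have "\<dots> \<le> \<bar>fst z\<bar> powr - (b/2) * \<bar>snd z\<bar> powr - (b/2)"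
        using n elim assms by (intro mult_mono powr_mono2') auto
      finally show ?thesis using True n by (auto simp: indicator_def)
    qed simp
  qed
qed measurable

text \<open>The same sharing of the exponent, now with \<open>b/2 > 1\<close>.\<close>

lemma integrable_norm_powr_at_infinity:
  fixes b :: real
  assumes "b > 2"
  shows "integrable lborel (\<lambda>z::real \<times> real. (max 1 (norm z)) powr - b)"
proof (rule Bochner_Integration.integrable_bound)
  let ?g = "\<lambda>s::real. (max 1 \<bar>s\<bar>) powr - (b/2)"
  show "integrable lborel (\<lambda>z::real \<times> real. ?g (fst z) * ?g (snd z))"
    using assms by (intro integrable_lborel_prod_mult integrable_powr_at_infinity) auto
  show "AE z::real \<times> real in lborel. norm ((max 1 (norm z)) powr - b) \<le> norm (?g (fst z) * ?g (snd z))"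
  proof (intro always_eventually allI)
    fix z :: "real \<times> real"
    have n: "\<bar>fst z\<bar> \<le> norm z" "\<bar>snd z\<bar> \<le> norm z"
      using norm_fst_le[of "fst z" "snd z"] norm_snd_le[of "snd z" "fst z"] by auto
    have "(max 1 (norm z)) powr - b = (max 1 (norm z)) powr - (b/2) * (max 1 (norm z)) powr - (b/2)"
      by (simp add: powr_add[symmetric])
    also have "\<dots> \<le> ?g (fst z) * ?g (snd z)"
      using n assms by (intro mult_mono powr_mono2') auto
    finally show "norm ((max 1 (norm z)) powr - b) \<le> norm (?g (fst z) * ?g (snd z))" by simp
  qed
qed simp

section \<open>Differences of powers and the splitting of the kernel\<close>

lemma powr_minus_diff_le:
  fixes p r r' :: real
  assumes "0 < r" "r \<le> r'" "0 \<le> p"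
  shows "r powr - p - r' powr - p \<le> p * r powr (- p - 1) * (r' - r)"
proof (cases "r = r'")
  case False
  then have lt: "r < r'" using assms by simp
  have "\<exists>z>r. z < r' \<and> r' powr - p - r powr - p = (r' - r) * (- p * z powr (- p - 1))"
  proof (rule MVT2[OF lt])
    fix x assume "r \<le> x" "x \<le> r'"
    then show "((\<lambda>x. x powr - p) has_real_derivative - p * x powr (- p - 1)) (at x)"
      using assms by (auto intro!: derivative_eq_intros)
  qed
  then obtain z where z: "r < z" "z < r'" "r' powr - p - r powr - p = (r' - r) * (- p * z powr (- p - 1))" by blast
  have "z powr (- p - 1) \<le> r powr (- p - 1)" using z assms powr_mono2'[of "- p - 1" r z] by simp
  then have "(r' - r) * p * z powr (- p - 1) \<le> (r' - r) * p * r powr (- p - 1)"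
    using lt assms by (intro mult_left_mono) auto
  then show ?thesis using z(3) by (simp add: algebra_simps)
qed simp

lemma abs_powr_minus_diff_le:
  fixes p r r' :: real
  assumes "0 < r" "0 < r'" "0 \<le> p"
  shows "\<bar>r powr - p - r' powr - p\<bar> \<le> p * (min r r') powr (- p - 1) * \<bar>r' - r\<bar>"
proof (cases "r \<le> r'")
  case True
  have "r' powr - p \<le> r powr - p" using True assms powr_mono2'[of "- p" r r'] by simp
  then show ?thesis using powr_minus_diff_le[OF assms(1) True assms(3)] True by simp
next
  case False
  then have le: "r' \<le> r" by simp
  have "r powr - p \<le> r' powr - p" using le assms powr_mono2'[of "- p" r' r] by simp
  then show ?thesis using powr_minus_diff_le[OF assms(2) le assms(3)] le by simp
qed

text \<open>With \<open>p = 2 + 2 * \<alpha>\<close>, the directions \<open>(0, 1)\<close> and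
  \<open>(-1, 0)\<close> give the first and second components of the kernel built from
  \<open>perp z\<close>. At the origin the value is 0.\<close>

definition ker :: "real \<Rightarrow> real \<times> real \<Rightarrow> real \<times> real \<Rightarrow> real" where
  "ker p e z = (z \<bullet> e) * norm z powr - p"

text \<open>The kernel is split into a globally Lipschitz part \<open>far\<close> and an integrable part \<open>near\<close>
  supported in the unit ball.\<close>

definition far :: "real \<Rightarrow> real \<times> real \<Rightarrow> real \<times> real \<Rightarrow> real" where
  "far p e z = (z \<bullet> e) * (max 1 (norm z)) powr - p"

definition near :: "real \<Rightarrow> real \<times> real \<Rightarrow> real \<times> real \<Rightarrow> real" where
  "near p e z = ker p e z - far p e z"

lemma ker_measurable [measurable]: "ker p e \<in> borel_measurable borel"
  and far_measurable [measurable]: "far p e \<in> borel_measurable borel"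
  and near_measurable [measurable]: "near p e \<in> borel_measurable borel"
  unfolding near_def[abs_def] ker_def[abs_def] far_def[abs_def] by measurable

lemma norm_powr_one_minus:
  fixes z :: "'a::real_normed_vector"
  shows "norm z * norm z powr - p = norm z powr (1 - p)"
  by (cases "z = 0") (simp_all add: powr_diff powr_minus divide_inverse)

lemma ker_bound: "norm e = 1 \<Longrightarrow> \<bar>ker p e z\<bar> \<le> norm z powr (1 - p)"
  unfolding ker_def abs_mult norm_powr_one_minus[symmetric]
  using Cauchy_Schwarz_ineq2[of z e] by (auto intro!: mult_right_mono)

lemma far_bound:
  assumes "norm e = 1" "p \<ge> 1" shows "\<bar>far p e z\<bar> \<le> 1"
proof -
  have "\<bar>far p e z\<bar> \<le> max 1 (norm z) * (max 1 (norm z)) powr - p"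
    unfolding far_def abs_mult using Cauchy_Schwarz_ineq2[of z e] assms by (auto intro!: mult_mono)
  also have "\<dots> = (max 1 (norm z)) powr (1 - p)"
    by (simp add: powr_diff powr_minus divide_inverse)
  also have "\<dots> \<le> (max 1 (norm z)) powr 0" using assms by (intro powr_mono) auto
  also have "\<dots> = 1" by (auto simp: max_def)
  finally show ?thesis .
qed

text \<open>Take \<open>z\<close> to be the point of smaller norm. The increment of the linear
  factor contributes 1 to the constant; the increment of the radial factor costs
  \<open>p * r powr (- p - 1)\<close>, and the smaller factor
  \<open>\<bar>z \<bullet> e\<bar> \<le> r\<close> absorbs one power of it.\<close>

lemma far_lipschitz:
  assumes e: "norm e = 1" and p: "p \<ge> 0"
  shows "\<bar>far p e z - far p e w\<bar> \<le> (1 + p) * norm (z - w)"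
proof -
  have *: "\<bar>far p e z - far p e w\<bar> \<le> (1 + p) * norm (z - w)" if le: "norm z \<le> norm w" for z w
  proof -
    define r where "r = max 1 (norm z)"
    define r' where "r' = max 1 (norm w)"
    have r: "r \<ge> 1" "r' \<ge> r" "norm z \<le> r" "r' - r \<le> norm (z - w)"
      using le norm_triangle_ineq2[of w z] by (auto simp: r_def r'_def norm_minus_commute)
    have "far p e z - far p e w = (z \<bullet> e) * (r powr - p - r' powr - p) + ((z - w) \<bullet> e) * r' powr - p"
      by (simp add: far_def r_def r'_def algebra_simps inner_diff_left)
    also have "\<bar>\<dots>\<bar> \<le> \<bar>z \<bullet> e\<bar> * \<bar>r powr - p - r' powr - p\<bar> + \<bar>(z - w) \<bullet> e\<bar> * r' powr - p"
      by (metis abs_mult abs_triangle_ineq abs_of_nonneg powr_ge_zero)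
    also have "\<dots> \<le> r * (p * r powr (- p - 1) * (r' - r)) + norm (z - w) * 1"
    proof (intro add_mono mult_mono)
      show "\<bar>z \<bullet> e\<bar> \<le> r" using Cauchy_Schwarz_ineq2[of z e] e r by simp
      show "\<bar>r powr - p - r' powr - p\<bar> \<le> p * r powr (- p - 1) * (r' - r)"
        using abs_powr_minus_diff_le[of r r' p] r p by simp
      show "\<bar>(z - w) \<bullet> e\<bar> \<le> norm (z - w)" using Cauchy_Schwarz_ineq2[of "z - w" e] e by simp
      show "r' powr - p \<le> 1" using powr_mono[of "-p" 0 r'] r p by simp
    qed (use r in auto)
    also have "r * (p * r powr (- p - 1) * (r' - r)) = p * r powr (- p) * (r' - r)"
      using r by (simp add: powr_diff)
    also have "\<dots> \<le> p * 1 * norm (z - w)"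
      using r p powr_mono[of "-p" 0 r] by (intro mult_mono) auto
    finally show ?thesis by (simp add: algebra_simps)
  qed
  show ?thesis
  proof (cases "norm z \<le> norm w")
    case False
    then show ?thesis using *[of w z] by (simp add: abs_minus_commute norm_minus_commute)
  qed (rule *)
qed

lemma near_eq_0: "norm z \<ge> 1 \<Longrightarrow> near p e z = 0"
  by (simp add: near_def ker_def far_def max_def)

lemma near_eq: "norm z \<le> 1 \<Longrightarrow> near p e z = (z \<bullet> e) * (norm z powr - p - 1)"
  by (auto simp: near_def ker_def far_def max_def algebra_simps)

lemma near_bound:
  assumes "norm e = 1" "p \<ge> 0" shows "\<bar>near p e z\<bar> \<le> norm z powr (1 - p) * indicator (cball 0 1) z"
proof (cases "norm z \<le> 1")
  case True
  show ?thesis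
  proof (cases "z = 0")
    case False
    have "1 \<le> norm z powr - p" using True False powr_mono2'[of "- p" "norm z" 1] assms by simp
    then have "\<bar>near p e z\<bar> \<le> \<bar>z \<bullet> e\<bar> * norm z powr - p"
      unfolding near_eq[OF True] abs_mult by (intro mult_left_mono) auto
    also have "\<dots> \<le> norm z * norm z powr - p"
      using Cauchy_Schwarz_ineq2[of z e] assms by (intro mult_right_mono) auto
    finally show ?thesis using True by (simp add: norm_powr_one_minus)
  qed (simp add: near_def ker_def far_def)
qed (simp add: near_eq_0)

lemma integrable_near:
  assumes "norm e = 1" "1 < p" "p < 3"
  shows "integrable lborel (near p e)"
proof (rule Bochner_Integration.integrable_bound)
  show "integrable lborel (\<lambda>z::real \<times> real. norm z powr (1 - p) * indicator (cball 0 1) z)"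
    using integrable_norm_powr_near_0[of "p - 1"] assms by simp
  show "AE z in lborel. norm (near p e z) \<le> norm (norm z powr (1 - p) * indicator (cball 0 1) z)"
    using near_bound[of e p] assms by (intro always_eventually allI) auto
qed simp

section \<open>The velocity as a convolution\<close>

lemma lborel_affine_pair:
  fixes a b s u :: real
  assumes "a \<noteq> 0" "b \<noteq> 0"
  shows "(lborel :: (real \<times> real) measure) =
    density (distr lborel borel (\<lambda>z. (s + a * fst z, u + b * snd z))) (\<lambda>_. ennreal \<bar>a * b\<bar>)"
proof -
  \<comment> \<open>Evaluated on the two basis vectors this yields \<open>a\<close> and
    \<open>b\<close>, the per-axis factors expected by the Euclidean affine formula.\<close>
  define c :: "real \<times> real \<Rightarrow> real" where "c j = a * fst j + b * snd j" for j
  have B: "(Basis :: (real \<times> real) set) = {(1, 0), (0, 1)}" by (auto simp: Basis_prod_def)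
  have T: "(\<lambda>x :: real \<times> real. (s, u) + (\<Sum>j\<in>Basis. (c j * (x \<bullet> j)) *\<^sub>R j)) = (\<lambda>z. (s + a * fst z, u + b * snd z))"
    by (auto simp: fun_eq_iff B c_def inner_prod_def)
  have p: "(\<Prod>j\<in>Basis. \<bar>c j\<bar>) = \<bar>a * b\<bar>"
    by (simp add: B c_def abs_mult)
  have "c j \<noteq> 0" if "j \<in> Basis" for j using that assms by (auto simp: B c_def)
  from lborel_affine_euclidean[of c "(s, u)", OF this] show ?thesis unfolding T p .
qed

lemma affine_pair_measurable [measurable]:
  "(\<lambda>z :: real \<times> real. (s + a * fst z, u + b * snd z)) \<in> borel_measurable borel"
  by (intro borel_measurable_continuous_onI continuous_intros)

lemma lborel_integral_affine_pair:
  fixes f :: "real \<times> real \<Rightarrow> real"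
  assumes [measurable]: "f \<in> borel_measurable borel" and ab: "a \<noteq> 0" "b \<noteq> 0"
  shows "(LINT z|lborel. f z) = \<bar>a * b\<bar> * (LINT z|lborel. f (s + a * fst z, u + b * snd z))"
proof -
  let ?T = "\<lambda>z :: real \<times> real. (s + a * fst z, u + b * snd z)"
  have "(LINT z|lborel. f z) = (LINT z|density (distr lborel borel ?T) (\<lambda>_. ennreal \<bar>a * b\<bar>). f z)"
    by (subst lborel_affine_pair[OF ab, of s u]) simp
  also have "\<dots> = (LINT z|distr lborel borel ?T. \<bar>a * b\<bar> *\<^sub>R f z)"
    by (rule integral_density) auto
  also have "\<dots> = (LINT z|lborel. \<bar>a * b\<bar> *\<^sub>R f (?T z))" by (rule integral_distr) auto
  finally show ?thesis by simp
qed

lemma lborel_integrable_affine_pair: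
  fixes f :: "real \<times> real \<Rightarrow> real"
  assumes f: "integrable lborel f" and ab: "a \<noteq> 0" "b \<noteq> 0"
  shows "integrable lborel (\<lambda>z. f (s + a * fst z, u + b * snd z))"
proof -
  let ?T = "\<lambda>z :: real \<times> real. (s + a * fst z, u + b * snd z)"
  have m[measurable]: "f \<in> borel_measurable borel" using f by auto
  have "integrable (density (distr lborel borel ?T) (\<lambda>_. ennreal \<bar>a * b\<bar>)) f"
    using f lborel_affine_pair[OF ab, of s u] by simp
  then have "integrable (distr lborel borel ?T) (\<lambda>z. \<bar>a * b\<bar> *\<^sub>R f z)"
    by (subst (asm) integrable_density) auto
  then have "integrable lborel (\<lambda>z. \<bar>a * b\<bar> *\<^sub>R f (?T z))"
    by (subst (asm) integrable_distr_eq) auto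
  then show ?thesis using ab by simp
qed

lemma diff_conv_affine: "(x :: real \<times> real) - z = (fst x + (-1) * fst z, snd x + (-1) * snd z)"
  by (simp add: prod_eq_iff)

lemma lborel_integral_diff:
  fixes f :: "real \<times> real \<Rightarrow> real"
  assumes "f \<in> borel_measurable borel"
  shows "(LINT z|lborel. f (x - z)) = (LINT z|lborel. f z)"
  unfolding diff_conv_affine using lborel_integral_affine_pair[OF assms, of "-1" "-1" "fst x" "snd x"] by simp

lemma lborel_integrable_diff:
  fixes f :: "real \<times> real \<Rightarrow> real"
  assumes "integrable lborel f"
  shows "integrable lborel (\<lambda>z. f (x - z))"
  unfolding diff_conv_affine by (rule lborel_integrable_affine_pair[OF assms]) auto

lemma reflect_conv_affine: "reflect z = (0 + 1 * fst z, 0 + (-1) * snd z)"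
  by (simp add: reflect_def)

lemma lborel_integral_reflect:
  fixes f :: "real \<times> real \<Rightarrow> real"
  assumes "f \<in> borel_measurable borel"
  shows "(LINT z|lborel. f (reflect z)) = (LINT z|lborel. f z)"
  unfolding reflect_conv_affine using lborel_integral_affine_pair[OF assms, of 1 "-1" 0 0] by simp

lemma lborel_integrable_reflect:
  fixes f :: "real \<times> real \<Rightarrow> real"
  assumes "integrable lborel f"
  shows "integrable lborel (\<lambda>z. f (reflect z))"
  unfolding reflect_conv_affine by (rule lborel_integrable_affine_pair[OF assms]) auto

lemma reflect_measurable [measurable]: "reflect \<in> borel_measurable borel"
  unfolding reflect_def[abs_def] by (intro borel_measurable_continuous_onI continuous_intros)

lemma reflect_simps [simp]: "fst (reflect z) = fst z" "snd (reflect z) = - snd z" "reflect (reflect z) = z"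
  by (simp_all add: reflect_def)

lemma norm_reflect [simp]: "norm (reflect z) = norm z"
  by (simp add: norm_prod_def)

text \<open>The sup bound pairs with the integrable part \<open>near\<close>, the L^1 bound with the
  bounded part \<open>far\<close>; a single constant serves for both.\<close>

definition bdd_int :: "real \<Rightarrow> (real \<times> real \<Rightarrow> real) \<Rightarrow> bool" where
  "bdd_int C \<Theta> \<longleftrightarrow> \<Theta> \<in> borel_measurable borel \<and> (\<forall>y. \<bar>\<Theta> y\<bar> \<le> C) \<and> integrable lborel \<Theta> \<and> (LINT y|lborel. \<bar>\<Theta> y\<bar>) \<le> C"

text \<open>In this form the singularity stays at \<open>z = 0\<close> while \<open>x\<close> moves,
  so limits and increments fall on \<Theta>. The commuted form is used when the kernel is to carry
  the increment.\<close>

definition conv :: "(real \<times> real \<Rightarrow> real) \<Rightarrow> (real \<times> real \<Rightarrow> real) \<Rightarrow> real \<times> real \<Rightarrow> real" where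
  "conv k \<Theta> x = (LINT z|lborel. \<Theta> (x - z) * k z)"

lemma bdd_int_nonneg: "bdd_int C \<Theta> \<Longrightarrow> C \<ge> 0"
  unfolding bdd_int_def by (meson abs_ge_zero order_trans)

lemma minus_measurable [measurable]: "(\<lambda>z :: real \<times> real. x - z) \<in> borel_measurable borel"
  by (intro borel_measurable_continuous_onI continuous_intros)

lemma conv_integrable_near:
  assumes \<Theta>: "bdd_int C \<Theta>" and "norm e = 1" "1 < p" "p < 3"
  shows "integrable lborel (\<lambda>z. \<Theta> (x - z) * near p e z)"
proof (rule Bochner_Integration.integrable_bound)
  show "integrable lborel (\<lambda>z. C * near p e z)" using integrable_near assms by auto
  have [measurable]: "\<Theta> \<in> borel_measurable borel" using \<Theta> by (simp add: bdd_int_def)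
  show "(\<lambda>z. \<Theta> (x - z) * near p e z) \<in> borel_measurable lborel" by measurable
  show "AE z in lborel. norm (\<Theta> (x - z) * near p e z) \<le> norm (C * near p e z)"
    using \<Theta> bdd_int_nonneg[OF \<Theta>] by (intro always_eventually allI) (auto simp: bdd_int_def abs_mult intro!: mult_right_mono)
qed

lemma conv_integrable_far:
  assumes \<Theta>: "bdd_int C \<Theta>" and "norm e = 1" "1 < p"
  shows "integrable lborel (\<lambda>z. \<Theta> (x - z) * far p e z)"
proof (rule Bochner_Integration.integrable_bound)
  have [measurable]: "\<Theta> \<in> borel_measurable borel" using \<Theta> by (simp add: bdd_int_def)
  show "integrable lborel (\<lambda>z. \<Theta> (x - z))" using \<Theta> by (intro lborel_integrable_diff) (simp add: bdd_int_def)
  show "(\<lambda>z. \<Theta> (x - z) * far p e z) \<in> borel_measurable lborel" by measurable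
  show "AE z in lborel. norm (\<Theta> (x - z) * far p e z) \<le> norm (\<Theta> (x - z))"
    using far_bound[of e p] assms by (intro always_eventually allI) (auto simp: abs_mult intro!: mult_left_le)
qed

lemma ker_eq: "ker p e z = near p e z + far p e z"
  by (simp add: near_def)

lemma conv_integrable_ker:
  assumes "bdd_int C \<Theta>" "norm e = 1" "1 < p" "p < 3"
  shows "integrable lborel (\<lambda>z. \<Theta> (x - z) * ker p e z)"
  unfolding ker_eq distrib_left using conv_integrable_near[OF assms] conv_integrable_far[OF assms(1-3)] by simp

lemma conv_ker_eq:
  assumes "bdd_int C \<Theta>" "norm e = 1" "1 < p" "p < 3"
  shows "conv (ker p e) \<Theta> x = conv (near p e) \<Theta> x + conv (far p e) \<Theta> x"
  unfolding conv_def ker_eq distrib_left using conv_integrable_near[OF assms] conv_integrable_far[OF assms(1-3)] by simp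

lemma conv_commute:
  assumes [measurable]: "\<Theta> \<in> borel_measurable borel" "k \<in> borel_measurable borel"
  shows "conv k \<Theta> x = (LINT y|lborel. \<Theta> y * k (x - y))"
  unfolding conv_def using lborel_integral_diff[of "\<lambda>y. \<Theta> y * k (x - y)" x] by simp

lemma conv_commute_integrable:
  fixes \<Theta> k :: "real \<times> real \<Rightarrow> real"
  assumes "integrable lborel (\<lambda>z. \<Theta> (x - z) * k z)"
  shows "integrable lborel (\<lambda>y. \<Theta> y * k (x - y))"
  using lborel_integrable_diff[of "\<lambda>z. \<Theta> (x - z) * k z" x] assms by simp

section \<open>From the half-plane integral to the odd extension\<close>

lemma ker_components:
  "ker p (0, 1) z = snd z * inverse (norm z powr p)"
  "ker p (-1, 0) z = - fst z * inverse (norm z powr p)"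
  by (simp_all add: ker_def inner_prod_def powr_minus)

text \<open>The reflected kernel in the velocity is the field of a mirror image of opposite sign.
  The value 0 on the axis makes oddness hold at every point.\<close>

definition odd_ext :: "(real \<times> real \<Rightarrow> real) \<Rightarrow> real \<times> real \<Rightarrow> real" where
  "odd_ext \<theta> y = (if snd y > 0 then \<theta> y else if snd y < 0 then - \<theta> (reflect y) else 0)"

lemma odd_ext_reflect: "odd_ext \<theta> (reflect y) = - odd_ext \<theta> y"
  by (auto simp: odd_ext_def)

lemma odd_ext_eq: "odd_ext \<theta> y = indicator halfplane y * \<theta> y - indicator halfplane (reflect y) * \<theta> (reflect y)"
  by (auto simp: odd_ext_def halfplane_iff indicator_def)

lemma restrict_bdd_int:
  assumes cont: "continuous_on halfplane \<theta>" and bd: "\<And>y. y \<in> halfplane \<Longrightarrow> \<bar>\<theta> y\<bar> \<le> C"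
    and L1: "L1_norm \<theta> \<le> ennreal C" and C: "C \<ge> 0"
  shows "bdd_int C (\<lambda>y. indicator halfplane y * \<theta> y)"
proof -
  let ?f = "\<lambda>y. indicator halfplane y * \<theta> y"
  have m[measurable]: "?f \<in> borel_measurable borel"
    using borel_measurable_continuous_on_indicator[OF _ cont] by simp
  have "L1_norm \<theta> = (\<integral>\<^sup>+x. ennreal \<bar>\<theta> x\<bar> * indicator halfplane x \<partial>lebesgue)"
    unfolding L1_norm_def by (subst nn_integral_restrict_space) auto
  also have "\<dots> = (\<integral>\<^sup>+x. ennreal \<bar>?f x\<bar> \<partial>lebesgue)"
    by (intro nn_integral_cong) (auto simp: indicator_def)
  also have "\<dots> = (\<integral>\<^sup>+x. ennreal \<bar>?f x\<bar> \<partial>lborel)"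
    by (rule nn_integral_completion) measurable
  finally have le: "(\<integral>\<^sup>+x. ennreal \<bar>?f x\<bar> \<partial>lborel) \<le> ennreal C" using L1 by simp
  have int: "integrable lborel ?f"
    by (rule integrableI_bounded) (use le in \<open>auto intro: le_less_trans\<close>)
  have "ennreal (LINT y|lborel. \<bar>?f y\<bar>) \<le> ennreal C"
    using le int by (subst nn_integral_eq_integral[symmetric]) auto
  then have "(LINT y|lborel. \<bar>?f y\<bar>) \<le> C" using C by (simp add: ennreal_le_iff)
  then show ?thesis using int bd C m by (auto simp: bdd_int_def indicator_def abs_mult)
qed

lemma bdd_int_odd_ext:
  assumes "bdd_int C (\<lambda>y. indicator halfplane y * \<theta> y)"
  shows "bdd_int (2 * C) (odd_ext \<theta>)"
proof -
  let ?f = "\<lambda>y. indicator halfplane y * \<theta> y"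
  have m[measurable]: "?f \<in> borel_measurable borel" and i: "integrable lborel ?f"
    and b: "\<And>y. \<bar>?f y\<bar> \<le> C" and l: "(LINT y|lborel. \<bar>?f y\<bar>) \<le> C"
    using assms by (auto simp: bdd_int_def)
  have eq: "odd_ext \<theta> = (\<lambda>y. ?f y - ?f (reflect y))" by (simp add: fun_eq_iff odd_ext_eq)
  have i2: "integrable lborel (\<lambda>y. ?f (reflect y))" by (rule lborel_integrable_reflect[OF i])
  have "(LINT y|lborel. \<bar>?f y - ?f (reflect y)\<bar>) \<le> (LINT y|lborel. \<bar>?f y\<bar> + \<bar>?f (reflect y)\<bar>)"
    by (intro integral_mono integrable_abs Bochner_Integration.integrable_diff Bochner_Integration.integrable_add i i2) auto
  also have "\<dots> = (LINT y|lborel. \<bar>?f y\<bar>) + (LINT y|lborel. \<bar>?f (reflect y)\<bar>)"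
    by (intro Bochner_Integration.integral_add integrable_abs i i2)
  also have "(LINT y|lborel. \<bar>?f (reflect y)\<bar>) = (LINT y|lborel. \<bar>?f y\<bar>)"
    by (rule lborel_integral_reflect) measurable
  finally have "(LINT y|lborel. \<bar>?f y - ?f (reflect y)\<bar>) \<le> 2 * C" using l by simp
  moreover have "\<bar>?f y - ?f (reflect y)\<bar> \<le> 2 * C" for y
    using b[of y] b[of "reflect y"] by linarith
  moreover have "(\<lambda>y. ?f y - ?f (reflect y)) \<in> borel_measurable borel"
    by (intro borel_measurable_diff m measurable_compose[OF reflect_measurable m])
  moreover have "integrable lborel (\<lambda>y. ?f y - ?f (reflect y))"
    by (intro Bochner_Integration.integrable_diff i i2)
  ultimately show ?thesis unfolding bdd_int_def eq by simp
qed

text \<open>Reflecting the variable in the second kernel folds the half-plane integral into a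
  whole-plane convolution with the odd extension. Every later estimate of the velocity uses these
  two scalar convolutions.\<close>

lemma gsqg_velocity_eq:
  assumes bi: "bdd_int C (\<lambda>y. indicator halfplane y * \<theta> y)" and \<alpha>: "0 < \<alpha>" "\<alpha> < 1/2"
  shows "gsqg_velocity \<alpha> \<theta> x =
    (conv (ker (2 + 2 * \<alpha>) (0, 1)) (odd_ext \<theta>) x, conv (ker (2 + 2 * \<alpha>) (-1, 0)) (odd_ext \<theta>) x)"
proof -
  define p where "p = 2 + 2 * \<alpha>"
  have p: "1 < p" "p < 3" using \<alpha> by (auto simp: p_def)
  define f where "f y = indicator halfplane y * \<theta> y" for y
  have bif: "bdd_int C f" using bi by (simp add: f_def[abs_def])
  have m[measurable]: "f \<in> borel_measurable borel" using bif by (simp add: bdd_int_def)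
  have 1: "integrable lborel (\<lambda>y. f y * (ker p e (x - y) - ker p e (x - reflect y)))"
    "(LINT y|lborel. f y * (ker p e (x - y) - ker p e (x - reflect y))) = conv (ker p e) (odd_ext \<theta>) x"
    if e: "norm e = 1" for e
  proof -
    have i1: "integrable lborel (\<lambda>y. f y * ker p e (x - y))"
      by (rule conv_commute_integrable[OF conv_integrable_ker[OF bif e p]])
    have "bdd_int C (\<lambda>y. f (reflect y))"
      using bif lborel_integrable_reflect[of f] lborel_integral_reflect[of "\<lambda>y. \<bar>f y\<bar>"] by (auto simp: bdd_int_def)
    from conv_commute_integrable[OF conv_integrable_ker[OF this e p]]
    have i2: "integrable lborel (\<lambda>y. f (reflect y) * ker p e (x - y))" .
    from lborel_integrable_reflect[OF this] have i3: "integrable lborel (\<lambda>y. f y * ker p e (x - reflect y))" by simp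
    show "integrable lborel (\<lambda>y. f y * (ker p e (x - y) - ker p e (x - reflect y)))"
      unfolding right_diff_distrib by (intro Bochner_Integration.integrable_diff i1 i3)
    have "(LINT y|lborel. f y * (ker p e (x - y) - ker p e (x - reflect y))) =
       (LINT y|lborel. f y * ker p e (x - y)) - (LINT y|lborel. f y * ker p e (x - reflect y))"
      unfolding right_diff_distrib by (intro Bochner_Integration.integral_diff i1 i3)
    also have "(LINT y|lborel. f y * ker p e (x - reflect y)) = (LINT y|lborel. f (reflect y) * ker p e (x - y))"
      using lborel_integral_reflect[of "\<lambda>y. f (reflect y) * ker p e (x - y)"] by simp
    also have "(LINT y|lborel. f y * ker p e (x - y)) - \<dots> = (LINT y|lborel. f y * ker p e (x - y) - f (reflect y) * ker p e (x - y))"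
      by (intro Bochner_Integration.integral_diff[symmetric] i1 i2)
    also have "\<dots> = (LINT y|lborel. odd_ext \<theta> y * ker p e (x - y))"
      by (intro Bochner_Integration.integral_cong refl) (simp add: odd_ext_eq f_def algebra_simps)
    also have "\<dots> = conv (ker p e) (odd_ext \<theta>) x"
      using bdd_int_odd_ext[OF bi] by (intro conv_commute[symmetric]) (auto simp: bdd_int_def)
    finally show "(LINT y|lborel. f y * (ker p e (x - y) - ker p e (x - reflect y))) = conv (ker p e) (odd_ext \<theta>) x" .
  qed
  define g where "g e y = f y * (ker p e (x - y) - ker p e (x - reflect y))" for e y
  have n: "norm (0 :: real, 1 :: real) = 1" "norm (-1 :: real, 0 :: real) = 1" by (simp_all add: norm_Pair)
  have "gsqg_velocity \<alpha> \<theta> x = (LINT y|lebesgue. g (0,1) y *\<^sub>R (1, 0) + g (-1,0) y *\<^sub>R (0, 1))"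
    unfolding gsqg_velocity_def
  proof (subst integral_restrict_space, simp, intro Bochner_Integration.integral_cong refl)
    fix y
    show "indicator halfplane y *\<^sub>R \<theta> y *\<^sub>R
        (perp (x - y) /\<^sub>R norm (x - y) powr (2 + 2 * \<alpha>) -
         perp (x - reflect y) /\<^sub>R norm (x - reflect y) powr (2 + 2 * \<alpha>)) =
      g (0, 1) y *\<^sub>R (1, 0) + g (- 1, 0) y *\<^sub>R (0, 1)"
      unfolding g_def f_def ker_components p_def[symmetric] perp_def
      by (simp add: prod_eq_iff algebra_simps)
  qed
  also have "\<dots> = (LINT y|lborel. g (0,1) y *\<^sub>R (1, 0) + g (-1,0) y *\<^sub>R (0, 1))"
    by (rule integral_completion) (simp add: g_def)
  also have "\<dots> = (LINT y|lborel. g (0,1) y) *\<^sub>R (1, 0) + (LINT y|lborel. g (-1,0) y) *\<^sub>R (0, 1)"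
  proof -
    have "integrable lborel (g (0, 1))" "integrable lborel (g (-1, 0))"
      using 1(1)[OF n(1)] 1(1)[OF n(2)] by (simp_all add: g_def[abs_def])
    then show ?thesis
      by (subst Bochner_Integration.integral_add) (simp_all del: scaleR_Pair)
  qed
  finally show ?thesis using 1(2)[OF n(1)] 1(2)[OF n(2)] by (simp add: g_def p_def)
qed

section \<open>Continuity of the velocity\<close>

lemma ker_le_near_0:
  assumes "norm e = 1" "1 \<le> p"
  shows "\<bar>ker p e z\<bar> \<le> norm z powr (1 - p) * indicator (cball 0 1) z + 1"
proof (cases "norm z \<le> 1")
  case True
  then show ?thesis using ker_bound[OF assms(1), of p z] by simp
next
  case False
  then have "norm z powr (1 - p) \<le> 1" using powr_mono[of "1 - p" 0 "norm z"] assms(2) by (auto split: if_splits)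
  then show ?thesis using ker_bound[OF assms(1), of p z] False by simp
qed

text \<open>The kernel decays like |z|^(1-p) with p < 3 and is not integrable at infinity, so
  dominated convergence is applied only inside a large ball. Outside, the uniform L^1 bound times
  the supremum of the kernel is small; no L^1 convergence of the densities is involved.\<close>

lemma conv_ker_tendsto:
  assumes b: "\<And>n. bdd_int C (\<Theta>n n)" "bdd_int C \<Theta>" and e: "norm e = 1" and p: "1 < p" "p < 3"
    and lim: "AE z in lborel. (\<lambda>n. \<Theta>n n (xn n - z)) \<longlonglongrightarrow> \<Theta> (x - z)"
  shows "(\<lambda>n. conv (ker p e) (\<Theta>n n) (xn n)) \<longlonglongrightarrow> conv (ker p e) \<Theta> x"
proof (rule LIMSEQ_I)
  fix r :: real assume r: "r > 0"
  have C: "C \<ge> 0" using b(2) by (rule bdd_int_nonneg)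
  have [measurable]: "\<Theta>n n \<in> borel_measurable borel" "\<Theta> \<in> borel_measurable borel" for n
    using b by (auto simp: bdd_int_def)
  have "((\<lambda>R. C * R powr (1 - p)) \<longlongrightarrow> C * 0) at_top"
    using p by (intro tendsto_mult tendsto_const tendsto_neg_powr filterlim_ident) auto
  \<comment> \<open>The tails of \<open>\<Theta>n n\<close> and of \<Theta> each receive r/4, the
    part inside the ball r/2.\<close>
  then have "eventually (\<lambda>R. C * R powr (1 - p) < r/4) at_top"
    using r by (intro order_tendstoD(2)[of _ "C * 0"]) auto
  then have "eventually (\<lambda>R. C * R powr (1 - p) < r/4 \<and> R \<ge> 1) at_top"
    using eventually_ge_at_top[of 1] by eventually_elim auto
  then obtain R where R: "C * R powr (1 - p) < r/4" "R \<ge> 1"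
    by (auto simp: eventually_at_top_linorder)
  define k1 where "k1 z = indicator (cball 0 R) z * ker p e z" for z
  define k2 where "k2 z = indicator (- cball 0 R) z * ker p e z" for z
  have km[measurable]: "k1 \<in> borel_measurable borel" "k2 \<in> borel_measurable borel"
    by (simp_all add: k1_def[abs_def] k2_def[abs_def])
  have keq: "ker p e z = k1 z + k2 z" for z by (auto simp: k1_def k2_def indicator_def)
  have k1b: "\<bar>k1 z\<bar> \<le> norm z powr (1 - p) * indicator (cball 0 1) z + indicator (cball 0 R) z" for z
    using ker_le_near_0[OF e, of p z] p R by (auto simp: k1_def indicator_def)
  have k2b: "\<bar>k2 z\<bar> \<le> R powr (1 - p)" for z
  proof (cases "norm z \<le> R")
    case False
    then have "\<bar>ker p e z\<bar> \<le> R powr (1 - p)"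
      using ker_bound[OF e, of p z] powr_mono2'[of "1 - p" R "norm z"] p R by simp
    then show ?thesis by (simp add: k2_def indicator_def)
  qed (simp add: k2_def)
  have w: "integrable lborel (\<lambda>z. C * (norm z powr (1 - p) * indicator (cball 0 1) z + indicator (cball (0::real\<times>real) R) z))"
    using integrable_norm_powr_near_0[of "p - 1"] p emeasure_lborel_cball_finite[of "0::real\<times>real" R]
    by (intro integrable_mult_right Bochner_Integration.integrable_add integrable_real_indicator) auto
  have dom1: "\<bar>T (y - z) * k1 z\<bar> \<le> C * (norm z powr (1 - p) * indicator (cball 0 1) z + indicator (cball 0 R) z)"
    if "bdd_int C T" for T y z
    unfolding abs_mult using that k1b[of z] C by (intro mult_mono) (auto simp: bdd_int_def)
  have i1: "integrable lborel (\<lambda>z. T (y - z) * k1 z)" if T: "bdd_int C T" for T y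
  proof (rule Bochner_Integration.integrable_bound[OF w])
    have [measurable]: "T \<in> borel_measurable borel" using T by (simp add: bdd_int_def)
    show "(\<lambda>z. T (y - z) * k1 z) \<in> borel_measurable lborel" by measurable
    show "AE z in lborel. norm (T (y - z) * k1 z) \<le> norm (C * (norm z powr (1 - p) * indicator (cball 0 1) z + indicator (cball 0 R) z))"
      using order_trans[OF dom1[OF T] abs_ge_self] by (intro always_eventually allI) simp
  qed
  have tail: "\<bar>LINT z|lborel. T (y - z) * k2 z\<bar> \<le> C * R powr (1 - p)"
    and split: "conv (ker p e) T y = (LINT z|lborel. T (y - z) * k1 z) + (LINT z|lborel. T (y - z) * k2 z)"
    if T: "bdd_int C T" for T y
  proof -
    have i2: "integrable lborel (\<lambda>z. T (y - z) * k2 z)"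
    proof -
      have "(\<lambda>z. T (y - z) * k2 z) = (\<lambda>z. T (y - z) * ker p e z - T (y - z) * k1 z)"
        by (simp add: keq fun_eq_iff algebra_simps)
      then show ?thesis using i1[OF T] conv_integrable_ker[OF T e p] by simp
    qed
    show "conv (ker p e) T y = (LINT z|lborel. T (y - z) * k1 z) + (LINT z|lborel. T (y - z) * k2 z)"
      unfolding conv_def keq distrib_left using i1[OF T] i2 by (rule Bochner_Integration.integral_add)
    have iT: "integrable lborel (\<lambda>z. \<bar>T (y - z)\<bar>)" using T by (intro integrable_abs lborel_integrable_diff) (simp add: bdd_int_def)
    have "\<bar>LINT z|lborel. T (y - z) * k2 z\<bar> \<le> (LINT z|lborel. \<bar>T (y - z)\<bar> * R powr (1 - p))"
      by (rule order_trans[OF integral_abs_bound], rule integral_mono)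
         (use integrable_abs[OF i2] iT k2b in \<open>auto simp: abs_mult intro!: mult_left_mono\<close>)
    also have "\<dots> = (LINT z|lborel. \<bar>T z\<bar>) * R powr (1 - p)"
    proof -
      have [measurable]: "T \<in> borel_measurable borel" using T by (simp add: bdd_int_def)
      have "(\<lambda>z. \<bar>T z\<bar>) \<in> borel_measurable borel" by measurable
      from lborel_integral_diff[OF this, of y] show ?thesis by simp
    qed
    also have "\<dots> \<le> C * R powr (1 - p)" using T by (intro mult_right_mono) (auto simp: bdd_int_def)
    finally show "\<bar>LINT z|lborel. T (y - z) * k2 z\<bar> \<le> C * R powr (1 - p)" .
  qed
  have "(\<lambda>n. LINT z|lborel. \<Theta>n n (xn n - z) * k1 z) \<longlonglongrightarrow> (LINT z|lborel. \<Theta> (x - z) * k1 z)"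
  proof (rule integral_dominated_convergence[OF _ _ w])
    show "AE z in lborel. (\<lambda>n. \<Theta>n n (xn n - z) * k1 z) \<longlonglongrightarrow> \<Theta> (x - z) * k1 z"
      using lim by eventually_elim (intro tendsto_mult tendsto_const)
    show "AE z in lborel. norm (\<Theta>n n (xn n - z) * k1 z) \<le> C * (norm z powr (1 - p) * indicator (cball 0 1) z + indicator (cball 0 R) z)" for n
      using dom1[OF b(1)] by (intro always_eventually allI) simp
  qed measurable
  from LIMSEQ_D[OF this half_gt_zero[OF r]]
  obtain N where N: "\<And>n. n \<ge> N \<Longrightarrow> \<bar>(LINT z|lborel. \<Theta>n n (xn n - z) * k1 z) - (LINT z|lborel. \<Theta> (x - z) * k1 z)\<bar> < r/2"
    unfolding real_norm_def by blast
  show "\<exists>N. \<forall>n\<ge>N. norm (conv (ker p e) (\<Theta>n n) (xn n) - conv (ker p e) \<Theta> x) < r"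
  proof (intro exI[of _ N] allI impI)
    fix n assume "n \<ge> N"
    from N[OF this] tail[OF b(1)[of n], of "xn n"] tail[OF b(2), of x] R(1)
    show "norm (conv (ker p e) (\<Theta>n n) (xn n) - conv (ker p e) \<Theta> x) < r"
      unfolding split[OF b(1)[of n], of "xn n"] split[OF b(2), of x] real_norm_def by linarith
  qed
qed

lemma conv_far_lipschitz:
  assumes \<Theta>: "bdd_int C \<Theta>" and e: "norm e = 1" and p: "1 < p"
  shows "\<bar>conv (far p e) \<Theta> x - conv (far p e) \<Theta> x'\<bar> \<le> (1 + p) * C * norm (x - x')"
proof -
  have m[measurable]: "\<Theta> \<in> borel_measurable borel" and i\<Theta>: "integrable lborel \<Theta>" and L: "(LINT y|lborel. \<bar>\<Theta> y\<bar>) \<le> C"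
    using \<Theta> by (auto simp: bdd_int_def)
  have i: "integrable lborel (\<lambda>y. \<Theta> y * far p e (x - y))" for x
    by (rule conv_commute_integrable[OF conv_integrable_far[OF \<Theta> e p]])
  have "conv (far p e) \<Theta> x - conv (far p e) \<Theta> x' = (LINT y|lborel. \<Theta> y * far p e (x - y) - \<Theta> y * far p e (x' - y))"
    unfolding conv_commute[OF m far_measurable] using i[of x] i[of x'] by simp
  also have "\<bar>\<dots>\<bar> \<le> (LINT y|lborel. \<bar>\<Theta> y\<bar> * ((1 + p) * norm (x - x')))"
  proof (rule order_trans[OF integral_abs_bound], rule integral_mono)
    show "integrable lborel (\<lambda>y. \<bar>\<Theta> y * far p e (x - y) - \<Theta> y * far p e (x' - y)\<bar>)"
      by (intro integrable_abs Bochner_Integration.integrable_diff i)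
    show "integrable lborel (\<lambda>y. \<bar>\<Theta> y\<bar> * ((1 + p) * norm (x - x')))"
      using i\<Theta> by (intro integrable_mult_left integrable_abs)
    fix y
    have "\<bar>far p e (x - y) - far p e (x' - y)\<bar> \<le> (1 + p) * norm (x - x')"
      using far_lipschitz[OF e, of p "x - y" "x' - y"] p by simp
    then show "\<bar>\<Theta> y * far p e (x - y) - \<Theta> y * far p e (x' - y)\<bar> \<le> \<bar>\<Theta> y\<bar> * ((1 + p) * norm (x - x'))"
      unfolding right_diff_distrib[symmetric] abs_mult by (rule mult_left_mono) simp
  qed
  also have "\<dots> = (LINT y|lborel. \<bar>\<Theta> y\<bar>) * ((1 + p) * norm (x - x'))" by simp
  also have "\<dots> \<le> C * ((1 + p) * norm (x - x'))" using L p by (intro mult_right_mono) auto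
  finally show ?thesis by (simp add: mult_ac)
qed

text \<open>The near part puts the increment on \<Theta>, the far part on the kernel. Only
  horizontal shifts are possible, since the odd extension may jump across the axis.\<close>

lemma conv_ker_lipschitz_1:
  assumes \<Theta>: "bdd_int C \<Theta>" and e: "norm e = 1" and p: "1 < p" "p < 3"
    and lip: "\<And>y k. \<bar>\<Theta> (y + (k, 0)) - \<Theta> y\<bar> \<le> C * \<bar>k\<bar>"
  shows "\<bar>conv (ker p e) \<Theta> (x + (k, 0)) - conv (ker p e) \<Theta> x\<bar> \<le>
    (C * (LINT z|lborel. \<bar>near p e z\<bar>) + (1 + p) * C) * \<bar>k\<bar>"
proof -
  note i = conv_integrable_near[OF \<Theta> e p]
  have "conv (near p e) \<Theta> (x + (k, 0)) - conv (near p e) \<Theta> x = (LINT z|lborel. \<Theta> (x + (k, 0) - z) * near p e z - \<Theta> (x - z) * near p e z)"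
    unfolding conv_def by (rule Bochner_Integration.integral_diff[symmetric, OF i i])
  also have "\<bar>\<dots>\<bar> \<le> (LINT z|lborel. C * \<bar>k\<bar> * \<bar>near p e z\<bar>)"
  proof (rule order_trans[OF integral_abs_bound], rule integral_mono)
    show "integrable lborel (\<lambda>z. \<bar>\<Theta> (x + (k, 0) - z) * near p e z - \<Theta> (x - z) * near p e z\<bar>)"
      by (intro integrable_abs Bochner_Integration.integrable_diff i)
    show "integrable lborel (\<lambda>z. C * \<bar>k\<bar> * \<bar>near p e z\<bar>)"
      by (intro integrable_mult_right integrable_abs integrable_near e p)
    fix z
    have eq: "x + (k, 0) - z = (x - z) + (k, 0)" by simp
    have "\<bar>\<Theta> (x + (k, 0) - z) - \<Theta> (x - z)\<bar> \<le> C * \<bar>k\<bar>" unfolding eq by (rule lip)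
    then show "\<bar>\<Theta> (x + (k, 0) - z) * near p e z - \<Theta> (x - z) * near p e z\<bar> \<le> C * \<bar>k\<bar> * \<bar>near p e z\<bar>"
      unfolding left_diff_distrib[symmetric] abs_mult by (rule mult_right_mono) simp
  qed
  finally have "\<bar>conv (near p e) \<Theta> (x + (k, 0)) - conv (near p e) \<Theta> x\<bar> \<le> C * (LINT z|lborel. \<bar>near p e z\<bar>) * \<bar>k\<bar>"
    by (simp add: mult_ac)
  moreover have "\<bar>conv (far p e) \<Theta> (x + (k, 0)) - conv (far p e) \<Theta> x\<bar> \<le> (1 + p) * C * \<bar>k\<bar>"
    using conv_far_lipschitz[OF \<Theta> e p(1), of "x + (k, 0)" x] by (simp add: norm_Pair)
  ultimately show ?thesis unfolding conv_ker_eq[OF \<Theta> e p] distrib_right by linarith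
qed

text \<open>Differentiating the radial factor costs |z|^(-p-1); the factor \<open>fst z\<close> in
  the kernel and the extra weight \<open>\<bar>fst z\<bar>\<close> win back two powers and leave the
  integrable |z|^(1-p). Either alternative on \<open>snd w\<close> is enough because the radial
  factor sees only the norm.\<close>

lemma near_diff_bound:
  assumes p: "1 < p" and z1: "fst z \<noteq> 0" and w: "fst w = fst z" "\<bar>snd w - snd z\<bar> \<le> d \<or> \<bar>snd w + snd z\<bar> \<le> d"
  shows "\<bar>fst z\<bar> * \<bar>near p (-1, 0) z - near p (-1, 0) w\<bar> \<le>
    p * d * (norm z powr (1 - p) * indicator (cball 0 1) z + norm w powr (1 - p) * indicator (cball 0 1) w)"
proof -
  have d: "d \<ge> 0" using w(2) by linarith
  \<comment> \<open>Clipping at 0 gives one formula for \<open>near\<close> inside and outside the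
    unit ball and does not increase differences.\<close>
  define v where "v r = max 0 (r powr - p - 1)" for r :: real
  have pos: "norm z > 0" "norm w > 0" using z1 w(1) by auto
  have nv: "near p (-1, 0) y = - fst y * v (norm y)" if "norm y > 0" for y
  proof (cases "norm y \<le> 1")
    case True
    have "norm y powr - p \<ge> 1" using powr_mono2'[of "- p" "norm y" 1] p True that by simp
    then show ?thesis using True by (simp add: near_eq v_def inner_prod_def)
  next
    case False
    have "norm y powr - p \<le> 1" using powr_mono[of "- p" 0 "norm y"] p False by (auto split: if_splits)
    then show ?thesis using False by (simp add: near_eq_0 v_def)
  qed
  have dn: "\<bar>norm w - norm z\<bar> \<le> d"
    using w(2)
  proof
    assume "\<bar>snd w - snd z\<bar> \<le> d"
    moreover have "norm (w - z) = \<bar>snd w - snd z\<bar>" using w(1) by (simp add: norm_prod_def)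
    ultimately show ?thesis using norm_triangle_ineq3[of w z] by linarith
  next
    assume "\<bar>snd w + snd z\<bar> \<le> d"
    moreover have "norm (w - reflect z) = \<bar>snd w + snd z\<bar>" using w(1) by (simp add: norm_prod_def)
    ultimately show ?thesis using norm_triangle_ineq3[of w "reflect z"] by simp
  qed
  have eq: "\<bar>fst z\<bar> * \<bar>near p (-1, 0) z - near p (-1, 0) w\<bar> = \<bar>fst z\<bar> * (\<bar>fst z\<bar> * \<bar>v (norm z) - v (norm w)\<bar>)"
    unfolding nv[OF pos(1)] nv[OF pos(2)] w(1) by (simp add: abs_mult[symmetric] right_diff_distrib abs_minus_commute)
  define \<mu> where "\<mu> = min (norm z) (norm w)"
  have \<mu>: "\<mu> > 0" using pos by (simp add: \<mu>_def)
  have f\<mu>: "\<bar>fst z\<bar> \<le> \<mu>"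
    using norm_fst_le[of "fst z" "snd z"] norm_fst_le[of "fst w" "snd w", unfolded prod.collapse] w(1) by (simp add: \<mu>_def)
  show ?thesis
  proof (cases "\<mu> \<le> 1")
    case True
    have "\<bar>v (norm z) - v (norm w)\<bar> \<le> \<bar>norm z powr - p - norm w powr - p\<bar>" unfolding v_def by linarith
    also have "\<dots> \<le> p * \<mu> powr (- p - 1) * \<bar>norm w - norm z\<bar>"
      unfolding \<mu>_def using abs_powr_minus_diff_le[of "norm z" "norm w" p] pos p by simp
    also have "\<dots> \<le> p * \<mu> powr (- p - 1) * d" using dn p by (intro mult_left_mono) auto
    finally have "\<bar>fst z\<bar> * (\<bar>fst z\<bar> * \<bar>v (norm z) - v (norm w)\<bar>) \<le> \<mu> * (\<mu> * (p * \<mu> powr (- p - 1) * d))"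
      using f\<mu> \<mu> p d by (intro mult_mono) auto
    also have "\<dots> = p * d * \<mu> powr (1 - p)"
      using \<mu> by (simp add: powr_diff powr_minus divide_simps)
    also have "\<dots> \<le> p * d * (norm z powr (1 - p) * indicator (cball 0 1) z + norm w powr (1 - p) * indicator (cball 0 1) w)"
      using True p d by (intro mult_left_mono) (auto simp: \<mu>_def min_def indicator_def split: if_splits)
    finally show ?thesis unfolding eq .
  next
    case False
    then have "near p (-1, 0) z = 0" "near p (-1, 0) w = 0" by (auto simp: \<mu>_def intro!: near_eq_0)
    then show ?thesis using p d by (simp add: indicator_def)
  qed
qed

text \<open>The vertical velocity vanishes linearly at the boundary, which offsets the blow-up of
  the vertical derivative of the solution. The near part is symmetrised twice. Under z_1 -> -z_1 the
  kernel is odd, and \<Theta> is replaced by a horizontal difference of size |z_1|; under reflection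
  about height \<open>h\<close> that difference is odd, and the kernel is replaced by a difference
  over \<open>2 * h\<close>.\<close>

lemma conv_ker_vertical_bound:
  assumes \<Theta>: "bdd_int C \<Theta>" and odd: "\<And>y. \<Theta> (reflect y) = - \<Theta> y" and p: "1 < p" "p < 3"
    and lip: "\<And>y k. \<bar>\<Theta> (y + (k, 0)) - \<Theta> y\<bar> \<le> C * \<bar>k\<bar>" and h: "h > 0"
  shows "\<bar>conv (ker p (-1, 0)) \<Theta> (a, h)\<bar> \<le>
    (2 * C * p * (LINT z::real\<times>real|lborel. norm z powr (1 - p) * indicator (cball 0 1) z) + (1 + p) * C) * h"
proof -
  have C: "C \<ge> 0" using \<Theta> by (rule bdd_int_nonneg)
  have m[measurable]: "\<Theta> \<in> borel_measurable borel" using \<Theta> by (simp add: bdd_int_def)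
  define e :: "real \<times> real" where "e = (-1, 0)"
  have e: "norm e = 1" by (simp add: e_def norm_Pair)
  define G :: "real \<times> real \<Rightarrow> real" where "G z = norm z powr (1 - p) * indicator (cball 0 1) z" for z
  have iG: "integrable lborel G" unfolding G_def[abs_def] using integrable_norm_powr_near_0[of "p - 1"] p by simp
  \<comment> \<open>Chosen so that \<open>(a, h) - \<sigma> z\<close> is the mirror image of
    \<open>(a, h) - z\<close> across the boundary, where oddness of \<Theta> applies.\<close>
  define \<sigma> :: "real \<times> real \<Rightarrow> real \<times> real" where "\<sigma> z = (0 + 1 * fst z, 2 * h + (-1) * snd z)" for z
  define \<tau> :: "real \<times> real \<Rightarrow> real \<times> real" where "\<tau> z = (0 + (-1) * fst z, 0 + 1 * snd z)" for z
  have [measurable]: "\<sigma> \<in> borel_measurable borel" "\<tau> \<in> borel_measurable borel"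
    unfolding \<sigma>_def[abs_def] \<tau>_def[abs_def] by measurable
  have \<sigma>I: "(LINT z|lborel. f (\<sigma> z)) = (LINT z|lborel. f z)" if "f \<in> borel_measurable borel" for f :: "real \<times> real \<Rightarrow> real"
    unfolding \<sigma>_def using lborel_integral_affine_pair[OF that, of 1 "-1" 0 "2 * h"] by simp
  have \<tau>I: "(LINT z|lborel. f (\<tau> z)) = (LINT z|lborel. f z)" if "f \<in> borel_measurable borel" for f :: "real \<times> real \<Rightarrow> real"
    unfolding \<tau>_def using lborel_integral_affine_pair[OF that, of "-1" 1 0 0] by simp
  have \<sigma>i: "integrable lborel (\<lambda>z. f (\<sigma> z))" if "integrable lborel f" for f :: "real \<times> real \<Rightarrow> real"
    unfolding \<sigma>_def by (rule lborel_integrable_affine_pair[OF that]) auto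
  have \<tau>i: "integrable lborel (\<lambda>z. f (\<tau> z))" if "integrable lborel f" for f :: "real \<times> real \<Rightarrow> real"
    unfolding \<tau>_def by (rule lborel_integrable_affine_pair[OF that]) auto
  define N where "N = conv (near p e) \<Theta> (a, h)"
  have i0: "integrable lborel (\<lambda>z. \<Theta> ((a, h) - z) * near p e z)" by (rule conv_integrable_near[OF \<Theta> e p])
  have near\<tau>: "near p e (\<tau> z) = - near p e z" for z
    by (simp add: near_def ker_def far_def e_def \<tau>_def inner_prod_def norm_prod_def)
  have N\<tau>: "N = - (LINT z|lborel. \<Theta> ((a, h) - \<tau> z) * near p e z)"
    using \<tau>I[of "\<lambda>z. \<Theta> ((a, h) - z) * near p e z"] by (simp add: N_def conv_def near\<tau>)
  have i\<tau>: "integrable lborel (\<lambda>z. \<Theta> ((a, h) - \<tau> z) * near p e z)"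
    using \<tau>i[OF i0] by (simp add: near\<tau>)
  define \<Delta> where "\<Delta> z = \<Theta> ((a, h) - z) - \<Theta> ((a, h) - \<tau> z)" for z
  have [measurable]: "\<Delta> \<in> borel_measurable borel" unfolding \<Delta>_def[abs_def] by measurable
  have i\<Delta>: "integrable lborel (\<lambda>z. \<Delta> z * near p e z)"
    unfolding \<Delta>_def left_diff_distrib by (intro Bochner_Integration.integrable_diff i0 i\<tau>)
  have 2: "2 * N = (LINT z|lborel. \<Delta> z * near p e z)"
    unfolding \<Delta>_def left_diff_distrib Bochner_Integration.integral_diff[OF i0 i\<tau>] using N\<tau> by (simp add: N_def conv_def)
  have \<Delta>\<sigma>: "\<Delta> (\<sigma> z) = - \<Delta> z" for z
  proof -
    have "(a, h) - \<sigma> z = reflect ((a, h) - z)" "(a, h) - \<tau> (\<sigma> z) = reflect ((a, h) - \<tau> z)"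
      by (simp_all add: \<sigma>_def \<tau>_def reflect_def prod_eq_iff)
    then show ?thesis by (simp add: \<Delta>_def odd)
  qed
  have i\<sigma>: "integrable lborel (\<lambda>z. \<Delta> z * near p e (\<sigma> z))"
    using \<sigma>i[OF i\<Delta>] by (simp add: \<Delta>\<sigma>)
  have "2 * N = - (LINT z|lborel. \<Delta> z * near p e (\<sigma> z))"
    using \<sigma>I[of "\<lambda>z. \<Delta> z * near p e z"] by (simp add: 2 \<Delta>\<sigma>)
  then have 4: "4 * N = (LINT z|lborel. \<Delta> z * (near p e z - near p e (\<sigma> z)))"
    unfolding right_diff_distrib Bochner_Integration.integral_diff[OF i\<Delta> i\<sigma>] using 2 by simp
  have \<Delta>b: "\<bar>\<Delta> z\<bar> \<le> 2 * C * \<bar>fst z\<bar>" for z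
  proof -
    have eq: "(a, h) - \<tau> z + (- 2 * fst z, 0) = (a, h) - z" by (simp add: \<tau>_def prod_eq_iff)
    show ?thesis
      using lip[of "(a, h) - \<tau> z" "- 2 * fst z"] unfolding eq by (simp add: \<Delta>_def abs_mult mult_ac)
  qed
  have "\<bar>4 * N\<bar> \<le> (LINT z|lborel. 2 * C * (p * (2 * h) * (G z + G (\<sigma> z))))"
    unfolding 4
  proof (rule order_trans[OF integral_abs_bound], rule integral_mono_AE)
    show "integrable lborel (\<lambda>z. \<bar>\<Delta> z * (near p e z - near p e (\<sigma> z))\<bar>)"
      unfolding right_diff_distrib by (intro integrable_abs Bochner_Integration.integrable_diff i\<Delta> i\<sigma>)
    show "integrable lborel (\<lambda>z. 2 * C * (p * (2 * h) * (G z + G (\<sigma> z))))"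
      by (intro integrable_mult_right Bochner_Integration.integrable_add iG \<sigma>i)
    show "AE z in lborel. \<bar>\<Delta> z * (near p e z - near p e (\<sigma> z))\<bar> \<le> 2 * C * (p * (2 * h) * (G z + G (\<sigma> z)))"
      using AE_fst_snd_neq(1)[of 0]
    proof eventually_elim
      case (elim z)
      have "\<bar>\<Delta> z * (near p e z - near p e (\<sigma> z))\<bar> \<le> 2 * C * (\<bar>fst z\<bar> * \<bar>near p e z - near p e (\<sigma> z)\<bar>)"
        using mult_right_mono[OF \<Delta>b[of z], of "\<bar>near p e z - near p e (\<sigma> z)\<bar>"] by (simp add: abs_mult mult_ac)
      also have "\<dots> \<le> 2 * C * (p * (2 * h) * (G z + G (\<sigma> z)))"
        unfolding G_def e_def
        by (intro mult_left_mono near_diff_bound) (use p elim h C in \<open>auto simp: \<sigma>_def\<close>)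
      finally show ?case .
    qed
  qed
  also have "\<dots> = 2 * C * (p * (2 * h) * ((LINT z|lborel. G z) + (LINT z|lborel. G (\<sigma> z))))"
    using iG \<sigma>i[OF iG] by simp
  also have "(LINT z|lborel. G (\<sigma> z)) = (LINT z|lborel. G z)" using iG by (intro \<sigma>I) auto
  finally have N: "\<bar>N\<bar> \<le> 2 * C * p * (LINT z|lborel. G z) * h" by (simp add: abs_mult algebra_simps)
  \<comment> \<open>At height 0 the far part vanishes, its kernel being even and \<Theta> odd under
    the reflection; Lipschitz continuity then gives a bound linear in \<open>h\<close>.\<close>
  define F where "F = conv (far p e) \<Theta> (a, 0)"
  have "F = (LINT y|lborel. \<Theta> y * far p e ((a, 0) - y))" unfolding F_def by (rule conv_commute) measurable
  also have "\<dots> = (LINT y|lborel. \<Theta> (reflect y) * far p e ((a, 0) - reflect y))"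
    by (rule lborel_integral_reflect[symmetric]) measurable
  also have "\<dots> = (LINT y|lborel. - (\<Theta> y * far p e ((a, 0) - y)))"
  proof (intro Bochner_Integration.integral_cong refl)
    fix y
    have "(a, 0) - reflect y = reflect ((a, 0) - y)" by (simp add: prod_eq_iff)
    then have "far p e ((a, 0) - reflect y) = far p e ((a, 0) - y)"
      by (simp add: far_def e_def inner_prod_def)
    then show "\<Theta> (reflect y) * far p e ((a, 0) - reflect y) = - (\<Theta> y * far p e ((a, 0) - y))" by (simp add: odd)
  qed
  also have "\<dots> = - F" unfolding F_def by (subst conv_commute) simp_all
  finally have "F = 0" by simp
  then have "\<bar>conv (far p e) \<Theta> (a, h)\<bar> \<le> (1 + p) * C * h"
    using conv_far_lipschitz[OF \<Theta> e p(1), of "(a, h)" "(a, 0)"] h by (simp add: F_def norm_Pair)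
  then show ?thesis
    using N unfolding e_def[symmetric] conv_ker_eq[OF \<Theta> e p] N_def G_def distrib_right by linarith
qed

section \<open>The boundary layer\<close>

text \<open>After rescaling lengths by \<open>h\<close> about \<open>(a, 0)\<close>, this is the
  kernel of the difference between the horizontal velocities at heights \<open>h\<close> and
  0.\<close>

definition qker :: "real \<Rightarrow> real \<times> real \<Rightarrow> real" where
  "qker p z = ker p (0, 1) (fst z, 1 - snd z) - ker p (0, 1) (fst z, - snd z)"

lemma qker_measurable [measurable]: "qker p \<in> borel_measurable borel"
proof -
  have [measurable]: "(\<lambda>z :: real \<times> real. (fst z, 1 - snd z)) \<in> borel_measurable borel"
    "(\<lambda>z :: real \<times> real. (fst z, - snd z)) \<in> borel_measurable borel"
    by (intro borel_measurable_continuous_onI continuous_intros)+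
  show ?thesis unfolding qker_def[abs_def] by measurable
qed

lemma norm_e2: "norm (0 :: real, 1 :: real) = 1"
  by (simp add: norm_Pair)

text \<open>The difference of two kernels one unit apart gains a power, from |z|^(1-p) to |z|^(-p),
  which is integrable at infinity because p > 2.\<close>

lemma qker_bound_at_infinity:
  assumes p: "1 < p" and z: "norm z > 3"
  shows "\<bar>qker p z\<bar> \<le> (1 + 2 * p) * 2 powr p * norm z powr - p"
proof -
  define w where "w = (fst z, 1 - snd z)"
  define z' where "z' = (fst z, - snd z)"
  define r where "r = norm z"
  have r: "r > 3" using z by (simp add: r_def)
  have nz': "norm z' = r" by (simp add: z'_def r_def norm_prod_def)
  have d: "norm (w - z') = 1" by (simp add: w_def z'_def norm_Pair)
  have dn: "\<bar>norm w - r\<bar> \<le> 1" using norm_triangle_ineq3[of w z'] by (simp add: d nz')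
  have w: "norm w \<ge> r/2" using dn r by linarith
  have "qker p z = (w \<bullet> (0, 1)) * norm w powr - p - (z' \<bullet> (0, 1)) * r powr - p"
    by (simp add: qker_def ker_def w_def z'_def nz'[unfolded z'_def])
  also have "\<dots> = norm w powr - p + (z' \<bullet> (0, 1)) * (norm w powr - p - r powr - p)"
    by (simp add: w_def z'_def inner_prod_def algebra_simps)
  also have "\<bar>\<dots>\<bar> \<le> norm w powr - p + \<bar>z' \<bullet> (0, 1)\<bar> * \<bar>norm w powr - p - r powr - p\<bar>"
    by (metis abs_mult abs_of_nonneg abs_triangle_ineq powr_ge_zero)
  also have "\<dots> \<le> (r/2) powr - p + r * (p * (r/2) powr (- p - 1) * 1)"
  proof (intro add_mono mult_mono)
    show "norm w powr - p \<le> (r/2) powr - p" using w r p by (intro powr_mono2') auto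
    show "\<bar>z' \<bullet> (0, 1)\<bar> \<le> r" using Cauchy_Schwarz_ineq2[of z' "(0,1)"] by (simp add: nz' norm_e2)
    have "\<bar>norm w powr - p - r powr - p\<bar> \<le> p * (min (norm w) r) powr (- p - 1) * \<bar>r - norm w\<bar>"
      using w r p by (intro abs_powr_minus_diff_le) auto
    also have "\<dots> \<le> p * (r/2) powr (- p - 1) * 1"
      using w r p dn by (intro mult_mono powr_mono2') auto
    finally show "\<bar>norm w powr - p - r powr - p\<bar> \<le> p * (r/2) powr (- p - 1) * 1" .
  qed (use r in auto)
  also have "r * (p * (r/2) powr (- p - 1) * 1) = 2 * p * (r/2) powr - p"
    using r by (simp add: powr_diff)
  also have "(r/2) powr - p = 2 powr p * r powr - p"
    using r by (simp add: powr_divide powr_minus divide_simps)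
  finally show ?thesis by (simp add: r_def algebra_simps)
qed

lemma integrable_qker:
  assumes p: "2 < p" "p < 3"
  shows "integrable lborel (qker p)"
proof (rule Bochner_Integration.integrable_bound)
  define G :: "real \<times> real \<Rightarrow> real" where "G z = norm z powr (1 - p) * indicator (cball 0 1) z" for z
  have iG: "integrable lborel G" unfolding G_def[abs_def] using integrable_norm_powr_near_0[of "p - 1"] p by simp
  have "integrable lborel (\<lambda>z. G (0 + 1 * fst z, 1 + (-1) * snd z))" "integrable lborel (\<lambda>z. G (0 + 1 * fst z, 0 + (-1) * snd z))"
    by (intro lborel_integrable_affine_pair[OF iG]; simp)+
  moreover have "integrable lborel (indicator (cball 0 3) :: real \<times> real \<Rightarrow> real)"
    using emeasure_lborel_cball_finite[of "0::real\<times>real" 3] by (intro integrable_real_indicator) auto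
  ultimately show "integrable lborel (\<lambda>z. (G (0 + 1 * fst z, 1 + (-1) * snd z) + G (0 + 1 * fst z, 0 + (-1) * snd z) + 2 * indicator (cball 0 3) z)
      + (1 + 2 * p) * 2 powr p * (max 1 (norm z)) powr - p)"
    using p by (intro Bochner_Integration.integrable_add integrable_mult_right integrable_norm_powr_at_infinity) auto
  have G0: "G z \<ge> 0" for z by (simp add: G_def)
  show "AE z in lborel. norm (qker p z) \<le> norm ((G (0 + 1 * fst z, 1 + (-1) * snd z) + G (0 + 1 * fst z, 0 + (-1) * snd z) + 2 * indicator (cball 0 3) z)
      + (1 + 2 * p) * 2 powr p * (max 1 (norm z)) powr - p)" (is "AE z in _. _ \<le> norm (?A z + ?B z)")
  proof (intro always_eventually allI)
    fix z
    have A: "?A z \<ge> 0" using G0 by simp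
    have B: "?B z \<ge> 0" using p by simp
    show "norm (qker p z) \<le> norm (?A z + ?B z)"
    proof (cases "norm z \<le> 3")
      case True
      have "\<bar>qker p z\<bar> \<le> \<bar>ker p (0, 1) (fst z, 1 - snd z)\<bar> + \<bar>ker p (0, 1) (fst z, - snd z)\<bar>"
        unfolding qker_def by linarith
      also have "\<dots> \<le> ?A z"
        using True ker_le_near_0[OF norm_e2, of p "(fst z, 1 - snd z)"] ker_le_near_0[OF norm_e2, of p "(fst z, - snd z)"] p
        by (simp add: G_def)
      finally show ?thesis using A B by simp
    next
      case False
      then have "\<bar>qker p z\<bar> \<le> ?B z" using qker_bound_at_infinity[of p z] p by (simp add: max_def)
      then show ?thesis using A B by simp
    qed
  qed
qed simp

text \<open>The substitution z_2 -> 1 - z_2 preserves \<open>qker\<close>, so the sign may be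
  replaced by its average with \<open>sgn (1 - snd z)\<close>. That average vanishes for z_2 outside
  [0,1], and for z_2 in that interval both terms of \<open>qker\<close> are nonnegative. This fixes
  the sign of the shear.\<close>

lemma integral_sgn_qker_pos:
  assumes p: "2 < p" "p < 3"
  shows "(LINT z|lborel. sgn (snd z) * qker p z) > 0"
proof -
  have sgm[measurable]: "(sgn :: real \<Rightarrow> real) \<in> borel_measurable borel"
    unfolding sgn_if[abs_def] by measurable
  have i: "integrable lborel (\<lambda>z. sgn (snd z) * qker p z)"
    by (rule Bochner_Integration.integrable_bound[OF integrable_qker[OF p]])
       (auto intro!: always_eventually simp: abs_mult sgn_if)
  have ker_neg: "ker p (0, 1) (a, - b) = - ker p (0, 1) (a, b)" for a b
    by (simp add: ker_def norm_prod_def inner_prod_def)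
  have ker0: "ker p (0, 1) (a, 0) = 0" for a by (simp add: ker_def inner_prod_def)
  have sym: "qker p (0 + 1 * fst z, 1 + (-1) * snd z) = qker p z" for z
    using ker_neg[of "fst z" "1 - snd z"] ker_neg[of "fst z" "snd z"] by (simp add: qker_def)
  have i': "integrable lborel (\<lambda>z. sgn (1 - snd z) * qker p z)"
    using lborel_integrable_affine_pair[OF i, of 1 "-1" 0 1] unfolding sym by simp
  have "(LINT z|lborel. sgn (snd z) * qker p z) = (LINT z|lborel. sgn (1 - snd z) * qker p z)"
    using lborel_integral_affine_pair[of "\<lambda>z. sgn (snd z) * qker p z" 1 "-1" 0 1] unfolding sym by simp
  then have eq: "2 * (LINT z|lborel. sgn (snd z) * qker p z) = (LINT z|lborel. (sgn (snd z) + sgn (1 - snd z)) * qker p z)"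
    unfolding distrib_right using Bochner_Integration.integral_add[OF i i'] by simp
  have kb: "ker p (0, 1) (a, b) \<ge> b * 2 powr - p" if "\<bar>a\<bar> \<le> 1" "0 \<le> b" "b \<le> 1" for a b
  proof (cases "b = 0")
    case False
    have "norm (a, b) \<le> 2" using norm_Pair_le[of a b] that by simp
    moreover have "norm (a, b) > 0" using False by (simp add: zero_prod_def)
    ultimately have "2 powr - p \<le> norm (a, b) powr - p" using p by (intro powr_mono2') auto
    then show ?thesis using that by (simp add: ker_def inner_prod_def mult_left_mono)
  qed (simp add: ker0)
  have nonneg: "qker p z \<ge> 0" if "0 \<le> snd z" "snd z \<le> 1" for z
    using that ker_neg[of "fst z" "snd z"] by (simp add: qker_def ker_def inner_prod_def)
  have "0 < (LINT z|lborel. 2 powr - p * indicator (cbox (0, 1/4) (1, 1/2)) (z :: real \<times> real))"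
    by (simp add: content_Pair)
  also have "\<dots> \<le> (LINT z|lborel. (sgn (snd z) + sgn (1 - snd z)) * qker p z)"
  proof (rule integral_mono)
    show "integrable lborel (\<lambda>z. 2 powr - p * indicator (cbox (0, 1/4) (1, 1/2)) (z :: real \<times> real))"
      by (intro integrable_mult_right integrable_real_indicator[OF _ emeasure_lborel_cbox_finite]) auto
    show "integrable lborel (\<lambda>z. (sgn (snd z) + sgn (1 - snd z)) * qker p z)"
      unfolding distrib_right using i i' by simp
    fix z :: "real \<times> real"
    show "2 powr - p * indicator (cbox (0, 1/4) (1, 1/2)) z \<le> (sgn (snd z) + sgn (1 - snd z)) * qker p z"
    proof (cases "z \<in> cbox (0, 1/4) (1, 1/2)")
      case True
      then have z: "\<bar>fst z\<bar> \<le> 1" "0 < snd z" "snd z < 1" by (cases z; auto simp: cbox_Pair_eq)+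
      \<comment> \<open>The two lower bounds from \<open>kb\<close> add up, because
        \<open>(1 - snd z) + snd z = 1\<close>.\<close>
      have "qker p z \<ge> 2 powr - p"
        using kb[of "fst z" "1 - snd z"] kb[of "fst z" "snd z"] z ker_neg[of "fst z" "snd z"]
        by (simp add: qker_def algebra_simps)
      then have "2 * qker p z \<ge> 2 powr - p" using powr_ge_zero[of 2 "- p"] by linarith
      then show ?thesis using True z by simp
    next
      case False
      consider "snd z < 0" | "0 \<le> snd z" "snd z \<le> 1" | "snd z > 1" by linarith
      then have "0 \<le> (sgn (snd z) + sgn (1 - snd z)) * qker p z"
      proof cases
        case 2
        then show ?thesis using nonneg[of z] by (intro mult_nonneg_nonneg add_nonneg_nonneg) auto
      qed auto
      then show ?thesis using False by simp
    qed
  qed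
  finally show ?thesis using eq by simp
qed

text \<open>The Jacobian h^2 times the homogeneity factor h^(1-p) of the kernel gives h^(3-p), which
  is h^(1-2\<alpha>) for p = 2 + 2\<alpha>.\<close>

lemma conv_ker_boundary_layer:
  assumes \<Theta>: "bdd_int C \<Theta>" and p: "2 < p" "p < 3" and h: "h > 0"
  shows "conv (ker p (0, 1)) \<Theta> (a, h) - conv (ker p (0, 1)) \<Theta> (a, 0) =
    h powr (3 - p) * (LINT z|lborel. \<Theta> (a - h * fst z, h * snd z) * qker p z)"
    "integrable lborel (\<lambda>z. \<Theta> (a - h * fst z, h * snd z) * qker p z)"
proof -
  let ?e = "(0, 1) :: real \<times> real"
  have p': "1 < p" using p by simp
  have m[measurable]: "\<Theta> \<in> borel_measurable borel" using \<Theta> by (simp add: bdd_int_def)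
  have i: "integrable lborel (\<lambda>y. \<Theta> y * ker p ?e (x - y))" for x
    by (rule conv_commute_integrable[OF conv_integrable_ker[OF \<Theta> norm_e2 p' p(2)]])
  define f where "f y = \<Theta> y * ker p ?e ((a, h) - y) - \<Theta> y * ker p ?e ((a, 0) - y)" for y
  have fi: "integrable lborel f" unfolding f_def[abs_def] by (intro Bochner_Integration.integrable_diff i)
  have scale: "ker p ?e (h * s, h * t) = h powr (1 - p) * ker p ?e (s, t)" for s t
  proof -
    have "(h * s, h * t) = h *\<^sub>R (s, t)" by simp
    then have "norm (h * s, h * t) = h * norm (s, t)" using h by (simp del: scaleR_Pair)
    then have "norm (h * s, h * t) powr - p = h powr - p * norm (s, t) powr - p" using h by (simp add: powr_mult)
    moreover have "h * h powr - p = h powr (1 - p)" using h by (simp add: powr_diff powr_minus divide_inverse)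
    ultimately show ?thesis by (simp add: ker_def inner_prod_def mult_ac)
  qed
  have fz: "f (a + (- h) * fst z, 0 + h * snd z) = h powr (1 - p) * (\<Theta> (a - h * fst z, h * snd z) * qker p z)" for z
    using scale[of "fst z" "1 - snd z"] scale[of "fst z" "- snd z"]
    by (simp add: f_def qker_def algebra_simps)
  show "integrable lborel (\<lambda>z. \<Theta> (a - h * fst z, h * snd z) * qker p z)"
    using lborel_integrable_affine_pair[OF fi, of "- h" h a 0] h unfolding fz by simp
  have "conv (ker p ?e) \<Theta> (a, h) - conv (ker p ?e) \<Theta> (a, 0) = (LINT y|lborel. f y)"
    unfolding f_def conv_commute[OF m ker_measurable] by (rule Bochner_Integration.integral_diff[symmetric, OF i i])
  also have "\<dots> = \<bar>(- h) * h\<bar> * (LINT z|lborel. f (a + (- h) * fst z, 0 + h * snd z))"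
    by (rule lborel_integral_affine_pair) (use fi h in auto)
  also have "\<dots> = (h * h * h powr (1 - p)) * (LINT z|lborel. \<Theta> (a - h * fst z, h * snd z) * qker p z)"
    unfolding fz by (simp add: abs_mult)
  also have "h * h * h powr (1 - p) = h powr (3 - p)"
  proof -
    have hh: "h * h = h powr 2" using h by (simp add: powr_realpow power2_eq_square)
    show ?thesis unfolding hh by (subst powr_add[symmetric]) simp
  qed
  finally show "conv (ker p ?e) \<Theta> (a, h) - conv (ker p ?e) \<Theta> (a, 0) =
    h powr (3 - p) * (LINT z|lborel. \<Theta> (a - h * fst z, h * snd z) * qker p z)" .
qed

text \<open>The error made by replacing the density, at the rescaled point \<open>z\<close>, by its
  value at height \<open>h\<close>: a horizontal Lipschitz term plus a vertical Hoelder term. Those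
  grow with \<open>z\<close>, so they are capped by the trivial bound, which keeps the product with
  \<open>qker\<close> integrable.\<close>

definition layer_err :: "real \<Rightarrow> real \<Rightarrow> real \<Rightarrow> real \<Rightarrow> real \<Rightarrow> real \<times> real \<Rightarrow> real" where
  "layer_err C K \<gamma> p h z = min C (K * h * \<bar>fst z\<bar> + K * (h * max 1 \<bar>snd z\<bar>) powr \<gamma>) * \<bar>qker p z\<bar>"

lemma layer_err_measurable [measurable]: "layer_err C K \<gamma> p h \<in> borel_measurable borel"
  unfolding layer_err_def[abs_def] by measurable

lemma layer_err_nonneg: "0 \<le> C \<Longrightarrow> 0 \<le> K \<Longrightarrow> 0 \<le> h \<Longrightarrow> 0 \<le> layer_err C K \<gamma> p h z"
  by (simp add: layer_err_def)

lemma layer_err_le: "layer_err C K \<gamma> p h z \<le> C * \<bar>qker p z\<bar>"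
  unfolding layer_err_def by (intro mult_right_mono) auto

lemma integrable_layer_err:
  assumes "2 < p" "p < 3" "0 \<le> C" "0 \<le> K" "0 \<le> h"
  shows "integrable lborel (layer_err C K \<gamma> p h)"
proof (rule Bochner_Integration.integrable_bound)
  show "integrable lborel (\<lambda>z. C * \<bar>qker p z\<bar>)" using integrable_qker assms by auto
  show "AE z in lborel. norm (layer_err C K \<gamma> p h z) \<le> norm (C * \<bar>qker p z\<bar>)"
    using layer_err_nonneg[of C K h] layer_err_le[of C K \<gamma> p h] assms
    by (intro always_eventually allI) auto
qed simp

lemma layer_err_mono:
  assumes "0 \<le> K" "0 \<le> h" "h \<le> h'" "0 \<le> \<gamma>"
  shows "layer_err C K \<gamma> p h z \<le> layer_err C K \<gamma> p h' z"
  unfolding layer_err_def using assms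
  by (intro mult_right_mono min.mono order_refl add_mono mult_left_mono powr_mono2) auto

lemma layer_err_tendsto:
  assumes p: "2 < p" "p < 3" and CK: "0 \<le> C" "0 \<le> K" and \<gamma>: "0 < \<gamma>"
  shows "((\<lambda>h. LINT z|lborel. layer_err C K \<gamma> p h z) \<longlongrightarrow> 0) (at_right 0)"
proof -
  have "((\<lambda>h. LINT z|lborel. layer_err C K \<gamma> p h z) \<longlongrightarrow> (LINT z|(lborel :: (real \<times> real) measure). 0)) (at_right 0)"
    unfolding tendsto_at_iff_sequentially comp_def
  proof (intro allI impI)
    fix X :: "nat \<Rightarrow> real" assume X: "\<forall>i. X i \<in> {0<..} - {0}" "X \<longlonglongrightarrow> 0"
    have X0: "X n > 0" for n using X(1) by auto
    show "(\<lambda>n. LINT z|lborel. layer_err C K \<gamma> p (X n) z) \<longlonglongrightarrow> (LINT z|(lborel :: (real \<times> real) measure). 0)"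
    proof (rule integral_dominated_convergence[where w="\<lambda>z. C * \<bar>qker p z\<bar>"])
      show "integrable lborel (\<lambda>z. C * \<bar>qker p z\<bar>)" using integrable_qker p by auto
      show "AE z in lborel. norm (layer_err C K \<gamma> p (X n) z) \<le> C * \<bar>qker p z\<bar>" for n
        using layer_err_nonneg[OF CK, of "X n"] layer_err_le[of C K \<gamma> p "X n"] X0[of n]
        by (intro always_eventually allI) (auto simp: less_imp_le)
      show "AE z in lborel. (\<lambda>n. layer_err C K \<gamma> p (X n) z) \<longlonglongrightarrow> 0"
      proof (intro always_eventually allI)
        fix z :: "real \<times> real"
        have 1: "(\<lambda>n. X n * max 1 \<bar>snd z\<bar>) \<longlonglongrightarrow> 0 * max 1 \<bar>snd z\<bar>" by (intro tendsto_intros X(2))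
        have 2: "(\<lambda>n. (X n * max 1 \<bar>snd z\<bar>) powr \<gamma>) \<longlonglongrightarrow> 0 powr \<gamma>"
          by (rule tendsto_powr') (use 1 \<gamma> X0 in \<open>auto intro!: always_eventually simp: less_imp_le\<close>)
        have "(\<lambda>n. layer_err C K \<gamma> p (X n) z) \<longlonglongrightarrow> min C (K * 0 * \<bar>fst z\<bar> + K * 0 powr \<gamma>) * \<bar>qker p z\<bar>"
          unfolding layer_err_def by (intro tendsto_mult tendsto_min tendsto_add tendsto_const X(2) 2)
        then show "(\<lambda>n. layer_err C K \<gamma> p (X n) z) \<longlonglongrightarrow> 0" using CK by simp
      qed
    qed simp_all
  qed
  then show ?thesis by simp
qed

text \<open>In the boundary layer the odd extension is close to \<open>sgn (snd z) * v\<close>, and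
  integrating this profile against \<open>qker\<close> gives the leading term. The number
  \<open>v\<close> is left free, so that the value at height \<open>h\<close> can be used instead of
  a boundary trace.\<close>

lemma conv_ker_boundary_expansion:
  assumes \<Theta>: "bdd_int C \<Theta>" and p: "2 < p" "p < 3" and h: "h > 0" and K: "K \<ge> 0" and D: "D \<ge> 0"
    and err: "\<And>z. snd z \<noteq> 0 \<Longrightarrow> \<bar>\<Theta> (a - h * fst z, h * snd z) - sgn (snd z) * v\<bar> \<le>
       min D (K * h * \<bar>fst z\<bar> + K * (h * max 1 \<bar>snd z\<bar>) powr \<gamma>)"
  shows "\<bar>conv (ker p (0, 1)) \<Theta> (a, h) - conv (ker p (0, 1)) \<Theta> (a, 0) - (LINT z|lborel. sgn (snd z) * qker p z) * h powr (3 - p) * v\<bar>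
    \<le> h powr (3 - p) * (LINT z|lborel. layer_err D K \<gamma> p h z)"
proof -
  note bl = conv_ker_boundary_layer[OF \<Theta> p h, of a]
  have [measurable]: "(sgn :: real \<Rightarrow> real) \<in> borel_measurable borel"
    unfolding sgn_if[abs_def] by measurable
  have i: "integrable lborel (\<lambda>z. sgn (snd z) * qker p z)"
    by (rule Bochner_Integration.integrable_bound[OF integrable_qker[OF p]])
       (auto intro!: always_eventually simp: abs_mult sgn_if)
  have i': "integrable lborel (\<lambda>z. sgn (snd z) * v * qker p z)"
    using integrable_mult_right[OF i, of v] by (simp add: mult_ac)
  have "conv (ker p (0, 1)) \<Theta> (a, h) - conv (ker p (0, 1)) \<Theta> (a, 0) - (LINT z|lborel. sgn (snd z) * qker p z) * h powr (3 - p) * v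
    = h powr (3 - p) * ((LINT z|lborel. \<Theta> (a - h * fst z, h * snd z) * qker p z) - (LINT z|lborel. sgn (snd z) * v * qker p z))"
  proof -
    have "(LINT z|lborel. sgn (snd z) * v * qker p z) = v * (LINT z|lborel. sgn (snd z) * qker p z)"
      by (subst integral_mult_right_zero[symmetric]) (simp add: mult_ac)
    then show ?thesis unfolding bl(1) by (simp add: algebra_simps)
  qed
  also have "(LINT z|lborel. \<Theta> (a - h * fst z, h * snd z) * qker p z) - (LINT z|lborel. sgn (snd z) * v * qker p z)
     = (LINT z|lborel. (\<Theta> (a - h * fst z, h * snd z) - sgn (snd z) * v) * qker p z)"
    unfolding left_diff_distrib by (rule Bochner_Integration.integral_diff[symmetric, OF bl(2) i'])
  finally have eq: "\<bar>conv (ker p (0, 1)) \<Theta> (a, h) - conv (ker p (0, 1)) \<Theta> (a, 0) - (LINT z|lborel. sgn (snd z) * qker p z) * h powr (3 - p) * v\<bar>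
    = h powr (3 - p) * \<bar>LINT z|lborel. (\<Theta> (a - h * fst z, h * snd z) - sgn (snd z) * v) * qker p z\<bar>"
    by (simp add: abs_mult)
  have "\<bar>LINT z|lborel. (\<Theta> (a - h * fst z, h * snd z) - sgn (snd z) * v) * qker p z\<bar> \<le> (LINT z|lborel. layer_err D K \<gamma> p h z)"
  proof (rule order_trans[OF integral_abs_bound], rule integral_mono_AE)
    show "integrable lborel (\<lambda>z. \<bar>(\<Theta> (a - h * fst z, h * snd z) - sgn (snd z) * v) * qker p z\<bar>)"
      unfolding left_diff_distrib by (intro integrable_abs Bochner_Integration.integrable_diff bl(2) i')
    show "integrable lborel (layer_err D K \<gamma> p h)"
      using p D K h by (intro integrable_layer_err) auto
    show "AE z in lborel. \<bar>(\<Theta> (a - h * fst z, h * snd z) - sgn (snd z) * v) * qker p z\<bar> \<le> layer_err D K \<gamma> p h z"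
      using AE_fst_snd_neq(2)[of 0]
      by eventually_elim (auto simp only: abs_mult layer_err_def intro!: mult_right_mono err abs_ge_zero)
  qed
  then show ?thesis unfolding eq by (intro mult_left_mono) auto
qed

section \<open>Time slices of solutions\<close>

text \<open>The pointwise content of a bound on \<open>X_norm\<close> for a continuous
  representative. Increments go upwards, so that only the region above \<open>y\<close> matters; the
  half in \<open>snd y / 2\<close> puts \<open>y\<close> inside an open set on which the weight is
  bounded below.\<close>

definition slice_bound :: "real \<Rightarrow> real \<Rightarrow> (real \<times> real \<Rightarrow> real) \<Rightarrow> bool" where
  "slice_bound C \<beta> f \<longleftrightarrow> (\<forall>y\<in>halfplane. \<bar>f y\<bar> \<le> C) \<and> L1_norm f \<le> ennreal C
     \<and> (\<forall>y\<in>halfplane. \<forall>k. \<bar>f (y + (k, 0)) - f y\<bar> \<le> C * \<bar>k\<bar>)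
     \<and> (\<forall>y\<in>halfplane. \<forall>k\<ge>0. \<bar>f (y + (0, k)) - f y\<bar> \<le> C * max 1 ((snd y / 2) powr - \<beta>) * k)"

lemma AE_continuous_le:
  fixes f :: "'a::euclidean_space \<Rightarrow> real"
  assumes S: "open S" and cont: "continuous_on S f" and le: "AE x in lborel. x \<in> S \<longrightarrow> f x \<le> c" and x: "x \<in> S"
  shows "f x \<le> c"
proof (rule ccontr)
  assume "\<not> f x \<le> c"
  then have "x \<in> S \<inter> f -` {c<..}" using x by simp
  moreover have "open (S \<inter> f -` {c<..})" by (rule continuous_open_preimage[OF cont S open_greaterThan])
  ultimately obtain r where r: "r > 0" "ball x r \<subseteq> S \<inter> f -` {c<..}" by (metis open_contains_ball)
  have "AE y in lborel. y \<notin> ball x r" using le by eventually_elim (use r in auto)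
  then have "emeasure lborel (ball x r) = 0"
    by (subst (asm) AE_iff_measurable[of "ball x r"]) auto
  then show False using content_ball_pos[OF r(1), of x] by (simp add: measure_def)
qed

lemma Linf_norm_AE:
  assumes "Linf_norm g < ennreal C"
  shows "AE x in lborel. x \<in> halfplane \<longrightarrow> \<bar>g x\<bar> \<le> C"
proof -
  have "AE x in lebesgue_on halfplane. ennreal \<bar>g x\<bar> \<le> Linf_norm g"
    unfolding Linf_norm_def by (rule esssup_AE)
  then have "AE x in lebesgue_on halfplane. \<bar>g x\<bar> \<le> C"
  proof eventually_elim
    case (elim x)
    then have "ennreal \<bar>g x\<bar> < ennreal C" using assms by (rule le_less_trans)
    then show ?case by (simp add: ennreal_less_iff)
  qed
  then show ?thesis by (simp add: AE_halfplane_iff)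
qed

lemma X_norm_imp_slice_bound:
  assumes cont: "continuous_on halfplane f" and X: "X_norm \<beta> f < ennreal C" and \<beta>: "\<beta> \<ge> 0"
  shows "slice_bound C \<beta> f"
proof -
  have C: "C > 0" using X by (metis ennreal_neg leI not_less_zero)
  define i1 where "i1 = (INF g\<in>{g. has_weak_deriv (1, 0) f g}. Linf_norm g)"
  define i2 where "i2 = (INF g\<in>{g. has_weak_deriv (0, 1) f g}. Linf_norm (\<lambda>x. min (snd x powr \<beta>) 1 * g x))"
  have Xeq: "X_norm \<beta> f = Linf_norm f + (i1 + i2) + L1_norm f"
    by (simp add: X_norm_def W_norm_def W_seminorm_def i1_def i2_def)
  have "Linf_norm f \<le> X_norm \<beta> f" "i1 \<le> X_norm \<beta> f" "i2 \<le> X_norm \<beta> f" "L1_norm f \<le> X_norm \<beta> f"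
    unfolding Xeq by (simp_all add: add_increasing add_increasing2)
  then have lt: "Linf_norm f < ennreal C" "i1 < ennreal C" "i2 < ennreal C" "L1_norm f < ennreal C"
    using X by (auto intro: le_less_trans)
  have "\<bar>f y\<bar> \<le> C" if "y \<in> halfplane" for y
    by (rule AE_continuous_le[OF open_halfplane _ Linf_norm_AE[OF lt(1)] that])
       (intro continuous_on_rabs cont)
  moreover have "\<bar>f (y + (k, 0)) - f y\<bar> \<le> C * \<bar>k\<bar>" if y: "y \<in> halfplane" for y k
  proof -
    obtain g where g: "has_weak_deriv (1, 0) f g" "Linf_norm g < ennreal C"
      using lt(2) unfolding i1_def by (auto simp: INF_less_iff)
    have pos: "\<bar>f (y + (k, 0)) - f y\<bar> \<le> C * k" if "k > 0" "y \<in> halfplane" for k y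
      using weak_deriv_increment_bound[OF g(1) cont open_halfplane convex_halfplane order_refl Linf_norm_AE[OF g(2)], of y k]
        that C by (simp add: halfplane_iff)
    consider "k = 0" | "k > 0" | "k < 0" by linarith
    then show ?thesis
    proof cases
      case 1
      then show ?thesis by (simp add: zero_prod_def[symmetric])
    next
      case 2
      then show ?thesis using pos[of k y] y by simp
    next
      case 3
      have eq: "y + (k, 0) + (- k, 0) = y" by (simp add: prod_eq_iff)
      have "\<bar>f (y + (k, 0) + (- k, 0)) - f (y + (k, 0))\<bar> \<le> C * (- k)"
        using 3 y by (intro pos) (auto simp: halfplane_iff)
      then show ?thesis unfolding eq using 3 by (simp add: abs_minus_commute)
    qed
  qed
  moreover have "\<bar>f (y + (0, k)) - f y\<bar> \<le> C * max 1 ((snd y / 2) powr - \<beta>) * k" if y: "y \<in> halfplane" and k: "k \<ge> 0" for y k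
  proof (cases "k = 0")
    case True
    then show ?thesis by (simp add: zero_prod_def[symmetric])
  next
    case False
    obtain g where g: "has_weak_deriv (0, 1) f g" "Linf_norm (\<lambda>x. min (snd x powr \<beta>) 1 * g x) < ennreal C"
      using lt(3) unfolding i2_def by (auto simp: INF_less_iff)
    define s where "s = snd y / 2"
    have s: "s > 0" using y by (simp add: s_def halfplane_iff)
    \<comment> \<open>On this open half-plane the weight is at least
      \<open>min (s powr \<beta>) 1\<close>, so the weighted bound becomes a plain one for the weak
      derivative.\<close>
    define S :: "(real \<times> real) set" where "S = UNIV \<times> {s<..}"
    have S: "open S" "convex S" "S \<subseteq> halfplane"
      unfolding S_def halfplane_def using s by (auto intro!: open_Times convex_Times)
    have "AE x in lborel. x \<in> S \<longrightarrow> \<bar>g x\<bar> \<le> C * max 1 (s powr - \<beta>)"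
      using Linf_norm_AE[OF g(2)]
    proof eventually_elim
      case (elim x)
      show ?case
      proof
        assume x: "x \<in> S"
        then have sx: "snd x > s" by (auto simp: S_def)
        define m where "m = min (snd x powr \<beta>) 1"
        have m: "m > 0" using sx s by (simp add: m_def)
        have "m * \<bar>g x\<bar> \<le> C" using elim x S m by (auto simp: m_def abs_mult)
        then have "\<bar>g x\<bar> \<le> C * (1 / m)" using m by (simp add: field_simps)
        also have "1 / m \<le> max 1 (s powr - \<beta>)"
        proof (cases "snd x powr \<beta> \<le> 1")
          case True
          then have "1 / m = snd x powr - \<beta>" by (simp add: m_def powr_minus_divide)
          also have "\<dots> \<le> s powr - \<beta>" using sx s \<beta> by (intro powr_mono2') auto
          finally show ?thesis by simp
        qed (simp add: m_def)
        finally show "\<bar>g x\<bar> \<le> C * max 1 (s powr - \<beta>)" using C by simp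
      qed
    qed
    from weak_deriv_increment_bound[OF g(1) cont S this, of y k] False k s C
    show ?thesis by (simp add: S_def s_def mem_Times_iff)
  qed
  ultimately show ?thesis using lt(4) by (auto simp: slice_bound_def)
qed

lemma LinfX_norm_less_imp_slice_bound:
  assumes cont: "\<And>t. t \<in> {0..T} \<Longrightarrow> continuous_on halfplane (f t)"
    and L: "LinfX_norm T \<beta> f < ennreal C" and \<beta>: "\<beta> \<ge> 0"
  shows "AE t in lborel. t \<in> {0..T} \<longrightarrow> slice_bound C \<beta> (f t)"
proof -
  obtain c where c: "AE t in lebesgue_on {0..T}. X_norm \<beta> (f t) \<le> c" "c < ennreal C"
    using L unfolding LinfX_norm_def by (auto simp: Inf_less_iff)
  have "AE t in lborel. t \<in> {0..T} \<longrightarrow> X_norm \<beta> (f t) \<le> c"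
    using c(1) by (simp add: AE_restrict_space_iff AE_completion_iff)
  then show ?thesis
  proof eventually_elim
    case (elim t)
    show ?case
    proof
      assume t: "t \<in> {0..T}"
      then have "X_norm \<beta> (f t) < ennreal C" using elim c(2) by (auto intro: le_less_trans)
      then show "slice_bound C \<beta> (f t)" by (intro X_norm_imp_slice_bound cont t \<beta>)
    qed
  qed
qed

section \<open>Continuity of solutions and attainment of the data\<close>

lemma locally_lipschitz_on_continuous:
  assumes "locally_lipschitz_on S f" shows "continuous_on S f"
  unfolding continuous_on_eq_continuous_within
proof
  fix p assume p: "p \<in> S"
  then obtain r L where r: "r > 0" "L-lipschitz_on (ball p r \<inter> S) f"
    using assms unfolding locally_lipschitz_on_def by blast
  have "continuous_on (ball p r \<inter> S) f" by (rule lipschitz_on_continuous_on[OF r(2)])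
  then have "continuous (at p within ball p r \<inter> S) f"
    using p r(1) by (simp add: continuous_on_eq_continuous_within)
  moreover have "at p within ball p r \<inter> S = at p within S"
    using r(1) by (intro at_within_nhd[of p "ball p r"]) auto
  ultimately show "continuous (at p within S) f" by simp
qed

lemma classical_solution_continuous:
  assumes "classical_solution \<alpha> T \<theta>"
  shows "continuous_on ({0..T} \<times> halfplane) (\<lambda>(t, x). \<theta> t x)"
    and "t \<in> {0..T} \<Longrightarrow> continuous_on halfplane (\<theta> t)"
proof -
  show c: "continuous_on ({0..T} \<times> halfplane) (\<lambda>(t, x). \<theta> t x)"
    using assms unfolding classical_solution_def by (intro locally_lipschitz_on_continuous) blast
  assume t: "t \<in> {0..T}"
  have "continuous_on halfplane (\<lambda>x. (\<lambda>(t, x). \<theta> t x) (t, x))"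
    by (rule continuous_on_compose2[OF c]) (use t in \<open>auto intro!: continuous_intros\<close>)
  then show "continuous_on halfplane (\<theta> t)" by simp
qed

lemma LinfX_space_slice_bound:
  assumes \<theta>: "\<theta> \<in> LinfX_space T \<beta>" "classical_solution \<alpha> T \<theta>" and \<beta>: "\<beta> \<ge> 0"
  obtains C where "C > 0" "AE t in lborel. t \<in> {0..T} \<longrightarrow> slice_bound C \<beta> (\<theta> t)"
proof -
  have "LinfX_norm T \<beta> \<theta> < \<infinity>" using \<theta>(1) by (simp add: LinfX_space_def)
  then obtain r where r: "r \<ge> 0" "LinfX_norm T \<beta> \<theta> = ennreal r"
    by (cases "LinfX_norm T \<beta> \<theta>") auto
  have "LinfX_norm T \<beta> \<theta> < ennreal (r + 1)" using r by (simp add: ennreal_less_iff)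
  from LinfX_norm_less_imp_slice_bound[OF classical_solution_continuous(2)[OF \<theta>(2)] this \<beta>] r(1)
  show ?thesis by (intro that[of "r + 1"]) auto
qed

lemma classical_solution_AE:
  assumes "classical_solution \<alpha> T \<theta>"
  shows "AE p in lborel. p \<in> {0..T} \<times> halfplane \<longrightarrow>
    (\<exists>D. ((\<lambda>(t, x). \<theta> t x) has_derivative D) (at p) \<and> D (1, 0) + D (0, gsqg_velocity \<alpha> (\<theta> (fst p)) (snd p)) = 0)"
proof -
  have "{0..T} \<times> halfplane \<in> sets (lborel :: (real \<times> real \<times> real) measure)"
    using borel_Times[of "{0..T}" halfplane] by simp
  then have "{0..T} \<times> halfplane \<in> sets (lebesgue :: (real \<times> real \<times> real) measure)" by (rule sets_completionI_sets)
  then show ?thesis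
    using assms unfolding classical_solution_def
    by (auto simp: AE_restrict_space_iff AE_completion_iff case_prod_unfold elim!: eventually_mono)
qed

lemma AE_fst:
  assumes "AE t in lborel. P t"
  shows "AE p in (lborel :: ('a::euclidean_space \<times> 'b::euclidean_space) measure). P (fst p)"
proof -
  obtain N where N: "N \<in> null_sets lborel" "{t. \<not> P t} \<subseteq> N"
    using assms unfolding eventually_ae_filter by auto
  have "N \<times> UNIV \<in> null_sets (lborel \<Otimes>\<^sub>M (lborel :: 'b measure))"
    using N(1) by (intro null_sets_def[THEN eq_reflection, THEN meta_eq_to_obj_eq, THEN equalityD2, THEN subsetD] CollectI conjI)
       (auto simp: null_sets_def lborel.emeasure_pair_measure_Times)
  then have "N \<times> UNIV \<in> null_sets (lborel :: ('a \<times> 'b) measure)" by (simp add: lborel_prod)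
  then show ?thesis by (rule AE_I') (use N(2) in auto)
qed

lemma initial_data_eq:
  assumes sol: "classical_solution \<alpha> T \<theta>" and T: "T > 0" and "has_initial_data \<theta> \<theta>0"
    and cont: "continuous_on halfplane \<theta>0" and x: "x \<in> halfplane"
  shows "\<theta> 0 x = \<theta>0 x"
proof -
  have "AE x in lborel. x \<in> halfplane \<longrightarrow> \<bar>\<theta> 0 x - \<theta>0 x\<bar> \<le> 0"
    using assms(3) unfolding has_initial_data_def AE_halfplane_iff by eventually_elim auto
  then have "\<bar>\<theta> 0 x - \<theta>0 x\<bar> \<le> 0"
    by (rule AE_continuous_le[where f="\<lambda>x. \<bar>\<theta> 0 x - \<theta>0 x\<bar>", OF open_halfplane _ _ x, rotated])
       (use T in \<open>auto intro!: continuous_intros cont classical_solution_continuous(2)[OF sol]\<close>)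
  then show ?thesis by simp
qed

text \<open>Joint continuity holds off the axis, on either side of which the extension is \<theta>
  up to sign. For the convolution this is convergence almost everywhere.\<close>

lemma odd_ext_tendsto:
  assumes cont: "continuous_on ({0..T} \<times> halfplane) (\<lambda>(t, x). \<theta> t x)"
    and tn: "\<And>n. tn n \<in> {0..T}" "tn \<longlonglongrightarrow> t" "t \<in> {0..T}" and yn: "yn \<longlonglongrightarrow> y" and y: "snd y \<noteq> 0"
  shows "(\<lambda>n. odd_ext (\<theta> (tn n)) (yn n)) \<longlonglongrightarrow> odd_ext (\<theta> t) y"
proof -
  have sy: "(\<lambda>n. snd (yn n)) \<longlonglongrightarrow> snd y" by (intro tendsto_intros yn)
  have *: "(\<lambda>n. \<theta> (tn n) (zn n)) \<longlonglongrightarrow> \<theta> t z" if z: "zn \<longlonglongrightarrow> z" "snd z > 0" for zn z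
  proof -
    have "(\<lambda>n. snd (zn n)) \<longlonglongrightarrow> snd z" by (intro tendsto_intros z)
    then have "eventually (\<lambda>n. snd (zn n) > 0) sequentially" using z(2) by (rule order_tendstoD)
    then have ev: "eventually (\<lambda>n. (tn n, zn n) \<in> {0..T} \<times> halfplane) sequentially"
      by eventually_elim (use tn(1) in \<open>auto simp: halfplane_iff\<close>)
    have "(\<lambda>n. (\<lambda>(t, x). \<theta> t x) (tn n, zn n)) \<longlonglongrightarrow> (\<lambda>(t, x). \<theta> t x) (t, z)"
      by (rule continuous_on_tendsto_compose[OF cont tendsto_Pair[OF tn(2) z(1)] _ ev])
         (use tn(3) z(2) in \<open>auto simp: halfplane_iff\<close>)
    then show ?thesis by simp
  qed
  show ?thesis
  proof (cases "snd y > 0")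
    case True
    have "eventually (\<lambda>n. snd (yn n) > 0) sequentially" using sy True by (rule order_tendstoD)
    then have "eventually (\<lambda>n. \<theta> (tn n) (yn n) = odd_ext (\<theta> (tn n)) (yn n)) sequentially"
      by eventually_elim (simp add: odd_ext_def)
    from Lim_transform_eventually[OF *[OF yn True] this] True show ?thesis by (simp add: odd_ext_def)
  next
    case False
    then have neg: "snd y < 0" using y by simp
    have r: "(\<lambda>n. reflect (yn n)) \<longlonglongrightarrow> reflect y" unfolding reflect_def by (intro tendsto_intros yn)
    have "eventually (\<lambda>n. snd (yn n) < 0) sequentially" using sy neg by (rule order_tendstoD)
    then have "eventually (\<lambda>n. - \<theta> (tn n) (reflect (yn n)) = odd_ext (\<theta> (tn n)) (yn n)) sequentially"
      by eventually_elim (simp add: odd_ext_def)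
    from Lim_transform_eventually[OF tendsto_minus[OF *[OF r]] this] neg show ?thesis by (simp add: odd_ext_def)
  qed
qed

lemma slice_bound_bdd_int:
  assumes "slice_bound C \<beta> f" "continuous_on halfplane f" "C > 0"
  shows "bdd_int C (\<lambda>y. indicator halfplane y * f y)"
  by (rule restrict_bdd_int) (use assms in \<open>auto simp: slice_bound_def\<close>)

lemma velocity_near_initial_time:
  assumes \<alpha>: "0 < \<alpha>" "\<alpha> < 1/2" and T: "T > 0"
    and cont: "continuous_on ({0..T} \<times> halfplane) (\<lambda>(t, x). \<theta> t x)"
    and bd: "bdd_int C (\<lambda>y. indicator halfplane y * \<theta> 0 y)" and \<epsilon>: "\<epsilon> > 0"
  shows "\<exists>\<delta>>0. \<forall>t\<in>{0..T}. \<forall>x. t < \<delta> \<longrightarrow> dist x x0 < \<delta> \<longrightarrow> bdd_int C (\<lambda>y. indicator halfplane y * \<theta> t y) \<longrightarrow>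
    norm (gsqg_velocity \<alpha> (\<theta> t) x - gsqg_velocity \<alpha> (\<theta> 0) x0) < \<epsilon>"
proof (rule ccontr)
  assume "\<not> ?thesis"
  then have neg: "\<exists>t\<in>{0..T}. \<exists>x. t < \<delta> \<and> dist x x0 < \<delta> \<and> bdd_int C (\<lambda>y. indicator halfplane y * \<theta> t y) \<and>
      \<not> norm (gsqg_velocity \<alpha> (\<theta> t) x - gsqg_velocity \<alpha> (\<theta> 0) x0) < \<epsilon>" if "\<delta> > 0" for \<delta>
    using that by blast
  have "\<forall>n. \<exists>t x. t \<in> {0..T} \<and> t < 1 / real (Suc n) \<and> dist x x0 < 1 / real (Suc n) \<and>
      bdd_int C (\<lambda>y. indicator halfplane y * \<theta> t y) \<and> \<not> norm (gsqg_velocity \<alpha> (\<theta> t) x - gsqg_velocity \<alpha> (\<theta> 0) x0) < \<epsilon>"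
  proof
    fix n
    show "\<exists>t x. t \<in> {0..T} \<and> t < 1 / real (Suc n) \<and> dist x x0 < 1 / real (Suc n) \<and>
      bdd_int C (\<lambda>y. indicator halfplane y * \<theta> t y) \<and> \<not> norm (gsqg_velocity \<alpha> (\<theta> t) x - gsqg_velocity \<alpha> (\<theta> 0) x0) < \<epsilon>"
      using neg[of "1 / real (Suc n)"] by fastforce
  qed
  from choice[OF this] obtain tn where "\<forall>n. \<exists>x. tn n \<in> {0..T} \<and> tn n < 1 / real (Suc n) \<and> dist (x) x0 < 1 / real (Suc n) \<and>
      bdd_int C (\<lambda>y. indicator halfplane y * \<theta> (tn n) y) \<and> \<not> norm (gsqg_velocity \<alpha> (\<theta> (tn n)) (x) - gsqg_velocity \<alpha> (\<theta> 0) x0) < \<epsilon>" by blast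
  from choice[OF this] obtain xn where xtn: "\<forall>n. tn n \<in> {0..T} \<and> tn n < 1 / real (Suc n) \<and> dist (xn n) x0 < 1 / real (Suc n) \<and>
      bdd_int C (\<lambda>y. indicator halfplane y * \<theta> (tn n) y) \<and> \<not> norm (gsqg_velocity \<alpha> (\<theta> (tn n)) (xn n) - gsqg_velocity \<alpha> (\<theta> 0) x0) < \<epsilon>" by blast
  have *: "\<And>n. tn n \<in> {0..T}" "\<And>n. tn n < 1 / real (Suc n)" "\<And>n. dist (xn n) x0 < 1 / real (Suc n)"
    "\<And>n. bdd_int C (\<lambda>y. indicator halfplane y * \<theta> (tn n) y)"
    "\<And>n. \<not> norm (gsqg_velocity \<alpha> (\<theta> (tn n)) (xn n) - gsqg_velocity \<alpha> (\<theta> 0) x0) < \<epsilon>"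
    using xtn by blast+
  have lim: "(\<lambda>n. 1 / real (Suc n)) \<longlonglongrightarrow> 0" by (rule LIMSEQ_Suc[OF lim_1_over_n])
  have tn: "tn \<longlonglongrightarrow> 0"
  proof (rule real_tendsto_sandwich[OF _ _ tendsto_const lim])
    show "eventually (\<lambda>n. 0 \<le> tn n) sequentially" using *(1) by (intro always_eventually allI) simp
    show "eventually (\<lambda>n. tn n \<le> 1 / real (Suc n)) sequentially"
      by (intro always_eventually allI less_imp_le *(2))
  qed
  have "(\<lambda>n. dist (xn n) x0) \<longlonglongrightarrow> 0"
  proof (rule real_tendsto_sandwich[OF _ _ tendsto_const lim])
    show "eventually (\<lambda>n. dist (xn n) x0 \<le> 1 / real (Suc n)) sequentially"
      by (intro always_eventually allI less_imp_le *(3))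
  qed simp
  then have xn: "xn \<longlonglongrightarrow> x0" by (rule tendsto_dist_iff[THEN iffD2])
  have p: "1 < 2 + 2 * \<alpha>" "2 + 2 * \<alpha> < 3" using \<alpha> by auto
  have ae: "AE z in lborel. (\<lambda>n. odd_ext (\<theta> (tn n)) (xn n - z)) \<longlonglongrightarrow> odd_ext (\<theta> 0) (x0 - z)"
    using AE_fst_snd_neq(2)[of "snd x0"]
  proof eventually_elim
    case (elim z)
    show ?case
      by (rule odd_ext_tendsto[OF cont *(1) tn]) (use T elim in \<open>auto intro!: tendsto_intros xn\<close>)
  qed
  have c: "(\<lambda>n. conv (ker (2 + 2 * \<alpha>) e) (odd_ext (\<theta> (tn n))) (xn n)) \<longlonglongrightarrow> conv (ker (2 + 2 * \<alpha>) e) (odd_ext (\<theta> 0)) x0"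
    if "norm e = 1" for e
    by (rule conv_ker_tendsto[OF bdd_int_odd_ext[OF *(4)] bdd_int_odd_ext[OF bd] that p ae])
  have "(\<lambda>n. gsqg_velocity \<alpha> (\<theta> (tn n)) (xn n)) \<longlonglongrightarrow> gsqg_velocity \<alpha> (\<theta> 0) x0"
    unfolding gsqg_velocity_eq[OF *(4) \<alpha>] gsqg_velocity_eq[OF bd \<alpha>]
    by (intro tendsto_Pair c) (simp_all add: norm_Pair)
  then have "(\<lambda>n. norm (gsqg_velocity \<alpha> (\<theta> (tn n)) (xn n) - gsqg_velocity \<alpha> (\<theta> 0) x0)) \<longlonglongrightarrow> 0"
    by (intro tendsto_norm_zero) (simp add: LIM_zero)
  then have "eventually (\<lambda>n. norm (gsqg_velocity \<alpha> (\<theta> (tn n)) (xn n) - gsqg_velocity \<alpha> (\<theta> 0) x0) < \<epsilon>) sequentially"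
    using \<epsilon> by (rule order_tendstoD)
  then show False using *(5) by (auto simp: eventually_sequentially)
qed

section \<open>Frozen coefficients and part (b)\<close>

lemma bdd_int_mono: "bdd_int C f \<Longrightarrow> C \<le> C' \<Longrightarrow> bdd_int C' f"
  by (auto simp: bdd_int_def intro: order_trans)

lemma slice_bound_mono:
  assumes "slice_bound C \<beta> f" "C \<le> C'"
  shows "slice_bound C' \<beta> f"
proof -
  have 1: "C * \<bar>k\<bar> \<le> C' * \<bar>k\<bar>" for k using assms(2) by (rule mult_right_mono) simp
  have 2: "C * max 1 ((s / 2) powr - \<beta>) * k \<le> C' * max 1 ((s / 2) powr - \<beta>) * k" if "k \<ge> 0" for s k
    using assms(2) that by (intro mult_right_mono) (auto simp: le_max_iff_disj)
  show ?thesis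
    using assms(1) order_trans[OF _ assms(2)] order_trans[OF _ ennreal_leI[OF assms(2)]] order_trans[OF _ 1] order_trans[OF _ 2]
    unfolding slice_bound_def by blast
qed

lemma dist_Pair_le: "dist (a, x) (b, y) \<le> dist a b + dist x y"
  unfolding dist_Pair_Pair using sqrt_sum_squares_le_sum_abs[of "dist a b" "dist x y"] by simp

lemma has_derivative_lipschitz_bound:
  fixes f :: "'a::euclidean_space \<Rightarrow> real"
  assumes D: "(f has_derivative D) (at p)" and S: "open S" "p \<in> S" and lip: "L-lipschitz_on S f"
  shows "\<bar>D v\<bar> \<le> L * norm v"
proof (rule ddir_lipschitz_bound[OF D])
  have "((\<lambda>k. p + k *\<^sub>R v) \<longlongrightarrow> p + 0 *\<^sub>R v) (at_right 0)" by (intro tendsto_intros)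
  then have "eventually (\<lambda>k. p + k *\<^sub>R v \<in> S) (at_right 0)"
    using S by (intro topological_tendstoD) auto
  then show "eventually (\<lambda>k. \<bar>f (p + k *\<^sub>R v) - f p\<bar> \<le> L * norm v * \<bar>k\<bar>) (at_right 0)"
  proof eventually_elim
    case (elim k)
    then show ?case using lipschitz_onD[OF lip elim S(2)] by (auto simp: dist_norm mult_ac)
  qed
qed

text \<open>Along the constant direction \<open>(1, u0)\<close> the equation leaves the derivative
  \<open>D (0, u0 - u)\<close>, which is at most the local Lipschitz constant times the oscillation
  of the velocity. Integrating along straight lines avoids constructing the flow.\<close>

lemma frozen_coefficients:
  assumes \<alpha>: "0 < \<alpha>" "\<alpha> < 1/2" and T: "T > 0" and sol: "classical_solution \<alpha> T \<theta>"
    and sb: "AE t in lborel. t \<in> {0..T} \<longrightarrow> slice_bound C \<beta> (\<theta> t)" and C: "C > 0"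
    and bd: "bdd_int C (\<lambda>y. indicator halfplane y * \<theta> 0 y)" and x0: "x0 \<in> halfplane" and \<epsilon>: "\<epsilon> > 0"
  shows "\<exists>\<delta>>0. \<forall>t x. 0 < t \<longrightarrow> t < \<delta> \<longrightarrow> dist x x0 < \<delta> \<longrightarrow>
    \<bar>\<theta> t x - \<theta> 0 (x - t *\<^sub>R gsqg_velocity \<alpha> (\<theta> 0) x0)\<bar> \<le> \<epsilon> * t"
proof -
  define f where "f = (\<lambda>(t, x). \<theta> t x)"
  define u0 where "u0 = gsqg_velocity \<alpha> (\<theta> 0) x0"
  note cont = classical_solution_continuous[OF sol]
  have "locally_lipschitz_on ({0..T} \<times> halfplane) f" using sol by (simp add: classical_solution_def f_def)
  moreover have "(0, x0) \<in> {0..T} \<times> halfplane" using T x0 by simp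
  ultimately obtain r0 L where r0: "r0 > 0" "L-lipschitz_on (ball (0, x0) r0 \<inter> ({0..T} \<times> halfplane)) f"
    unfolding locally_lipschitz_on_def by blast
  have L: "L \<ge> 0" using r0(2) by (rule lipschitz_on_nonneg)
  obtain r1 where r1: "r1 > 0" "ball x0 r1 \<subseteq> halfplane" using open_halfplane x0 by (metis open_contains_ball)
  \<comment> \<open>The shift by 1 covers the case L = 0.\<close>
  have "\<epsilon> / (L + 1) > 0" using \<epsilon> L by simp
  from velocity_near_initial_time[OF \<alpha> T cont(1) bd this, of x0]
  obtain \<delta>1 where \<delta>1: "\<delta>1 > 0" "\<And>t x. t \<in> {0..T} \<Longrightarrow> t < \<delta>1 \<Longrightarrow> dist x x0 < \<delta>1 \<Longrightarrow>
      bdd_int C (\<lambda>y. indicator halfplane y * \<theta> t y) \<Longrightarrow> norm (gsqg_velocity \<alpha> (\<theta> t) x - u0) < \<epsilon> / (L + 1)"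
    unfolding u0_def by blast
  define \<rho> where "\<rho> = min (r0/2) (min r1 (min \<delta>1 T))"
  have \<rho>: "\<rho> > 0" "2 * \<rho> \<le> r0" "\<rho> \<le> r1" "\<rho> \<le> \<delta>1" "\<rho> \<le> T" using r0 r1 \<delta>1 T by (auto simp: \<rho>_def)
  define S where "S = {0<..<\<rho>} \<times> ball x0 \<rho>"
  have S: "open S" "convex S" unfolding S_def by (intro open_Times convex_Times open_greaterThanLessThan open_ball convex_ball convex_real_interval)+
  have SH: "S \<subseteq> {0..T} \<times> halfplane" using \<rho> r1 by (auto simp: S_def)
  have "S \<subseteq> ball (0, x0) r0"
  proof
    fix p assume "p \<in> S"
    then obtain t x where p: "p = (t, x)" "0 < t" "t < \<rho>" "dist x0 x < \<rho>" by (auto simp: S_def)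
    have "dist (0, x0) p \<le> dist 0 t + dist x0 x" unfolding p(1) by (rule dist_Pair_le)
    also have "\<dots> < r0" using p \<rho> by (simp add: dist_real_def)
    finally show "p \<in> ball (0, x0) r0" by simp
  qed
  then have lip: "L-lipschitz_on S f" using SH by (intro lipschitz_on_subset[OF r0(2)]) auto
  define v :: "real \<times> real \<times> real" where "v = (1, u0)"
  have diff: "AE p in lborel. p \<in> S \<longrightarrow> (\<exists>D. (f has_derivative D) (at p) \<and> \<bar>D v\<bar> \<le> \<epsilon>)"
    using classical_solution_AE[OF sol] AE_fst[OF sb]
  proof eventually_elim
    case (elim p)
    show ?case
    proof
      assume p: "p \<in> S"
      then have pH: "p \<in> {0..T} \<times> halfplane" using SH by blast
      define u where "u = gsqg_velocity \<alpha> (\<theta> (fst p)) (snd p)"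
      obtain D where D: "(f has_derivative D) (at p)" "D (1, 0) + D (0, u) = 0"
        using elim(1) pH by (auto simp: f_def u_def)
      interpret D: bounded_linear D using D(1) by (rule has_derivative_bounded_linear)
      have "fst p \<in> {0..T}" using pH by auto
      then have "bdd_int C (\<lambda>y. indicator halfplane y * \<theta> (fst p) y)"
        using elim(2) C by (intro slice_bound_bdd_int cont(2)) auto
      moreover have "fst p < \<delta>1" "dist (snd p) x0 < \<delta>1" using p \<rho> by (auto simp: S_def dist_commute)
      ultimately have u: "norm (u - u0) < \<epsilon> / (L + 1)"
        unfolding u_def using \<open>fst p \<in> {0..T}\<close> by (intro \<delta>1(2))
      have "v = (1, 0) + (0, u) + (0, u0 - u)" by (simp add: v_def)
      then have "D v = D (1, 0) + D (0, u) + D (0, u0 - u)" by (simp only: D.add)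
      then have "\<bar>D v\<bar> = \<bar>D (0, u0 - u)\<bar>" using D(2) by simp
      also have "\<dots> \<le> L * norm (0 :: real, u0 - u)"
        by (rule has_derivative_lipschitz_bound[OF D(1) S(1) p lip])
      also have "\<dots> = L * norm (u - u0)" by (simp add: norm_Pair norm_minus_commute)
      also have "\<dots> \<le> (L + 1) * (\<epsilon> / (L + 1))" using u L by (intro mult_mono) auto
      also have "\<dots> = \<epsilon>" using L by simp
      finally show "\<exists>D. (f has_derivative D) (at p) \<and> \<bar>D v\<bar> \<le> \<epsilon>" using D(1) by blast
    qed
  qed
  \<comment> \<open>Room for the starting point and for a backward path of length at most
    \<open>\<delta> * norm u0\<close> inside the ball of radius \<rho>.\<close>
  define \<delta> where "\<delta> = \<rho> / (2 + norm u0)"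
  have \<delta>: "\<delta> > 0" "\<delta> * (2 + norm u0) = \<rho>" "\<delta> \<le> \<rho>"
    using \<rho>(1) norm_ge_zero[of u0] unfolding \<delta>_def by (auto simp: field_simps simp del: norm_ge_zero)
  have "\<bar>\<theta> t x - \<theta> 0 (x - t *\<^sub>R u0)\<bar> \<le> \<epsilon> * t" if t: "0 < t" "t < \<delta>" and x: "dist x x0 < \<delta>" for t x
  proof -
    have inB: "x - s *\<^sub>R u0 \<in> ball x0 \<rho>" if "0 \<le> s" "s \<le> t" for s
    proof -
      have "dist x0 (x - s *\<^sub>R u0) \<le> dist x0 x + dist x (x - s *\<^sub>R u0)" by (rule dist_triangle)
      also have "dist x (x - s *\<^sub>R u0) = s * norm u0" using that by (simp add: dist_norm)
      also have "\<dots> \<le> \<delta> * norm u0" using that t by (intro mult_right_mono) auto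
      finally have "dist x0 (x - s *\<^sub>R u0) < \<delta> + \<delta> * norm u0" using x by (simp add: dist_commute)
      also have "\<dots> \<le> \<rho>" using \<delta>(1) by (simp add: \<delta>(2)[symmetric] algebra_simps)
      finally show ?thesis by simp
    qed
    have tx: "(t, x) \<in> S" using inB[of 0] t \<delta> by (simp add: S_def)
    \<comment> \<open>The open set \<open>S\<close> excludes time 0, so the increment is taken from
      times \<open>s > 0\<close> and then carried to the limit by continuity.\<close>
    have ev: "eventually (\<lambda>s. \<bar>f (t, x) - f (s, x - (t - s) *\<^sub>R u0)\<bar> \<le> \<epsilon> * t) (at_right 0)"
      unfolding eventually_at_right_field
    proof (intro exI[of _ t] conjI allI impI t(1))
      fix s assume s: "0 < s" "s < t"
      define p where "p = (s, x - (t - s) *\<^sub>R u0)"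
      have p: "p \<in> S" using inB[of "t - s"] s t \<delta> by (simp add: p_def S_def)
      have pv: "p + (t - s) *\<^sub>R v = (t, x)" by (simp add: p_def v_def)
      have "\<bar>f (p + (t - s) *\<^sub>R v) - f p\<bar> \<le> \<epsilon> * (t - s)"
        by (rule directional_derivative_bound[OF S lip diff p]) (use pv tx s in auto)
      also have "\<dots> \<le> \<epsilon> * t" using s \<epsilon> by (intro mult_left_mono) auto
      finally show "\<bar>f (t, x) - f (s, x - (t - s) *\<^sub>R u0)\<bar> \<le> \<epsilon> * t" unfolding pv unfolding p_def .
    qed
    have H: "x - s *\<^sub>R u0 \<in> halfplane" if "0 \<le> s" "s \<le> t" for s
      using inB[OF that] \<rho>(3) r1(2) by auto
    have "((\<lambda>s. f (s, x - (t - s) *\<^sub>R u0)) \<longlongrightarrow> f (0, x - (t - 0) *\<^sub>R u0)) (at_right 0)"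
    proof (rule continuous_on_tendsto_compose[OF cont(1)[folded f_def]])
      show "((\<lambda>s. (s, x - (t - s) *\<^sub>R u0)) \<longlongrightarrow> (0, x - (t - 0) *\<^sub>R u0)) (at_right 0)"
        by (intro tendsto_intros)
      show "(0, x - (t - 0) *\<^sub>R u0) \<in> {0..T} \<times> halfplane" using H[of t] t T by simp
      show "eventually (\<lambda>s. (s, x - (t - s) *\<^sub>R u0) \<in> {0..T} \<times> halfplane) (at_right 0)"
        unfolding eventually_at_right_field
      proof (intro exI[of _ t] conjI allI impI t(1))
        fix s assume s: "0 < s" "s < t"
        then show "(s, x - (t - s) *\<^sub>R u0) \<in> {0..T} \<times> halfplane" using H[of "t - s"] t \<delta> \<rho> by auto
      qed
    qed
    then have "((\<lambda>s. \<bar>f (t, x) - f (s, x - (t - s) *\<^sub>R u0)\<bar>) \<longlongrightarrow> \<bar>f (t, x) - f (0, x - (t - 0) *\<^sub>R u0)\<bar>) (at_right 0)"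
      by (intro tendsto_intros)
    from tendsto_upperbound[OF this ev] show ?thesis by (simp add: f_def)
  qed
  then show ?thesis using \<delta>(1) unfolding u0_def by blast
qed

section \<open>Velocities of the data in part (b)\<close>

lemma lipschitz_compact_support_bdd_int:
  assumes lip: "L-lipschitz_on UNIV f" and B: "\<And>x. \<bar>f x\<bar> \<le> B" and K: "\<And>x. x \<notin> cbox a b \<Longrightarrow> f x = 0"
  shows "\<exists>C>0. bdd_int C (\<lambda>y. indicator halfplane y * f y)"
proof -
  have m[measurable]: "f \<in> borel_measurable borel"
    by (intro borel_measurable_continuous_onI lipschitz_on_continuous_on[OF lip])
  define g where "g y = indicator halfplane y * f y" for y
  have gB: "\<bar>g y\<bar> \<le> \<bar>B\<bar>" for y using B[of y] by (auto simp: g_def indicator_def)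
  have gm: "g \<in> borel_measurable borel" unfolding g_def[abs_def] by measurable
  have i: "integrable lborel g"
    by (rule integrable_bounded_compact_support[OF gm gB bounded_cbox[of a b]]) (simp add: g_def K)
  show ?thesis
  proof (intro exI[of _ "max 1 (max \<bar>B\<bar> (LINT y|lborel. \<bar>g y\<bar>))"] conjI)
    show "bdd_int (max 1 (max \<bar>B\<bar> (LINT y|lborel. \<bar>g y\<bar>))) (\<lambda>y. indicator halfplane y * f y)"
      unfolding g_def[symmetric] bdd_int_def using gm i gB by (auto simp: le_max_iff_disj)
  qed simp
qed

text \<open>The bump lies above height 4, where \<open>2 - snd y\<close> is negative, and its image
  of opposite sign lies below the axis, where that factor is positive. Both push the horizontal
  velocity at \<open>(0, 2)\<close> the same way.\<close>

lemma velocity_tent2_neg: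
  assumes \<alpha>: "0 < \<alpha>" "\<alpha> < 1/2"
  shows "conv (ker (2 + 2 * \<alpha>) (0, 1)) (odd_ext (tent2 5)) (0, 2) < 0"
proof -
  define p where "p = 2 + 2 * \<alpha>"
  have p: "1 < p" "p < 3" using \<alpha> by (auto simp: p_def)
  obtain C where C: "bdd_int C (\<lambda>y. indicator halfplane y * tent2 5 y)" 
    using lipschitz_compact_support_bdd_int[OF tent2_lipschitz tent2_bounds(2) tent2_eq_0] by blast
  note bi = bdd_int_odd_ext[OF C]
  have m: "odd_ext (tent2 5) \<in> borel_measurable borel" using bi by (simp add: bdd_int_def)
  define F where "F y = - (odd_ext (tent2 5) y * ker p (0, 1) ((0, 2) - y))" for y
  have iF: "integrable lborel F"
    unfolding F_def[abs_def] using conv_commute_integrable[OF conv_integrable_ker[OF bi norm_e2 p]] by simp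
  have conv: "conv (ker p (0, 1)) (odd_ext (tent2 5)) (0, 2) = - (LINT y|lborel. F y)"
    unfolding conv_commute[OF m ker_measurable] F_def by simp
  have ker: "ker p (0, 1) ((0, 2) - y) = (2 - snd y) * norm ((0, 2) - y) powr - p" for y
    by (simp add: ker_def inner_prod_def)
  have F0: "F y \<ge> 0" for y
  proof -
    consider "snd y < 0" | "0 \<le> snd y" "snd y \<le> 4" | "snd y > 4" by linarith
    then show ?thesis
    proof cases
      case 1
      then show ?thesis using tent2_bounds(1)[of 5 "reflect y"] by (simp add: F_def odd_ext_def ker)
    next
      case 2
      then have "tent2 5 y = 0" by (simp add: tent2_def tent_eq_0)
      then show ?thesis using 2 by (simp add: F_def odd_ext_def)
    next
      case 3
      then have "tent2 5 y * ((snd y - 2) * norm ((0, 2) - y) powr - p) \<ge> 0"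
        using tent2_bounds(1)[of 5 y] by (intro mult_nonneg_nonneg) auto
      then show ?thesis using 3 by (simp add: F_def odd_ext_def ker algebra_simps)
    qed
  qed
  \<comment> \<open>On this box the tent is at least 1/4, the height above 2 is at least 2, and the
    distance to \<open>(0, 2)\<close> is at most 4.\<close>
  let ?B = "cbox (-1/2, 9/2) (1/2, 11/2) :: (real \<times> real) set"
  have "0 < (LINT y|lborel. (1/4 * 2 * 4 powr - p) * indicator ?B y)"
    by (simp add: content_Pair)
  also have "\<dots> \<le> (LINT y|lborel. F y)"
  proof (rule integral_mono)
    show "integrable lborel (\<lambda>y. (1/4 * 2 * 4 powr - p) * indicator ?B y)"
      by (intro integrable_mult_right integrable_real_indicator[OF _ emeasure_lborel_cbox_finite]) auto
    fix y :: "real \<times> real"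
    show "(1/4 * 2 * 4 powr - p) * indicator ?B y \<le> F y"
    proof (cases "y \<in> ?B")
      case True
      then have "fst y \<in> {-1/2..1/2}" "snd y \<in> {9/2..11/2}"
        by (auto simp: cbox_Pair_eq mem_Times_iff)
      then have y: "\<bar>fst y\<bar> \<le> 1/2" "\<bar>snd y - 5\<bar> \<le> 1/2"
        unfolding atLeastAtMost_iff by linarith+
      have y': "snd y \<ge> 4" using y(2) by linarith
      have t: "tent2 5 y \<ge> 1/2 * (1/2)" unfolding tent2_def
        using y by (intro mult_mono) (auto simp: tent_def)
      have "norm ((0, 2) - y) \<le> \<bar>fst y\<bar> + \<bar>snd y - 2\<bar>"
        using norm_Pair_le[of "- fst y" "2 - snd y"] by (simp add: minus_prod_def abs_minus_commute)
      also have "\<dots> \<le> 4" using y by linarith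
      finally have n: "norm ((0, 2) - y) \<le> 4" .
      have "(0, 2) - y \<noteq> 0" using y' by (auto simp: prod_eq_iff)
      then have "4 powr - p \<le> norm ((0, 2) - y) powr - p" using n p by (intro powr_mono2') auto
      then have "2 * 4 powr - p \<le> (snd y - 2) * norm ((0, 2) - y) powr - p"
        using y' by (intro mult_mono) auto
      from t this have "1/2 * (1/2) * (2 * 4 powr - p) \<le> tent2 5 y * ((snd y - 2) * norm ((0, 2) - y) powr - p)"
        by (rule mult_mono) (auto simp: tent2_bounds)
      also have "\<dots> = F y" using y' by (simp add: F_def odd_ext_def ker algebra_simps)
      finally show ?thesis using True by simp
    qed (use F0 in simp)
  qed (rule iF)
  finally show ?thesis unfolding conv[unfolded p_def] by simp
qed

lemma odd_ext_cong: "(\<And>x. x \<in> halfplane \<Longrightarrow> f x = g x) \<Longrightarrow> odd_ext f = odd_ext g"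
  by (auto simp: fun_eq_iff odd_ext_def halfplane_iff)

text \<open>\<open>tent2 2\<close> has its kink at \<open>(0, 2)\<close>; \<open>tent2 5\<close> vanishes near that point but changes the
  velocity there.\<close>

definition perturbed :: "real \<Rightarrow> real \<times> real \<Rightarrow> real" where
  "perturbed c x = tent2 2 x + c * tent2 5 x"

lemma perturbed_facts:
  assumes "c \<ge> 0"
  shows "(2 + c * 2)-lipschitz_on UNIV (perturbed c)" "AE x in lborel. \<exists>D. (perturbed c has_derivative D) (at x)"
    "\<bar>perturbed c x\<bar> \<le> 1 + c" "x \<notin> cbox (-1, 1) (1, 6) \<Longrightarrow> perturbed c x = 0"
proof -
  have l: "(c * 2)-lipschitz_on UNIV (\<lambda>x. c * tent2 5 x)"
    using lipschitz_on_cmult_real[OF tent2_lipschitz, of c] assms by simp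
  show "(2 + c * 2)-lipschitz_on UNIV (perturbed c)"
    unfolding perturbed_def[abs_def] by (rule lipschitz_on_add[OF tent2_lipschitz l])
  show "AE x in lborel. \<exists>D. (perturbed c has_derivative D) (at x)"
    using tent2_AE_differentiable[of 2] tent2_AE_differentiable[of 5]
  proof eventually_elim
    case (elim x)
    then obtain D1 D2 where "(tent2 2 has_derivative D1) (at x)" "(tent2 5 has_derivative D2) (at x)" by blast
    from has_derivative_add[OF this(1) has_derivative_mult_right[OF this(2), of c]]
    show ?case unfolding perturbed_def[abs_def] by blast
  qed
  have "c * \<bar>tent2 5 x\<bar> \<le> c * 1" using assms tent2_bounds(2) by (rule mult_left_mono[rotated])
  then show "\<bar>perturbed c x\<bar> \<le> 1 + c"
    using tent2_bounds[of 2 x] tent2_bounds[of 5 x] assms by (simp add: perturbed_def)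
  assume x: "x \<notin> cbox (-1, 1) (1, 6)"
  then have "x \<notin> cbox (-1, 2 - 1) (1, 2 + 1)" "x \<notin> cbox (-1, 5 - 1) (1, 5 + 1)"
    by (auto simp: cbox_Pair_eq mem_Times_iff)
  from this[THEN tent2_eq_0] show "perturbed c x = 0" by (simp add: perturbed_def)
qed

text \<open>The initial velocity is linear in the datum, so its horizontal component is affine in
  \<open>c\<close>. Only that component is recorded, because the separation of the two solutions is
  measured horizontally.\<close>

lemma solution_frozen:
  assumes \<alpha>: "0 < \<alpha>" "\<alpha> < 1/2" and \<beta>: "\<beta> \<ge> 0" and T: "T > 0" and c: "c \<ge> 0"
    and sol: "\<theta> \<in> LinfX_space T \<beta>" "classical_solution \<alpha> T \<theta>" and init: "has_initial_data \<theta> (perturbed c)" and \<epsilon>: "\<epsilon> > 0"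
  shows "\<exists>\<delta>>0. \<exists>u. fst u = conv (ker (2 + 2 * \<alpha>) (0, 1)) (odd_ext (tent2 2)) (0, 2) + c * conv (ker (2 + 2 * \<alpha>) (0, 1)) (odd_ext (tent2 5)) (0, 2)
    \<and> (\<forall>t x. 0 < t \<longrightarrow> t < \<delta> \<longrightarrow> dist x (0, 2) < \<delta> \<longrightarrow> \<bar>\<theta> t x - perturbed c (x - t *\<^sub>R u)\<bar> \<le> \<epsilon> * t)"
proof -
  note pf = perturbed_facts[OF c]
  note contp = continuous_on_subset[OF lipschitz_on_continuous_on[OF pf(1)] subset_UNIV]
  have th0: "\<theta> 0 x = perturbed c x" if "x \<in> halfplane" for x
    by (rule initial_data_eq[OF sol(2) T init contp that])
  have oe: "odd_ext (\<theta> 0) = odd_ext (perturbed c)" by (rule odd_ext_cong) (rule th0)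
  obtain C1 where C1: "C1 > 0" "AE t in lborel. t \<in> {0..T} \<longrightarrow> slice_bound C1 \<beta> (\<theta> t)"
    using LinfX_space_slice_bound[OF sol \<beta>] by blast
  obtain C2 where C2: "C2 > 0" "bdd_int C2 (\<lambda>y. indicator halfplane y * perturbed c y)"
    using lipschitz_compact_support_bdd_int[OF pf(1,3,4)] by blast
  have eq: "(\<lambda>y. indicator halfplane y * perturbed c y) = (\<lambda>y. indicator halfplane y * \<theta> 0 y)"
    by (auto simp: fun_eq_iff indicator_def th0)
  define C where "C = max C1 C2"
  have C: "C > 0" using C1 by (simp add: C_def)
  have sb: "AE t in lborel. t \<in> {0..T} \<longrightarrow> slice_bound C \<beta> (\<theta> t)"
    using C1(2) by eventually_elim (auto simp: C_def intro: slice_bound_mono)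
  have bd: "bdd_int C (\<lambda>y. indicator halfplane y * \<theta> 0 y)"
    using C2(2) unfolding eq by (rule bdd_int_mono) (simp add: C_def)
  have x0: "(0, 2) \<in> halfplane" by (simp add: halfplane_iff)
  define u where "u = gsqg_velocity \<alpha> (\<theta> 0) (0, 2)"
  obtain \<delta> where \<delta>: "\<delta> > 0" "\<And>t x. 0 < t \<Longrightarrow> t < \<delta> \<Longrightarrow> dist x (0, 2) < \<delta> \<Longrightarrow> \<bar>\<theta> t x - \<theta> 0 (x - t *\<^sub>R u)\<bar> \<le> \<epsilon> * t"
    using frozen_coefficients[OF \<alpha> T sol(2) sb C bd x0 \<epsilon>] unfolding u_def by blast
  have u: "u = gsqg_velocity \<alpha> (perturbed c) (0, 2)"
    unfolding u_def gsqg_velocity_eq[OF bd \<alpha>] gsqg_velocity_eq[OF C2(2) \<alpha>] oe ..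
  have p: "1 < 2 + 2 * \<alpha>" "2 + 2 * \<alpha> < 3" using \<alpha> by auto
  obtain D2 D5 where D: "bdd_int D2 (odd_ext (tent2 2))" "bdd_int D5 (odd_ext (tent2 5))"
    using lipschitz_compact_support_bdd_int[OF tent2_lipschitz tent2_bounds(2) tent2_eq_0] bdd_int_odd_ext by metis
  have oe2: "odd_ext (perturbed c) y = odd_ext (tent2 2) y + c * odd_ext (tent2 5) y" for y
    by (simp add: odd_ext_def perturbed_def)
  have "fst u = conv (ker (2 + 2 * \<alpha>) (0, 1)) (odd_ext (perturbed c)) (0, 2)"
    unfolding u gsqg_velocity_eq[OF C2(2) \<alpha>] by simp
  also have "\<dots> = conv (ker (2 + 2 * \<alpha>) (0, 1)) (odd_ext (tent2 2)) (0, 2) + c * conv (ker (2 + 2 * \<alpha>) (0, 1)) (odd_ext (tent2 5)) (0, 2)"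
    unfolding conv_def oe2 distrib_right mult.assoc
    using conv_integrable_ker[OF D(1) norm_e2 p] conv_integrable_ker[OF D(2) norm_e2 p] by simp
  finally have fu: "fst u = \<dots>" .
  \<comment> \<open>Keeps \<open>x - t *\<^sub>R u\<close> within distance 1 of
    \<open>(0, 2)\<close>, hence in the half-plane, where \<open>\<theta> 0\<close> is the
    datum.\<close>
  define \<delta>' where "\<delta>' = min \<delta> (1 / (1 + norm u))"
  have \<delta>': "\<delta>' > 0" using \<delta>(1) by (simp add: \<delta>'_def add_pos_nonneg)
  show ?thesis
  proof (intro exI[of _ \<delta>'] exI[of _ u] conjI \<delta>' fu allI impI)
    fix t :: real and x :: "real \<times> real" assume t: "0 < t" "t < \<delta>'" and x: "dist x (0, 2) < \<delta>'"
    have "\<delta>' \<le> 1 / (1 + norm u)" by (simp add: \<delta>'_def)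
    then have "\<delta>' * (1 + norm u) \<le> 1" by (simp add: pos_le_divide_eq add_pos_nonneg)
    moreover have "t * norm u \<le> \<delta>' * norm u" using t by (intro mult_right_mono) auto
    ultimately have "dist x (0, 2) + t * norm u < 1" using x by (simp add: algebra_simps)
    moreover have "\<bar>snd (x - t *\<^sub>R u) - 2\<bar> \<le> dist (x - t *\<^sub>R u) (0, 2)"
      using dist_snd_le[of "x - t *\<^sub>R u" "(0, 2)"] by (simp add: dist_real_def)
    moreover have "dist (x - t *\<^sub>R u) (0, 2) \<le> dist (x - t *\<^sub>R u) x + dist x (0, 2)" by (rule dist_triangle)
    moreover have "dist (x - t *\<^sub>R u) x = t * norm u" using t by (simp add: dist_norm)
    ultimately have "x - t *\<^sub>R u \<in> halfplane" unfolding halfplane_iff by linarith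
    then show "\<bar>\<theta> t x - perturbed c (x - t *\<^sub>R u)\<bar> \<le> \<epsilon> * t"
      using \<delta>(2)[of t x] t x th0 by (simp add: \<delta>'_def)
  qed
qed

lemma exists_small_time:
  fixes T \<delta> :: real
  assumes "T > 0" "\<delta> > 0" and P: "AE t in lborel. t \<in> {0..T} \<longrightarrow> P t"
  shows "\<exists>t. 0 < t \<and> t < \<delta> \<and> t \<le> T \<and> P t"
proof (rule ccontr)
  assume *: "\<not> ?thesis"
  define m where "m = min T \<delta>"
  have m: "m > 0" using assms(1,2) by (simp add: m_def)
  have "AE t in lborel. t \<notin> {0<..<m}"
    using P by eventually_elim (use * in \<open>auto simp: m_def\<close>)
  then have "emeasure lborel {0<..<m} = 0"
    by (subst (asm) AE_iff_measurable[of "{0<..<m}"]) auto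
  then show False using m by simp
qed

lemma not_continuous_dependence:
  assumes \<alpha>: "0 < \<alpha>" "\<alpha> < 1/2" and \<beta>: "\<beta> \<ge> 0" and T: "T > 0"
    and sol: "\<theta> \<in> LinfX_space T \<beta>" "classical_solution \<alpha> T \<theta>" "has_initial_data \<theta> (perturbed 0)"
    and c: "c > 0" and sol': "\<theta>' \<in> LinfX_space T \<beta>" "classical_solution \<alpha> T \<theta>'" "has_initial_data \<theta>' (perturbed c)"
  shows "\<not> LinfX_norm T \<beta> (\<lambda>t x. \<theta>' t x - \<theta> t x) < ennreal (1/4)"
proof
  assume less: "LinfX_norm T \<beta> (\<lambda>t x. \<theta>' t x - \<theta> t x) < ennreal (1/4)"
  define w where "w = - conv (ker (2 + 2 * \<alpha>) (0, 1)) (odd_ext (tent2 5)) (0, 2)"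
  have w: "w > 0" using velocity_tent2_neg[OF \<alpha>] by (simp add: w_def)
  define d where "d = c * w"
  have d: "d > 0" using c w by (simp add: d_def)
  \<comment> \<open>Four evaluations will each cost \<open>t * d / 8\<close>, half of the main term
    \<open>t * d\<close>.\<close>
  have \<epsilon>: "d / 8 > 0" using d by simp
  from solution_frozen[OF \<alpha> \<beta> T order_refl sol \<epsilon>]
  obtain \<delta>1 u where \<delta>1: "\<delta>1 > 0" and 1:
    "fst u = conv (ker (2 + 2 * \<alpha>) (0, 1)) (odd_ext (tent2 2)) (0, 2) + 0 * conv (ker (2 + 2 * \<alpha>) (0, 1)) (odd_ext (tent2 5)) (0, 2)
    \<and> (\<forall>t x. 0 < t \<longrightarrow> t < \<delta>1 \<longrightarrow> dist x (0, 2) < \<delta>1 \<longrightarrow> \<bar>\<theta> t x - perturbed 0 (x - t *\<^sub>R u)\<bar> \<le> d / 8 * t)"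
    by (elim exE conjE) iprover
  from solution_frozen[OF \<alpha> \<beta> T less_imp_le[OF c] sol' \<epsilon>]
  obtain \<delta>2 v where \<delta>2: "\<delta>2 > 0" and 2:
    "fst v = conv (ker (2 + 2 * \<alpha>) (0, 1)) (odd_ext (tent2 2)) (0, 2) + c * conv (ker (2 + 2 * \<alpha>) (0, 1)) (odd_ext (tent2 5)) (0, 2)
    \<and> (\<forall>t x. 0 < t \<longrightarrow> t < \<delta>2 \<longrightarrow> dist x (0, 2) < \<delta>2 \<longrightarrow> \<bar>\<theta>' t x - perturbed c (x - t *\<^sub>R v)\<bar> \<le> d / 8 * t)"
    by (elim exE conjE) iprover
  have uv: "fst u - fst v = d" using conjunct1[OF 1] conjunct1[OF 2] by (simp add: d_def w_def)
  have sb: "AE t in lborel. t \<in> {0..T} \<longrightarrow> slice_bound (1/4) \<beta> (\<lambda>x. \<theta>' t x - \<theta> t x)"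
    by (rule LinfX_norm_less_imp_slice_bound[OF _ less \<beta>])
       (intro continuous_intros classical_solution_continuous(2)[OF sol(2)] classical_solution_continuous(2)[OF sol'(2)])
  define M where "M = 1 + \<bar>fst u\<bar> + \<bar>fst v\<bar> + \<bar>snd u\<bar> + \<bar>snd v\<bar> + d"
  have M: "M > 0" using d by (simp add: M_def)
  \<comment> \<open>Scaled by \<open>M\<close> so that every displacement t u, t v and t d stays
    below both admissible radii and 1/2.\<close>
  define \<delta> where "\<delta> = min (min \<delta>1 \<delta>2) (1/2) / (2 * M)"
  have \<delta>: "\<delta> > 0" using \<delta>1 \<delta>2 M by (simp add: \<delta>_def)
  have M1: "M \<ge> 1" using d by (simp add: M_def)
  have \<delta>M: "\<delta> * M < \<delta>1" "\<delta> * M < \<delta>2" "\<delta> * M \<le> 1/2" using \<delta>1 \<delta>2 M by (auto simp: \<delta>_def)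
  have \<delta>le: "\<delta> \<le> \<delta> * M" using \<delta> M1 by simp
  obtain t where t: "0 < t" "t < \<delta>" "t \<le> T" "slice_bound (1/4) \<beta> (\<lambda>x. \<theta>' t x - \<theta> t x)"
    using exists_small_time[OF T \<delta> sb] by blast
  have tM: "t * a \<le> \<delta> * M" if "0 \<le> a" "a \<le> M" for a
    using t that \<delta> by (intro mult_mono) auto
  have Mb: "\<bar>fst u\<bar> \<le> M" "\<bar>fst v\<bar> \<le> M" "\<bar>snd u\<bar> \<le> M" "\<bar>snd v\<bar> \<le> M" "d \<le> M"
    unfolding M_def using d by linarith+
  \<comment> \<open>\<open>P\<close> lies on the transported ridge of \<open>\<theta>\<close>, and
    \<open>Q\<close> below on that of \<open>\<theta>'\<close>; the vertical displacement only
    multiplies the profile by a factor of at least 1/2.\<close>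
  define P where "P = (t * fst u, 2 :: real)"
  define Q where "Q = (t * fst v, 2 :: real)"
  have dP: "dist P (0, 2) = t * \<bar>fst u\<bar>" and dQ: "dist Q (0, 2) = t * \<bar>fst v\<bar>"
    using t by (simp_all add: P_def Q_def dist_Pair_Pair dist_real_def abs_mult)
  have small: "dist P (0, 2) < \<delta>1" "dist P (0, 2) < \<delta>2" "dist Q (0, 2) < \<delta>1" "dist Q (0, 2) < \<delta>2"
    unfolding dP dQ using tM[OF abs_ge_zero Mb(1)] tM[OF abs_ge_zero Mb(2)] \<delta>M by linarith+
  have t\<delta>: "t < \<delta>1" "t < \<delta>2" using t(2) \<delta>le \<delta>M by linarith+
  define bu where "bu = tent (- t * snd u)"
  define bv where "bv = tent (- t * snd v)"
  have tu: "t * \<bar>snd u\<bar> \<le> 1/2" "t * \<bar>snd v\<bar> \<le> 1/2" "t * d \<le> 1/2"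
    using tM[OF abs_ge_zero Mb(3)] tM[OF abs_ge_zero Mb(4)] tM[OF less_imp_le[OF d] Mb(5)] \<delta>M by linarith+
  have b: "bu \<ge> 1/2" "bv \<ge> 1/2" using tu t by (auto simp: bu_def bv_def tent_def abs_mult)
  \<comment> \<open>Near height 2 the upper tent vanishes: it enters the equation only through the
    velocity.\<close>
  have pert: "perturbed c' (s, 2 - r) = tent s * tent (- r)" if "\<bar>r\<bar> \<le> 1/2" for c' s r
  proof -
    have "tent (- 3 - r) = 0" using that by (intro tent_eq_0) linarith
    then show ?thesis by (simp add: perturbed_def tent2_def)
  qed
  have ru: "\<bar>t * snd u\<bar> \<le> 1/2" "\<bar>t * snd v\<bar> \<le> 1/2" using tu t by (auto simp: abs_mult)
  have uvt: "t * fst u - t * fst v = t * d" unfolding uv[symmetric] by (simp add: algebra_simps)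
  have tent: "tent (t * d) = 1 - t * d" "tent (- (t * d)) = 1 - t * d"
    using tu(3) t d by (simp_all add: tent_def)
  have e1: "perturbed 0 (P - t *\<^sub>R u) = bu"
    using pert[OF ru(1), of 0 0] by (simp add: P_def bu_def minus_prod_def tent_def)
  have e2: "perturbed 0 (Q - t *\<^sub>R u) = (1 - t * d) * bu"
  proof -
    have Q': "Q - t *\<^sub>R u = (- (t * d), 2 - t * snd u)" using uvt by (simp add: Q_def prod_eq_iff)
    show ?thesis unfolding Q' using pert[OF ru(1), of 0 "- (t * d)"] by (simp add: tent(2) bu_def)
  qed
  have e3: "perturbed c (P - t *\<^sub>R v) = (1 - t * d) * bv"
    using pert[OF ru(2), of c "t * fst u - t * fst v"] uvt tent(1) by (simp add: P_def bv_def minus_prod_def)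
  have e4: "perturbed c (Q - t *\<^sub>R v) = bv"
    using pert[OF ru(2), of c 0] by (simp add: Q_def bv_def minus_prod_def tent_def)
  define m1 where "m1 = (1 - t * d) * bv"
  define m2 where "m2 = (1 - t * d) * bu"
  define e where "e = t * d"
  have de: "d / 8 * t = e / 8" by (simp add: e_def)
  have "\<bar>\<theta> t P - bu\<bar> \<le> e / 8" "\<bar>\<theta> t Q - m2\<bar> \<le> e / 8" "\<bar>\<theta>' t P - m1\<bar> \<le> e / 8" "\<bar>\<theta>' t Q - bv\<bar> \<le> e / 8"
    using conjunct2[OF 1, rule_format, OF t(1) t\<delta>(1) small(1)] conjunct2[OF 1, rule_format, OF t(1) t\<delta>(1) small(3)]
      conjunct2[OF 2, rule_format, OF t(1) t\<delta>(2) small(2)] conjunct2[OF 2, rule_format, OF t(1) t\<delta>(2) small(4)]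
    unfolding e1 e2 e3 e4 de m1_def m2_def by this+
  \<comment> \<open>The drop of one profile and the rise of the other add up, and
    \<open>bu + bv \<ge> 1\<close>.\<close>
  moreover have "(bv - m1) + (bu - m2) = e * (bu + bv)" by (simp add: m1_def m2_def e_def algebra_simps)
  moreover have "e * (bu + bv) \<ge> e * 1" using b t d by (intro mult_left_mono) (auto simp: e_def)
  ultimately have big: "(\<theta>' t Q - \<theta> t Q) - (\<theta>' t P - \<theta> t P) \<ge> t * d / 2"
    unfolding abs_le_iff e_def[symmetric] by linarith
  have "P + (t * fst v - t * fst u, 0) = Q" by (simp add: P_def Q_def)
  moreover have "P \<in> halfplane" by (simp add: P_def halfplane_iff)
  ultimately have "\<bar>(\<theta>' t Q - \<theta> t Q) - (\<theta>' t P - \<theta> t P)\<bar> \<le> 1/4 * \<bar>t * fst v - t * fst u\<bar>"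
    using t(4) unfolding slice_bound_def by metis
  also have "\<bar>t * fst v - t * fst u\<bar> = t * d" using uvt t d by (simp add: abs_minus_commute[of "t * fst v"])
  finally have "t * d / 2 \<le> 1/4 * (t * d)" using big by linarith
  then show False using t d by simp
qed

lemma ill_posed_b:
  assumes \<alpha>: "0 < \<alpha>" "\<alpha> < 1/2" and \<beta>: "\<beta> \<ge> 0"
  shows "\<exists>\<theta>0\<in>X_space \<beta>. \<exists>\<theta>0n :: nat \<Rightarrow> real \<times> real \<Rightarrow> real.
      (\<forall>n\<ge>1. \<theta>0n n \<in> X_space \<beta>)
    \<and> (\<lambda>n. X_norm \<beta> (\<lambda>x. \<theta>0n n x - \<theta>0 x)) \<longlonglongrightarrow> 0
    \<and> \<not> (\<exists>T>0. \<exists>\<theta>\<in>LinfX_space T \<beta>. \<exists>\<theta>n :: nat \<Rightarrow> real \<Rightarrow> real \<times> real \<Rightarrow> real.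
          classical_solution \<alpha> T \<theta> \<and> has_initial_data \<theta> \<theta>0
        \<and> (\<forall>n\<ge>1. \<theta>n n \<in> LinfX_space T \<beta> \<and> classical_solution \<alpha> T (\<theta>n n)
                \<and> has_initial_data (\<theta>n n) (\<theta>0n n))
        \<and> (\<lambda>n. LinfX_norm T \<beta> (\<lambda>t x. \<theta>n n t x - \<theta> t x)) \<longlonglongrightarrow> 0)"
proof (intro bexI[of _ "perturbed 0"] exI[of _ "\<lambda>n. perturbed (1 / real n)"] conjI allI impI)
  have X: "perturbed c \<in> X_space \<beta>" if "c \<ge> 0" for c
    by (rule lipschitz_compact_support_X_space(1)[OF perturbed_facts[OF that]])
  show "perturbed 0 \<in> X_space \<beta>" by (rule X) simp
  show "perturbed (1 / real n) \<in> X_space \<beta>" for n by (rule X) simp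
  \<comment> \<open>The perturbation is \<open>c * tent2 5\<close> with sup norm at most
    \<open>c\<close> and Lipschitz constant \<open>2 * c\<close> counted twice, which gives 5, plus
    the L^1 bound by the area of the support. At \<open>n = 0\<close> the coefficient 1/n is
    0.\<close>
  define M where "M = 5 + measure lborel (cbox (-1, 5 - 1) (1, 5 + 1) :: (real \<times> real) set)"
  have bound: "X_norm \<beta> (\<lambda>x. perturbed (1 / real n) x - perturbed 0 x) \<le> ennreal (1 / real n * M)" for n
  proof -
    define c where "c = 1 / real n"
    have c: "c \<ge> 0" by (simp add: c_def)
    have l: "(c * 2)-lipschitz_on UNIV (\<lambda>x. c * tent2 5 x)"
      using lipschitz_on_cmult_real[OF tent2_lipschitz, of c] c by simp
    have d: "AE x in lborel. \<exists>D. ((\<lambda>x. c * tent2 5 x) has_derivative D) (at x)"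
      using tent2_AE_differentiable[of 5] by eventually_elim (blast intro: has_derivative_mult_right)
    have b: "\<bar>c * tent2 5 x\<bar> \<le> c" for x
      using mult_left_mono[OF tent2_bounds(2)[of 5 x] c] c by (simp add: abs_mult)
    have k: "c * tent2 5 x = 0" if "x \<notin> cbox (-1, 5 - 1) (1, 5 + 1)" for x
      using tent2_eq_0[OF that] by simp
    have "(\<lambda>x. perturbed (1 / real n) x - perturbed 0 x) = (\<lambda>x. c * tent2 5 x)"
      by (simp add: perturbed_def c_def)
    moreover have "c + (c * 2 + c * 2) + c * measure lborel (cbox (-1, 5 - 1) (1, 5 + 1) :: (real \<times> real) set) = 1 / real n * M"
      unfolding M_def c_def[symmetric] by (simp add: algebra_simps)
    ultimately show ?thesis
      using lipschitz_compact_support_X_space(2)[OF l d b k, where \<beta>=\<beta> and a="(-1, 5 - 1)" and b="(1, 5 + 1)"] by simp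
  qed
  have "(\<lambda>n. 1 / real n * M) \<longlonglongrightarrow> 0 * M" by (intro tendsto_mult tendsto_const lim_1_over_n)
  then have lim: "(\<lambda>n. ennreal (1 / real n * M)) \<longlonglongrightarrow> 0"
    using tendsto_ennrealI[of "\<lambda>n. 1 / real n * M" 0 sequentially] by simp
  show "(\<lambda>n. X_norm \<beta> (\<lambda>x. perturbed (1 / real n) x - perturbed 0 x)) \<longlonglongrightarrow> 0"
    by (rule tendsto_sandwich[OF _ always_eventually[OF allI[OF bound]] tendsto_const lim]) simp
  show "\<not> (\<exists>T>0. \<exists>\<theta>\<in>LinfX_space T \<beta>. \<exists>\<theta>n :: nat \<Rightarrow> real \<Rightarrow> real \<times> real \<Rightarrow> real.
          classical_solution \<alpha> T \<theta> \<and> has_initial_data \<theta> (perturbed 0)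
        \<and> (\<forall>n\<ge>1. \<theta>n n \<in> LinfX_space T \<beta> \<and> classical_solution \<alpha> T (\<theta>n n)
                \<and> has_initial_data (\<theta>n n) (perturbed (1 / real n)))
        \<and> (\<lambda>n. LinfX_norm T \<beta> (\<lambda>t x. \<theta>n n t x - \<theta> t x)) \<longlonglongrightarrow> 0)"
  proof (intro notI, elim exE bexE conjE)
    fix T \<theta> and \<theta>n :: "nat \<Rightarrow> real \<Rightarrow> real \<times> real \<Rightarrow> real"
    assume T: "T > 0" and sol: "\<theta> \<in> LinfX_space T \<beta>" "classical_solution \<alpha> T \<theta>" "has_initial_data \<theta> (perturbed 0)"
      and n: "\<forall>n\<ge>1. \<theta>n n \<in> LinfX_space T \<beta> \<and> classical_solution \<alpha> T (\<theta>n n) \<and> has_initial_data (\<theta>n n) (perturbed (1 / real n))"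
      and lim: "(\<lambda>n. LinfX_norm T \<beta> (\<lambda>t x. \<theta>n n t x - \<theta> t x)) \<longlonglongrightarrow> 0"
    have "eventually (\<lambda>n. LinfX_norm T \<beta> (\<lambda>t x. \<theta>n n t x - \<theta> t x) < ennreal (1/4)) sequentially"
      using lim by (rule order_tendstoD) simp
    then have "eventually (\<lambda>n. LinfX_norm T \<beta> (\<lambda>t x. \<theta>n n t x - \<theta> t x) < ennreal (1/4) \<and> n \<ge> 1) sequentially"
      using eventually_ge_at_top[of 1] by eventually_elim auto
    then obtain n where n': "LinfX_norm T \<beta> (\<lambda>t x. \<theta>n n t x - \<theta> t x) < ennreal (1/4)" "n \<ge> 1"
      by (auto simp: eventually_sequentially)
    have "1 / real n > 0" using n'(2) by simp
    from not_continuous_dependence[OF \<alpha> \<beta> T sol this] n n' show False by blast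
  qed
qed

section \<open>Hoelder bounds up to the boundary\<close>

text \<open>On one dyadic block the derivative bound is at most 2 C a^(-\<beta>) and the length at
  most a.\<close>

lemma slice_bound_hoelder_local:
  assumes sb: "slice_bound C \<beta> f" and C: "C > 0" and \<beta>: "0 \<le> \<beta>" "\<beta> < 1"
    and s: "0 < a" "a \<le> b" "b \<le> 2 * a" "b \<le> 1"
  shows "\<bar>f (x, b) - f (x, a)\<bar> \<le> 2 * C * a powr (1 - \<beta>)"
proof -
  have H: "(x, a) \<in> halfplane" using s by (simp add: halfplane_iff)
  have "\<bar>f ((x, a) + (0, b - a)) - f (x, a)\<bar> \<le> C * max 1 ((snd (x, a) / 2) powr - \<beta>) * (b - a)"
    using sb H s unfolding slice_bound_def by (metis diff_ge_0_iff_ge)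
  then have "\<bar>f (x, b) - f (x, a)\<bar> \<le> C * max 1 ((a / 2) powr - \<beta>) * (b - a)" by simp
  also have "max 1 ((a / 2) powr - \<beta>) = (a / 2) powr - \<beta>"
    using s \<beta> powr_mono2'[of "- \<beta>" "a / 2" 1] by (simp add: max_def)
  also have "(a / 2) powr - \<beta> = 2 powr \<beta> * a powr - \<beta>"
    using s by (simp add: powr_divide powr_minus divide_simps)
  also have "C * (2 powr \<beta> * a powr - \<beta>) * (b - a) \<le> C * (2 * a powr - \<beta>) * a"
    using s C \<beta> powr_mono[of \<beta> 1 "2::real"] by (intro mult_mono) auto
  also have "\<dots> = 2 * C * a powr (1 - \<beta>)"
    using s by (simp add: powr_diff powr_minus divide_inverse)
  finally show ?thesis .
qed

text \<open>The sum of the geometric series of dyadic block bounds with ratio 2^(-(1-\<beta>)),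
  finite because \<beta> < 1.\<close>

definition hoelder_const :: "real \<Rightarrow> real \<Rightarrow> real" where
  "hoelder_const C \<beta> = 2 * C / (1 - 2 powr - (1 - \<beta>))"

lemma hoelder_const:
  assumes "C > 0" "\<beta> < 1"
  shows "hoelder_const C \<beta> \<ge> 2 * C" "hoelder_const C \<beta> * (1 - 2 powr - (1 - \<beta>)) = 2 * C"
proof -
  have q: "2 powr - (1 - \<beta>) < (1 :: real)" using powr_less_mono[of "- (1 - \<beta>)" 0 "2 :: real"] assms by simp
  then show "hoelder_const C \<beta> * (1 - 2 powr - (1 - \<beta>)) = 2 * C" using assms(2) by (simp add: hoelder_const_def)
  show "hoelder_const C \<beta> \<ge> 2 * C"
    unfolding hoelder_const_def using q assms by (simp add: pos_le_divide_eq algebra_simps)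
qed

text \<open>Telescoping over dyadic heights integrates the singular derivative bound down to the
  boundary. The result depends on the larger height only and takes the place of a boundary
  trace.\<close>

lemma slice_bound_hoelder:
  assumes sb: "slice_bound C \<beta> f" and C: "C > 0" and \<beta>: "0 \<le> \<beta>" "\<beta> < 1" and ab: "0 < a" "0 < b"
  shows "\<bar>f (x, a) - f (x, b)\<bar> \<le> hoelder_const C \<beta> * (max a b) powr (1 - \<beta>)"
proof -
  define K where "K = hoelder_const C \<beta>"
  define q where "q = (2 :: real) powr - (1 - \<beta>)"
  note hc = hoelder_const[OF C \<beta>(2), folded K_def q_def]
  have q: "q > 0" by (simp add: q_def)
  have K: "K > 0" using hc(1) C by linarith
  have dyadic: "\<bar>f (x, b) - f (x, a)\<bar> \<le> K * b powr (1 - \<beta>)"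
    if "0 < a" "a \<le> b" "b \<le> 2 ^ n * a" "b \<le> 1" for n a b
    using that
  proof (induction n arbitrary: b)
    case 0
    then show ?case using K by simp
  next
    case (Suc n)
    show ?case
    proof (cases "b \<le> 2 * a")
      case True
      have "\<bar>f (x, b) - f (x, a)\<bar> \<le> 2 * C * a powr (1 - \<beta>)"
        by (rule slice_bound_hoelder_local[OF sb C \<beta> Suc.prems(1,2) True Suc.prems(4)])
      also have "\<dots> \<le> K * b powr (1 - \<beta>)"
        using hc C Suc.prems \<beta> by (intro mult_mono powr_mono2) auto
      finally show ?thesis .
    next
      case False
      have "\<bar>f (x, b/2) - f (x, a)\<bar> \<le> K * (b/2) powr (1 - \<beta>)"
        by (rule Suc.IH) (use False Suc.prems in auto)
      moreover have "\<bar>f (x, b) - f (x, b/2)\<bar> \<le> 2 * C * (b/2) powr (1 - \<beta>)"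
        by (rule slice_bound_hoelder_local[OF sb C \<beta>]) (use Suc.prems in auto)
      moreover have "(b/2) powr (1 - \<beta>) = q * b powr (1 - \<beta>)"
        using Suc.prems unfolding q_def powr_minus_divide by (simp add: powr_divide)
      ultimately have "\<bar>f (x, b) - f (x, a)\<bar> \<le> (K * q + 2 * C * q) * b powr (1 - \<beta>)"
        by (simp add: algebra_simps)
      also have "\<dots> \<le> K * b powr (1 - \<beta>)"
      proof (rule mult_right_mono)
        \<comment> \<open>The relation \<open>K * (1 - q) = 2 * C\<close> makes the surplus in the
          induction step a perfect square times \<open>K\<close>.\<close>
        have "2 * C * q = K * q * (1 - q)" using hc(2) by (simp add: mult_ac)
        then have "K - (K * q + 2 * C * q) = K * (1 - q)\<^sup>2" by (simp add: power2_eq_square algebra_simps)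
        moreover have "K * (1 - q)\<^sup>2 \<ge> 0" using K by simp
        ultimately show "K * q + 2 * C * q \<le> K" by linarith
      qed simp
      finally show ?thesis .
    qed
  qed
  have le1: "\<bar>f (x, b) - f (x, a)\<bar> \<le> K * b powr (1 - \<beta>)" if ab: "0 < a" "a \<le> b" for a b
  proof (cases "b \<le> 1")
    case True
    obtain n where "b / a < 2 ^ n" using real_arch_pow[of 2 "b / a"] by auto
    then have "b \<le> 2 ^ n * a" using ab by (simp add: divide_less_eq)
    then show ?thesis using dyadic ab True by blast
  next
    case False
    \<comment> \<open>Above height 1 the sup bound suffices, as \<open>2 * C \<le> K\<close> and the
      power is at least 1.\<close>
    have "\<bar>f (x, b)\<bar> \<le> C" "\<bar>f (x, a)\<bar> \<le> C"
      using sb ab by (auto simp: slice_bound_def halfplane_iff)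
    then have "\<bar>f (x, b) - f (x, a)\<bar> \<le> K * 1" using hc(1) by linarith
    also have "\<dots> \<le> K * b powr (1 - \<beta>)" using K False \<beta> by (intro mult_left_mono ge_one_powr_ge_zero) auto
    finally show ?thesis .
  qed
  show ?thesis
    using le1[of a b] le1[of b a] ab unfolding K_def[symmetric]
    by (cases "a \<le> b") (auto simp: max_def abs_minus_commute)
qed

lemma odd_ext_lipschitz_1:
  assumes sb: "slice_bound C \<beta> f" and C: "C > 0"
  shows "\<bar>odd_ext f (y + (k, 0)) - odd_ext f y\<bar> \<le> 2 * C * \<bar>k\<bar>"
proof -
  have *: "\<bar>f (z + (k, 0)) - f z\<bar> \<le> 2 * C * \<bar>k\<bar>" if "snd z > 0" for z
  proof -
    have "\<bar>f (z + (k, 0)) - f z\<bar> \<le> C * \<bar>k\<bar>" using sb that by (simp add: slice_bound_def halfplane_iff)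
    also have "\<dots> \<le> 2 * C * \<bar>k\<bar>" using C by (intro mult_right_mono) auto
    finally show ?thesis .
  qed
  consider "snd y > 0" | "snd y < 0" | "snd y = 0" by linarith
  then show ?thesis
  proof cases
    case 1
    then show ?thesis using *[of y] by (simp add: odd_ext_def)
  next
    case 2
    have "reflect (y + (k, 0)) = reflect y + (k, 0)" by (simp add: prod_eq_iff)
    then show ?thesis using 2 *[of "reflect y"] by (simp add: odd_ext_def abs_minus_commute)
  next
    case 3
    then show ?thesis using C by (simp add: odd_ext_def)
  qed
qed

section \<open>The velocity of a single time slice\<close>

definition trace_const :: "real \<Rightarrow> real" where
  "trace_const p = (LINT z|lborel. sgn (snd z) * qker p z)"

text \<open>The sum of the constants in \<open>conv_ker_vertical_bound\<close> and
  \<open>conv_ker_lipschitz_1\<close>, so that one number serves for the vertical velocity and for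
  the boundary velocity.\<close>

definition vel_const :: "real \<Rightarrow> real \<Rightarrow> real" where
  "vel_const p C = (2 * C * p * (LINT z::real\<times>real|lborel. norm z powr (1 - p) * indicator (cball 0 1) z) + (1 + p) * C)
     + (C * (LINT z|lborel. \<bar>near p (0, 1) z\<bar>) + (1 + p) * C)"

lemma vel_const_bounds:
  assumes "C \<ge> 0" "p \<ge> 0"
  shows "2 * C * p * (LINT z::real\<times>real|lborel. norm z powr (1 - p) * indicator (cball 0 1) z) + (1 + p) * C \<le> vel_const p C"
    "C * (LINT z|lborel. \<bar>near p (0, 1) z\<bar>) + (1 + p) * C \<le> vel_const p C" "vel_const p C \<ge> 0"
  using assms unfolding vel_const_def by (auto intro!: add_nonneg_nonneg mult_nonneg_nonneg Bochner_Integration.integral_nonneg)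

text \<open>What part (a) uses of the velocity: the boundary velocity is Lipschitz in x_1, the
  vertical component is O(h), and the horizontal shear has leading coefficient
  \<open>trace_const p\<close> times the value at height \<open>h\<close>.\<close>

lemma slice_velocity:
  assumes \<alpha>: "0 < \<alpha>" "\<alpha> < 1/2" and sb: "slice_bound C \<beta> f" and C: "C > 0" and cont: "continuous_on halfplane f"
    and \<beta>: "0 \<le> \<beta>" "\<beta> < 1"
  defines "p \<equiv> 2 + 2 * \<alpha>" and "U \<equiv> \<lambda>a. conv (ker (2 + 2 * \<alpha>) (0, 1)) (odd_ext f) (a, 0)"
    and "K \<equiv> max (hoelder_const C \<beta>) C"
  shows "\<bar>U (a + k) - U a\<bar> \<le> vel_const p (2 * C) * \<bar>k\<bar>"
    and "h > 0 \<Longrightarrow> \<bar>snd (gsqg_velocity \<alpha> f (a, h))\<bar> \<le> vel_const p (2 * C) * h"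
    and "h > 0 \<Longrightarrow> \<bar>fst (gsqg_velocity \<alpha> f (a, h)) - U a - trace_const p * h powr (1 - 2 * \<alpha>) * f (a, h)\<bar> \<le>
       h powr (1 - 2 * \<alpha>) * (LINT z|lborel. layer_err (2 * C) K (1 - \<beta>) p h z)"
proof -
  have p: "1 < p" "2 < p" "p < 3" using \<alpha> by (auto simp: p_def)
  have bi: "bdd_int C (\<lambda>y. indicator halfplane y * f y)" by (rule slice_bound_bdd_int[OF sb cont C])
  note bo = bdd_int_odd_ext[OF bi]
  have lip: "\<bar>odd_ext f (y + (k, 0)) - odd_ext f y\<bar> \<le> 2 * C * \<bar>k\<bar>" for y k by (rule odd_ext_lipschitz_1[OF sb C])
  note vel = gsqg_velocity_eq[OF bi \<alpha>, folded p_def]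
  have vc: "2 * C \<ge> 0" "p \<ge> 0" using C p by auto
  have "\<bar>U (a + k) - U a\<bar> \<le> (2 * C * (LINT z|lborel. \<bar>near p (0, 1) z\<bar>) + (1 + p) * (2 * C)) * \<bar>k\<bar>"
    using conv_ker_lipschitz_1[OF bo norm_e2 p(1,3) lip, of "(a, 0)" k] by (simp add: U_def p_def[symmetric])
  also have "\<dots> \<le> vel_const p (2 * C) * \<bar>k\<bar>" by (intro mult_right_mono vel_const_bounds vc) simp
  finally show "\<bar>U (a + k) - U a\<bar> \<le> vel_const p (2 * C) * \<bar>k\<bar>" .
  assume h: "h > 0"
  have "\<bar>snd (gsqg_velocity \<alpha> f (a, h))\<bar> \<le> (2 * (2 * C) * p * (LINT z::real\<times>real|lborel. norm z powr (1 - p) * indicator (cball 0 1) z) + (1 + p) * (2 * C)) * h"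
    unfolding vel snd_conv by (rule conv_ker_vertical_bound[OF bo odd_ext_reflect p(1,3) lip h])
  also have "\<dots> \<le> vel_const p (2 * C) * h" using h by (intro mult_right_mono vel_const_bounds vc) simp
  finally show "\<bar>snd (gsqg_velocity \<alpha> f (a, h))\<bar> \<le> vel_const p (2 * C) * h" .
  have K: "K \<ge> C" "K \<ge> hoelder_const C \<beta>" "K \<ge> 0" using C by (auto simp: K_def)
  \<comment> \<open>The path to \<open>(a, h)\<close> goes horizontally at height \<open>s\<close>
    and then vertically, which explains the two terms and why \<open>K\<close> dominates both
    \<open>C\<close> and \<open>hoelder_const C \<beta>\<close>.\<close>
  have err: "\<bar>odd_ext f (a - h * fst z, h * snd z) - sgn (snd z) * f (a, h)\<bar> \<le>
      min (2 * C) (K * h * \<bar>fst z\<bar> + K * (h * max 1 \<bar>snd z\<bar>) powr (1 - \<beta>))" if z: "snd z \<noteq> 0" for z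
  proof -
    define s where "s = h * \<bar>snd z\<bar>"
    have s: "s > 0" using h z by (simp add: s_def)
    have "\<bar>odd_ext f (a - h * fst z, h * snd z) - sgn (snd z) * f (a, h)\<bar> = \<bar>f (a - h * fst z, s) - f (a, h)\<bar>"
      using h z by (cases "snd z > 0") (auto simp: odd_ext_def s_def zero_less_mult_iff mult_less_0_iff reflect_def)
    moreover have "\<bar>f (a - h * fst z, s) - f (a, h)\<bar> \<le> 2 * C"
    proof -
      have "\<bar>f (a - h * fst z, s)\<bar> \<le> C" "\<bar>f (a, h)\<bar> \<le> C" using sb s h by (auto simp: slice_bound_def halfplane_iff)
      then show ?thesis by linarith
    qed
    moreover have "\<bar>f (a - h * fst z, s) - f (a, h)\<bar> \<le> K * h * \<bar>fst z\<bar> + K * (h * max 1 \<bar>snd z\<bar>) powr (1 - \<beta>)"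
    proof -
      have "\<bar>f ((a, s) + (- h * fst z, 0)) - f (a, s)\<bar> \<le> C * \<bar>- h * fst z\<bar>"
      proof -
        have "(a, s) \<in> halfplane" using s by (simp add: halfplane_iff)
        then show ?thesis using sb unfolding slice_bound_def by blast
      qed
      also have "\<dots> \<le> K * \<bar>- h * fst z\<bar>" using K(1) by (rule mult_right_mono) simp
      finally have 1: "\<bar>f (a - h * fst z, s) - f (a, s)\<bar> \<le> K * h * \<bar>fst z\<bar>" using h by (simp add: abs_mult)
      have "\<bar>f (a, s) - f (a, h)\<bar> \<le> hoelder_const C \<beta> * (max s h) powr (1 - \<beta>)"
        by (rule slice_bound_hoelder[OF sb C \<beta> s h])
      also have "\<dots> \<le> K * (max s h) powr (1 - \<beta>)" using K(2) by (rule mult_right_mono) simp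
      also have "max s h = h * max 1 \<bar>snd z\<bar>" using h by (auto simp: s_def max_def mult_le_cancel_left1)
      finally show ?thesis using 1 by linarith
    qed
    ultimately show ?thesis by simp
  qed
  have e: "3 - p = 1 - 2 * \<alpha>" by (simp add: p_def)
  show "\<bar>fst (gsqg_velocity \<alpha> f (a, h)) - U a - trace_const p * h powr (1 - 2 * \<alpha>) * f (a, h)\<bar> \<le>
       h powr (1 - 2 * \<alpha>) * (LINT z|lborel. layer_err (2 * C) K (1 - \<beta>) p h z)"
    using conv_ker_boundary_expansion[OF bo p(2,3) h K(3) vc(1) err]
    unfolding vel fst_conv trace_const_def U_def p_def[symmetric] e .
qed

section \<open>Averages over strips\<close>

lemma conv_ker_bound:
  assumes \<Theta>: "bdd_int C \<Theta>" and e: "norm e = 1" and p: "1 < p" "p < 3"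
  shows "\<bar>conv (ker p e) \<Theta> x\<bar> \<le> C * (LINT z|lborel. \<bar>near p e z\<bar>) + C"
proof -
  have m[measurable]: "\<Theta> \<in> borel_measurable borel" using \<Theta> by (simp add: bdd_int_def)
  have "\<bar>conv (near p e) \<Theta> x\<bar> \<le> (LINT z|lborel. C * \<bar>near p e z\<bar>)"
    unfolding conv_def
    by (rule order_trans[OF integral_abs_bound], rule integral_mono)
       (use integrable_abs[OF conv_integrable_near[OF \<Theta> e p]] integrable_abs[OF integrable_near[OF e p]] \<Theta>
        in \<open>auto simp: abs_mult bdd_int_def intro!: mult_right_mono\<close>)
  moreover have "\<bar>conv (far p e) \<Theta> x\<bar> \<le> (LINT z|lborel. \<bar>\<Theta> (x - z)\<bar>)"
    unfolding conv_def
  proof (rule order_trans[OF integral_abs_bound], rule integral_mono)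
    show "integrable lborel (\<lambda>z. \<bar>\<Theta> (x - z) * far p e z\<bar>)"
      by (intro integrable_abs conv_integrable_far[OF \<Theta> e p(1)])
    show "integrable lborel (\<lambda>z. \<bar>\<Theta> (x - z)\<bar>)"
      using \<Theta> by (intro integrable_abs lborel_integrable_diff) (simp add: bdd_int_def)
    show "\<bar>\<Theta> (x - z) * far p e z\<bar> \<le> \<bar>\<Theta> (x - z)\<bar>" for z
      using far_bound[OF e, of p z] p by (simp add: abs_mult mult_left_le)
  qed
  moreover have "(LINT z|lborel. \<bar>\<Theta> (x - z)\<bar>) = (LINT z|lborel. \<bar>\<Theta> z\<bar>)"
  proof -
    have "(\<lambda>z. \<bar>\<Theta> z\<bar>) \<in> borel_measurable borel" by measurable
    from lborel_integral_diff[OF this, of x] show ?thesis .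
  qed
  moreover have "(LINT z|lborel. \<bar>\<Theta> z\<bar>) \<le> C" using \<Theta> by (simp add: bdd_int_def)
  ultimately show ?thesis unfolding conv_ker_eq[OF \<Theta> e p] by simp
qed

section \<open>Rescaling the height variable\<close>

lemma lborel_affine_height:
  fixes h :: real
  assumes "h \<noteq> 0"
  shows "(lborel :: (real \<times> real \<times> real) measure) =
    density (distr lborel borel (\<lambda>p. (fst p, fst (snd p), h * snd (snd p)))) (\<lambda>_. ennreal \<bar>h\<bar>)"
proof -
  define c :: "real \<times> real \<times> real \<Rightarrow> real" where "c j = fst j + fst (snd j) + h * snd (snd j)" for j
  have B: "(Basis :: (real \<times> real \<times> real) set) = {(1, 0, 0), (0, 1, 0), (0, 0, 1)}"
    by (auto simp: Basis_prod_def zero_prod_def)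
  have T: "(\<lambda>x :: real \<times> real \<times> real. 0 + (\<Sum>j\<in>Basis. (c j * (x \<bullet> j)) *\<^sub>R j)) = (\<lambda>p. (fst p, fst (snd p), h * snd (snd p)))"
    by (auto simp: fun_eq_iff B c_def inner_prod_def)
  have p: "(\<Prod>j\<in>Basis. \<bar>c j\<bar>) = \<bar>h\<bar>"
    by (simp add: B c_def)
  have "c j \<noteq> 0" if "j \<in> Basis" for j using that assms by (auto simp: B c_def)
  from lborel_affine_euclidean[of c 0, OF this] show ?thesis unfolding T p .
qed

lemma height_measurable [measurable]:
  "(\<lambda>p :: real \<times> real \<times> real. (fst p, fst (snd p), h * snd (snd p))) \<in> borel_measurable borel"
  by (intro borel_measurable_continuous_onI continuous_intros)

lemma lborel_integral_height:
  fixes f :: "real \<times> real \<times> real \<Rightarrow> real"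
  assumes f: "integrable lborel f" and h: "h > 0"
  shows "(LINT p|lborel. f p) = (LINT p|lborel. h * f (fst p, fst (snd p), h * snd (snd p)))"
    "integrable lborel (\<lambda>p. h * f (fst p, fst (snd p), h * snd (snd p)))"
proof -
  let ?T = "\<lambda>p :: real \<times> real \<times> real. (fst p, fst (snd p), h * snd (snd p))"
  have h0: "h \<noteq> 0" using h by simp
  have m[measurable]: "f \<in> borel_measurable borel" using f by auto
  have "(LINT z|lborel. f z) = (LINT z|density (distr lborel borel ?T) (\<lambda>_. ennreal \<bar>h\<bar>). f z)"
    by (subst lborel_affine_height[OF h0]) simp
  also have "\<dots> = (LINT z|distr lborel borel ?T. \<bar>h\<bar> *\<^sub>R f z)"
    by (rule integral_density) auto
  also have "\<dots> = (LINT z|lborel. \<bar>h\<bar> *\<^sub>R f (?T z))" by (rule integral_distr) auto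
  finally show "(LINT p|lborel. f p) = (LINT p|lborel. h * f (?T p))" using h by simp
  have "integrable (density (distr lborel borel ?T) (\<lambda>_. ennreal \<bar>h\<bar>)) f"
    using f lborel_affine_height[OF h0] by simp
  then have "integrable (distr lborel borel ?T) (\<lambda>z. \<bar>h\<bar> *\<^sub>R f z)"
    by (subst (asm) integrable_density) auto
  then have "integrable lborel (\<lambda>z. \<bar>h\<bar> *\<^sub>R f (?T z))"
    by (subst (asm) integrable_distr_eq) auto
  then show "integrable lborel (\<lambda>p. h * f (?T p))" using h by simp
qed

lemma locally_lipschitz_on_compact:
  fixes f :: "'a::metric_space \<Rightarrow> 'b::metric_space"
  assumes f: "locally_lipschitz_on S f" and X: "compact X" "X \<subseteq> S"
  shows "\<exists>L. L-lipschitz_on X f"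
proof -
  \<comment> \<open>The notion \<open>local_lipschitz\<close> carries a time parameter; a single
    dummy time turns it into a statement about \<open>f\<close>.\<close>
  have ll: "local_lipschitz {0::real} X (\<lambda>_. f)"
    unfolding local_lipschitz_def
  proof (intro ballI)
    fix x and t :: real assume x: "x \<in> X"
    then obtain r L where r: "r > 0" "L-lipschitz_on (ball x r \<inter> S) f"
      using f X(2) unfolding locally_lipschitz_on_def by blast
    have "cball x (r/2) \<inter> X \<subseteq> ball x r \<inter> S" using X(2) r(1) by auto
    from lipschitz_on_subset[OF r(2) this]
    show "\<exists>u>0. \<exists>L. \<forall>t\<in>cball t u \<inter> {0}. L-lipschitz_on (cball x u \<inter> X) f"
      using r(1) by (intro exI[of _ "r/2"] conjI exI[of _ L]) auto
  qed
  show ?thesis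
    by (rule local_lipschitz_compact_implies_lipschitz[OF ll X(1)]) auto
qed

lemma lipschitz_on_power2:
  fixes f :: "'a::metric_space \<Rightarrow> real"
  assumes f: "L-lipschitz_on S f" and M: "\<And>x. x \<in> S \<Longrightarrow> \<bar>f x\<bar> \<le> M" "M \<ge> 0"
  shows "(2 * M * L)-lipschitz_on S (\<lambda>x. (f x)\<^sup>2)"
proof (rule lipschitz_onI)
  have L: "L \<ge> 0" using f by (rule lipschitz_on_nonneg)
  then show "0 \<le> 2 * M * L" using M(2) by simp
  fix x y assume xy: "x \<in> S" "y \<in> S"
  have "\<bar>(f x)\<^sup>2 - (f y)\<^sup>2\<bar> = \<bar>f x + f y\<bar> * \<bar>f x - f y\<bar>"
    by (simp add: abs_mult[symmetric] power2_eq_square algebra_simps)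
  also have "\<dots> \<le> (2 * M) * (L * dist x y)"
    using lipschitz_onD[OF f xy] M(1)[OF xy(1)] M(1)[OF xy(2)] M(2)
    by (intro mult_mono) (auto simp: dist_real_def)
  finally show "dist ((f x)\<^sup>2) ((f y)\<^sup>2) \<le> 2 * M * L * dist x y" by (simp add: dist_real_def mult_ac)
qed

text \<open>Normalised to integral 1 in the height variable. Rescaling heights by \<open>h\<close>
  turns every strip into the fixed interval [1,2], which is how strips are compared.\<close>

definition strip :: "real \<Rightarrow> real \<times> real \<times> real \<Rightarrow> real" where
  "strip h p = indicator {h..2 * h} (snd (snd p)) / h"

lemma strip_measurable [measurable]: "strip h \<in> borel_measurable borel"
  unfolding strip_def[abs_def] by measurable

lemma strip_nonneg: "h > 0 \<Longrightarrow> strip h p \<ge> 0" and strip_le: "h > 0 \<Longrightarrow> strip h p \<le> 1 / h"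
  by (auto simp: strip_def indicator_def)

lemma strip_height: "h > 0 \<Longrightarrow> h * strip h (fst p, fst (snd p), h * snd (snd p)) = indicator {1..2} (snd (snd p))"
  by (simp add: strip_def indicator_def)

definition base :: "real \<times> real \<times> real \<Rightarrow> real \<times> real" where
  "base p = (fst p, fst (snd p))"

lemma base_measurable [measurable]: "base \<in> borel_measurable borel"
  unfolding base_def[abs_def] by (intro borel_measurable_continuous_onI continuous_intros)

lemma base_height [simp]: "base (fst p, fst (snd p), h * snd (snd p)) = base p"
  by (simp add: base_def)

text \<open>The hypothetical solution of part (a), reduced to what the argument uses; the context
  ends in a contradiction.\<close>

locale boundary_shear =
  fixes \<alpha> \<beta> T C :: real and \<theta> :: "real \<Rightarrow> real \<times> real \<Rightarrow> real"
  assumes \<alpha>: "0 < \<alpha>" "\<alpha> < 1/2" and \<beta>: "0 \<le> \<beta>" "\<beta> < 2 * \<alpha>" and T: "T > 0" and C: "C > 0"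
    and sol: "classical_solution \<alpha> T \<theta>"
    and slices: "AE t in lborel. t \<in> {0..T} \<longrightarrow> slice_bound C \<beta> (\<theta> t)"
    and init: "\<And>x. x \<in> halfplane \<Longrightarrow> \<theta> 0 x = tent2 0 x"
begin

definition p where "p = 2 + 2 * \<alpha>"
definition K where "K = max (hoelder_const C \<beta>) C"
definition A where "A = vel_const p (2 * C)"
text \<open>Extension by zero from the open cylinder makes the solution a Borel function on the
  whole space, so that integrals over \<open>lborel\<close> and translations apply.\<close>

definition F where "F q = indicator ({0<..<T} \<times> halfplane) q * \<theta> (fst q) (snd q)"
definition U where "U t a = conv (ker p (0, 1)) (odd_ext (\<theta> t)) (a, 0)"

lemma \<beta>1: "\<beta> < 1" using \<alpha> \<beta> by linarith

lemma p: "1 < p" "2 < p" "p < 3" using \<alpha> by (auto simp: p_def)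

lemma K: "K \<ge> C" "K \<ge> hoelder_const C \<beta>" "K \<ge> 0" using C by (auto simp: K_def)

lemma A: "A \<ge> 0" unfolding A_def using C p by (intro vel_const_bounds) auto

lemma F_eq: "t \<in> {0<..<T} \<Longrightarrow> h > 0 \<Longrightarrow> F (t, a, h) = \<theta> t (a, h)"
  by (simp add: F_def halfplane_iff)

lemma sets_cylinder: "{0<..<T} \<times> halfplane \<in> sets borel"
  by (intro borel_open open_Times open_halfplane) auto

lemma F_measurable [measurable]: "F \<in> borel_measurable borel"
proof -
  have "continuous_on ({0<..<T} \<times> halfplane) (\<lambda>(t, x). \<theta> t x)"
    by (rule continuous_on_subset[OF classical_solution_continuous(1)[OF sol]]) auto
  from borel_measurable_continuous_on_indicator[OF sets_cylinder this]
  show ?thesis by (simp add: F_def[abs_def] case_prod_unfold)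
qed

lemma AE_slices: "AE q in lborel. fst q \<in> {0<..<T} \<longrightarrow> slice_bound C \<beta> (\<theta> (fst q))"
  using AE_fst[OF slices] by eventually_elim auto

lemma F_bound: "AE q in lborel. \<bar>F q\<bar> \<le> C"
  using AE_slices
proof eventually_elim
  case (elim q)
  then show ?case using C by (cases q) (auto simp: F_def indicator_def slice_bound_def)
qed

lemma F_lipschitz:
  assumes "X \<subseteq> {0<..<T} \<times> halfplane" "compact X"
  shows "\<exists>L. L-lipschitz_on X F"
proof -
  have "locally_lipschitz_on ({0..T} \<times> halfplane) (\<lambda>(t, x). \<theta> t x)" using sol by (simp add: classical_solution_def)
  moreover have "X \<subseteq> {0..T} \<times> halfplane" using assms(1) by auto
  ultimately obtain L where "L-lipschitz_on X (\<lambda>(t, x). \<theta> t x)"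
    using locally_lipschitz_on_compact[OF _ assms(2)] by blast
  moreover have "F q = (\<lambda>(t, x). \<theta> t x) q" if "q \<in> X" for q using that assms(1) by (auto simp: F_def indicator_def)
  ultimately show ?thesis unfolding lipschitz_on_def by metis
qed

lemma F_has_derivative:
  "AE q in lborel. q \<in> {0<..<T} \<times> halfplane \<longrightarrow>
    (\<exists>D. (F has_derivative D) (at q) \<and> D (1, 0) + D (0, gsqg_velocity \<alpha> (\<theta> (fst q)) (snd q)) = 0)"
  using classical_solution_AE[OF sol]
proof eventually_elim
  case (elim q)
  show ?case
  proof
    assume q: "q \<in> {0<..<T} \<times> halfplane"
    then have "q \<in> {0..T} \<times> halfplane" by auto
    then obtain D where D: "((\<lambda>(t, x). \<theta> t x) has_derivative D) (at q)"
      "D (1, 0) + D (0, gsqg_velocity \<alpha> (\<theta> (fst q)) (snd q)) = 0" using elim by blast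
    have "open ({0<..<T} \<times> halfplane)" by (intro open_Times open_halfplane) auto
    from has_derivative_transform_within_open[OF D(1) this q]
    have "(F has_derivative D) (at q)" by (auto simp: F_def)
    then show "\<exists>D. (F has_derivative D) (at q) \<and> D (1, 0) + D (0, gsqg_velocity \<alpha> (\<theta> (fst q)) (snd q)) = 0"
      using D(2) by blast
  qed
qed

lemma F_vertical:
  assumes "t \<in> {0<..<T}" "slice_bound C \<beta> (\<theta> t)" "0 < a" "0 < b"
  shows "\<bar>F (t, x, a) - F (t, x, b)\<bar> \<le> K * (max a b) powr (1 - \<beta>)"
proof -
  have "\<bar>\<theta> t (x, a) - \<theta> t (x, b)\<bar> \<le> hoelder_const C \<beta> * (max a b) powr (1 - \<beta>)"
    by (rule slice_bound_hoelder[OF assms(2) C \<beta>(1) \<beta>1 assms(3,4)])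
  also have "\<dots> \<le> K * (max a b) powr (1 - \<beta>)" using K(2) by (rule mult_right_mono) simp
  finally show ?thesis using assms by (simp add: F_eq)
qed

text \<open>The supports used all lie in one box over -3/4 <= x_1 <= -1/4, away from time 0 and from
  the boundary. A slightly larger compact box still lies in the domain and supplies the Lipschitz
  constant.\<close>

lemma diff_quotient_F:
  assumes t1: "0 < t1" "2 * t1 < T" and h: "0 < h"
    and \<phi>: "\<phi> \<in> borel_measurable borel" "\<And>q. \<bar>\<phi> q\<bar> \<le> B"
    and supp: "\<And>q. q \<notin> cbox (t1/2, -3/4, h) (3*t1/2, -1/4, 2*h) \<Longrightarrow> \<phi> q = 0"
  shows "integrable lborel (\<lambda>q. ddir F v q * \<phi> q)"
    and "((\<lambda>k. LINT q|lborel. F q * ((\<phi> (q - k *\<^sub>R v) - \<phi> q) / k)) \<longlongrightarrow> (LINT q|lborel. ddir F v q * \<phi> q)) (at 0)"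
proof -
  let ?X = "cbox (t1/4, -1, h/2) (2*t1, 0, 3*h) :: (real \<times> real \<times> real) set"
  let ?S = "box (t1/4, -1, h/2) (2*t1, 0, 3*h) :: (real \<times> real \<times> real) set"
  let ?K = "cbox (t1/2, -3/4, h) (3*t1/2, -1/4, 2*h) :: (real \<times> real \<times> real) set"
  have X: "?X \<subseteq> {0<..<T} \<times> halfplane" using t1 h by (auto simp: cbox_Pair_eq halfplane_iff)
  obtain L where L: "L-lipschitz_on ?X F" using F_lipschitz[OF X compact_cbox] by blast
  have LS: "L-lipschitz_on ?S F" by (rule lipschitz_on_subset[OF L box_subset_cbox])
  have KS: "?K \<subseteq> ?S" using t1 h by (auto simp: mem_box Basis_prod_def zero_prod_def)
  have d: "AE q in lborel. q \<in> ?K \<longrightarrow> (\<exists>D. (F has_derivative D) (at q))"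
    using F_has_derivative by eventually_elim (use KS X box_subset_cbox in blast)
  show "integrable lborel (\<lambda>q. ddir F v q * \<phi> q)"
    by (rule integral_diff_quotient_tendsto(1)[OF F_measurable LS open_box \<phi> compact_cbox KS supp d])
  show "((\<lambda>k. LINT q|lborel. F q * ((\<phi> (q - k *\<^sub>R v) - \<phi> q) / k)) \<longlongrightarrow> (LINT q|lborel. ddir F v q * \<phi> q)) (at 0)"
    by (rule integral_diff_quotient_tendsto(2)[OF F_measurable LS open_box \<phi> compact_cbox KS supp d])
qed

end

lemma content_cbox3:
  assumes "a \<le> a'" "b \<le> b'" "c \<le> (c' :: real)"
  shows "measure lborel (cbox (a :: real, b :: real, c) (a', b', c')) = (a' - a) * ((b' - b) * (c' - c))"
  using assms by (simp add: content_Pair)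

lemma base_diff: "base (q - k *\<^sub>R v) = base q - k *\<^sub>R base v"
  by (simp add: base_def)

lemma integral_abs_le_box:
  fixes f :: "real \<times> real \<times> real \<Rightarrow> real"
  assumes m: "f \<in> borel_measurable borel" and b: "AE q in lborel. \<bar>f q\<bar> \<le> M * indicator (cbox x y) q" and M: "M \<ge> 0"
  shows "integrable lborel f" "\<bar>LINT q|lborel. f q\<bar> \<le> M * measure lborel (cbox x y)"
proof -
  have i: "integrable lborel (\<lambda>q. M * indicator (cbox x y) q)"
    by (intro integrable_mult_right integrable_real_indicator[OF _ emeasure_lborel_cbox_finite]) auto
  show f: "integrable lborel f"
    by (rule Bochner_Integration.integrable_bound[OF i]) (use m b M in \<open>auto elim!: eventually_mono\<close>)
  have "\<bar>LINT q|lborel. f q\<bar> \<le> (LINT q|lborel. M * indicator (cbox x y) q)"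
    by (rule order_trans[OF integral_abs_bound], rule integral_mono_AE[OF integrable_abs[OF f] i b])
  also have "\<dots> = M * measure lborel (cbox x y)" by simp
  finally show "\<bar>LINT q|lborel. f q\<bar> \<le> M * measure lborel (cbox x y)" .
qed

lemma strip_support:
  assumes "\<mu> (base q) * strip h q \<noteq> 0" and "\<And>s. s \<notin> cbox (a, b) (a', b') \<Longrightarrow> \<mu> s = 0"
  shows "q \<in> cbox (a, b, h) (a', b', 2 * h)"
proof -
  have "base q \<in> cbox (a, b) (a', b')" using assms by fastforce
  moreover have "snd (snd q) \<in> {h..2 * h}" using assms(1) by (auto simp: strip_def indicator_def)
  ultimately show ?thesis by (cases q) (auto simp: base_def cbox_Pair_eq)
qed

context boundary_shear
begin

text \<open>The direction \<open>v\<close> is tangent to the boundary, so the derivative can be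
  moved to \<mu>, which depends only on time and x_1. Rescaling both strips to [1,2] leaves the
  difference of \<open>F\<close> at heights \<open>h * s\<close> and \<open>h' * s\<close>, which is
  the Hoelder bound. The last factor is the volume of the box carrying the shifted supports.\<close>

lemma strip_compare:
  assumes t1: "0 < t1" "2 * t1 < T" and h: "0 < h'" "h' \<le> h"
    and \<mu>[measurable]: "\<mu> \<in> borel_measurable borel" and B: "\<And>s. \<bar>\<mu> s\<bar> \<le> B"
    and supp: "\<And>s. s \<notin> cbox (t1/2, -3/4) (3*t1/2, -1/4) \<Longrightarrow> \<mu> s = 0"
    and lip: "\<And>k. AE q in lborel. \<bar>\<mu> (base q - k *\<^sub>R base v) - \<mu> (base q)\<bar> \<le> \<Lambda> * \<bar>k\<bar>" and \<Lambda>: "\<Lambda> \<ge> 0"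
    and v: "\<bar>fst v\<bar> \<le> 1" "\<bar>fst (snd v)\<bar> \<le> 1" "snd (snd v) = 0"
  shows "\<bar>(LINT q|lborel. ddir F v q * (\<mu> (base q) * strip h q)) - (LINT q|lborel. ddir F v q * (\<mu> (base q) * strip h' q))\<bar>
    \<le> K * (2 * h) powr (1 - \<beta>) * \<Lambda> * (2 * t1)"
proof -
  have h0: "h > 0" using h by simp
  define I where "I g k = (LINT q|lborel. F q * ((\<mu> (base (q - k *\<^sub>R v)) * strip g (q - k *\<^sub>R v) - \<mu> (base q) * strip g q) / k))" for g k
  have lim: "(I g \<longlongrightarrow> (LINT q|lborel. ddir F v q * (\<mu> (base q) * strip g q))) (at 0)" if g: "g > 0" for g
    unfolding I_def
  proof (rule diff_quotient_F(2)[OF t1 g, where B="B * (1 / g)"])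
    show "(\<lambda>q. \<mu> (base q) * strip g q) \<in> borel_measurable borel" by measurable
    show "\<bar>\<mu> (base q) * strip g q\<bar> \<le> B * (1 / g)" for q
      unfolding abs_mult using B[of "base q"] strip_nonneg[OF g, of q] strip_le[OF g, of q]
      by (intro mult_mono) auto
    show "\<mu> (base q) * strip g q = 0" if "q \<notin> cbox (t1/2, -3/4, g) (3*t1/2, -1/4, 2*g)" for q
      using that strip_support[where \<mu>=\<mu>, OF _ supp] by blast
  qed
  \<comment> \<open>Shifts below \<open>k0\<close> keep the support of \<mu> in [0, 2 t1] x
    [-1, 0].\<close>
  define k0 where "k0 = min (t1/4) (1/4)"
  have k0: "k0 > 0" using t1 by (simp add: k0_def)
  have bound: "\<bar>I h k - I h' k\<bar> \<le> K * (2 * h) powr (1 - \<beta>) * \<Lambda> * (2 * t1)" if k: "k \<noteq> 0" "\<bar>k\<bar> < k0" for k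
  proof -
    define d where "d q = (\<mu> (base q - k *\<^sub>R base v) - \<mu> (base q)) / k" for q
    have [measurable]: "(\<lambda>q. \<mu> (base q - k *\<^sub>R base v)) \<in> borel_measurable borel"
    proof -
      have "(\<lambda>q. base q - k *\<^sub>R base v) \<in> borel_measurable borel" by measurable
      from measurable_compose[OF this \<mu>] show ?thesis .
    qed
    have dm[measurable]: "d \<in> borel_measurable borel" unfolding d_def[abs_def] by measurable
    have db: "AE q in lborel. \<bar>d q\<bar> \<le> \<Lambda>"
      using lip[of k] by eventually_elim (use k in \<open>simp add: d_def abs_div divide_le_eq\<close>)
    have ds: "base q \<in> cbox (0, -1) (2*t1, 0)" if "d q \<noteq> 0" for q
    proof -
      have "\<mu> (base q - k *\<^sub>R base v) \<noteq> 0 \<or> \<mu> (base q) \<noteq> 0" using that by (auto simp: d_def)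
      then have "base q - k *\<^sub>R base v \<in> cbox (t1/2, -3/4) (3*t1/2, -1/4) \<or> base q \<in> cbox (t1/2, -3/4) (3*t1/2, -1/4)"
        using supp by blast
      moreover have "\<bar>k * fst v\<bar> \<le> k0 * 1" "\<bar>k * fst (snd v)\<bar> \<le> k0 * 1"
        unfolding abs_mult using k v by (intro mult_mono; simp)+
      then have "\<bar>k * fst v\<bar> \<le> t1/4" "\<bar>k * fst (snd v)\<bar> \<le> 1/4" by (auto simp: k0_def)
      ultimately show ?thesis using t1 by (auto simp: base_def cbox_Pair_eq abs_le_iff)
    qed
    \<comment> \<open>A tangential shift leaves the height alone, so the discontinuous strip
      contributes nothing to the quotient.\<close>
    have strip_k: "strip g (q - k *\<^sub>R v) = strip g q" for g q using v(3) by (simp add: strip_def)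
    have Ieq: "I g k = (LINT q|lborel. F (fst q, fst (snd q), g * snd (snd q)) * d q * indicator {1..2} (snd (snd q)))"
      and Ii: "integrable lborel (\<lambda>q. F (fst q, fst (snd q), g * snd (snd q)) * d q * indicator {1..2} (snd (snd q)))"
      if g: "g > 0" for g
    proof -
      have Ig: "I g k = (LINT q|lborel. F q * d q * strip g q)"
        unfolding I_def strip_k base_diff
        by (intro Bochner_Integration.integral_cong refl) (simp add: d_def algebra_simps diff_divide_distrib)
      have i: "integrable lborel (\<lambda>q. F q * d q * strip g q)"
      proof (rule integral_abs_le_box(1)[where M="C * \<Lambda> * (1 / g)" and x="(0, -1, g)" and y="(2*t1, 0, 2*g)"])
        show "AE q in lborel. \<bar>F q * d q * strip g q\<bar> \<le> C * \<Lambda> * (1 / g) * indicator (cbox (0, -1, g) (2*t1, 0, 2*g)) q"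
          using F_bound db
        proof eventually_elim
          case (elim q)
          show ?case
          proof (cases "F q * d q * strip g q = 0")
            case False
            then have "d q \<noteq> 0" "strip g q \<noteq> 0" by auto
            then have "q \<in> cbox (0, -1, g) (2*t1, 0, 2*g)"
              using ds[of q] by (cases q) (auto simp: base_def cbox_Pair_eq strip_def indicator_def split: if_splits)
            moreover have "\<bar>F q\<bar> * \<bar>d q\<bar> * \<bar>strip g q\<bar> \<le> C * \<Lambda> * (1 / g)"
              using elim C \<Lambda> strip_nonneg[OF g, of q] strip_le[OF g, of q] by (intro mult_mono) auto
            ultimately show ?thesis by (simp add: abs_mult)
          next
            case True
            show ?thesis unfolding True using C \<Lambda> g by simp
          qed
        qed
      qed (use C \<Lambda> g in auto)
      have dT: "d (fst q, fst (snd q), g * snd (snd q)) = d q" for q by (simp add: d_def)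
      have eq: "g * (F (fst q, fst (snd q), g * snd (snd q)) * d (fst q, fst (snd q), g * snd (snd q)) * strip g (fst q, fst (snd q), g * snd (snd q)))
         = F (fst q, fst (snd q), g * snd (snd q)) * d q * indicator {1..2} (snd (snd q))" for q
        unfolding dT strip_height[OF g, of q, symmetric] by simp
      from Ig lborel_integral_height[OF i g]
      show "I g k = (LINT q|lborel. F (fst q, fst (snd q), g * snd (snd q)) * d q * indicator {1..2} (snd (snd q)))"
        and "integrable lborel (\<lambda>q. F (fst q, fst (snd q), g * snd (snd q)) * d q * indicator {1..2} (snd (snd q)))"
        unfolding eq by simp_all
    qed
    define N where "N = K * (2 * h) powr (1 - \<beta>) * \<Lambda>"
    have N: "N \<ge> 0" using K(3) \<Lambda> by (simp add: N_def)
    have "I h k - I h' k = (LINT q|lborel. F (fst q, fst (snd q), h * snd (snd q)) * d q * indicator {1..2} (snd (snd q))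
        - F (fst q, fst (snd q), h' * snd (snd q)) * d q * indicator {1..2} (snd (snd q)))"
      unfolding Ieq[OF h0] Ieq[OF h(1)] by (rule Bochner_Integration.integral_diff[symmetric, OF Ii[OF h0] Ii[OF h(1)]])
    also have "\<bar>\<dots>\<bar> \<le> N * measure lborel (cbox (0, -1, 1) (2*t1, 0, 2) :: (real \<times> real \<times> real) set)"
    proof (rule integral_abs_le_box(2)[OF _ _ N])
      show "(\<lambda>q. F (fst q, fst (snd q), h * snd (snd q)) * d q * indicator {1..2} (snd (snd q))
        - F (fst q, fst (snd q), h' * snd (snd q)) * d q * indicator {1..2} (snd (snd q))) \<in> borel_measurable borel"
        by measurable
      show "AE q in lborel. \<bar>F (fst q, fst (snd q), h * snd (snd q)) * d q * indicator {1..2} (snd (snd q))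
        - F (fst q, fst (snd q), h' * snd (snd q)) * d q * indicator {1..2} (snd (snd q))\<bar> \<le> N * indicator (cbox (0, -1, 1) (2*t1, 0, 2)) q"
        using AE_slices db
      proof eventually_elim
        case (elim q)
        obtain t a s where q: "q = (t, a, s)" by (metis prod.collapse)
        have eq: "\<bar>F (fst q, fst (snd q), h * snd (snd q)) * d q * indicator {1..2} (snd (snd q))
        - F (fst q, fst (snd q), h' * snd (snd q)) * d q * indicator {1..2} (snd (snd q))\<bar>
          = \<bar>F (t, a, h * s) - F (t, a, h' * s)\<bar> * \<bar>d q\<bar> * indicator {1..2} s"
          by (simp add: q left_diff_distrib[symmetric] abs_mult)
        show ?case
        proof (cases "d q \<noteq> 0 \<and> s \<in> {1..2}")
          case True
          then have "q \<in> cbox (0, -1, 1) (2*t1, 0, 2)"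
            using ds[of q] by (auto simp: q base_def cbox_Pair_eq)
          have "\<bar>F (t, a, h * s) - F (t, a, h' * s)\<bar> \<le> K * (2 * h) powr (1 - \<beta>)"
          proof (cases "t \<in> {0<..<T}")
            case t: True
            have "\<bar>F (t, a, h * s) - F (t, a, h' * s)\<bar> \<le> K * (max (h * s) (h' * s)) powr (1 - \<beta>)"
              using elim(1) t True h h0 by (intro F_vertical) (auto simp: q)
            also have "\<dots> \<le> K * (2 * h) powr (1 - \<beta>)"
            proof (intro mult_left_mono powr_mono2 K)
              have "h * s \<le> h * 2" "h' * s \<le> h * 2" using True h h0 by (intro mult_mono; simp)+
              then show "max (h * s) (h' * s) \<le> 2 * h" by simp
            qed (use \<beta>1 True h h0 in auto)
            finally show ?thesis .
          next
            case False
            then have "F (t, a, h * s) = 0" "F (t, a, h' * s) = 0" by (auto simp: F_def)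
            then show ?thesis using K by simp
          qed
          then have "\<bar>F (t, a, h * s) - F (t, a, h' * s)\<bar> * \<bar>d q\<bar> \<le> N"
            unfolding N_def using elim(2) \<Lambda> K by (intro mult_mono) auto
          then show ?thesis unfolding eq using True \<open>q \<in> _\<close> by simp
        qed (use N in \<open>auto simp: eq\<close>)
      qed
    qed
    also have "measure lborel (cbox (0, -1, 1) (2*t1, 0, 2) :: (real \<times> real \<times> real) set) = 2 * t1"
      using t1 by (subst content_cbox3) auto
    finally show ?thesis by (simp add: N_def)
  qed
  have "((\<lambda>k. \<bar>I h k - I h' k\<bar>) \<longlongrightarrow> \<bar>(LINT q|lborel. ddir F v q * (\<mu> (base q) * strip h q)) - (LINT q|lborel. ddir F v q * (\<mu> (base q) * strip h' q))\<bar>) (at 0)"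
    by (intro tendsto_intros lim h h0)
  moreover have "eventually (\<lambda>k. \<bar>I h k - I h' k\<bar> \<le> K * (2 * h) powr (1 - \<beta>) * \<Lambda> * (2 * t1)) (at 0)"
    unfolding eventually_at using bound k0 by (intro exI[of _ k0]) (auto simp: dist_real_def)
  ultimately show ?thesis by (rule tendsto_upperbound) simp
qed

text \<open>\<open>V (t, a)\<close> equals the boundary velocity \<open>U t a\<close> for almost every \<open>t\<close>; the truncation makes
  it bounded on the exceptional set too.\<close>

definition V :: "real \<times> real \<Rightarrow> real" where
  "V s = max (- A) (min A (LINT z|lborel. (F (fst s, (snd s, 0) - z) - F (fst s, reflect ((snd s, 0) - z))) * ker p (0, 1) z))"

lemma V_bound: "\<bar>V s\<bar> \<le> A"
  using A by (auto simp: V_def)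

lemma V_measurable [measurable]: "V \<in> borel_measurable borel"
proof -
  have m1: "(\<lambda>w :: (real \<times> real) \<times> real \<times> real. (fst (fst w), (snd (fst w), 0) - snd w)) \<in> borel_measurable borel"
    by (intro borel_measurable_continuous_onI continuous_intros)
  have m2: "(\<lambda>w :: (real \<times> real) \<times> real \<times> real. (fst (fst w), reflect ((snd (fst w), 0) - snd w))) \<in> borel_measurable borel"
    unfolding reflect_def by (intro borel_measurable_continuous_onI continuous_intros)
  have "(\<lambda>w :: (real \<times> real) \<times> real \<times> real. (F (fst (fst w), (snd (fst w), 0) - snd w) - F (fst (fst w), reflect ((snd (fst w), 0) - snd w))) * ker p (0, 1) (snd w)) \<in> borel_measurable borel"
    by (intro borel_measurable_times borel_measurable_diff measurable_compose[OF m1 F_measurable] measurable_compose[OF m2 F_measurable]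
        measurable_compose[OF borel_measurable_fst_snd(2) ker_measurable])
  then have "(\<lambda>(s, z). (F (fst s, (snd s, 0) - z) - F (fst s, reflect ((snd s, 0) - z))) * ker p (0, 1) z) \<in> borel_measurable ((borel :: (real \<times> real) measure) \<Otimes>\<^sub>M (lborel :: (real \<times> real) measure))"
    by (simp add: borel_prod[symmetric] case_prod_unfold cong: measurable_cong_sets sets_pair_measure_cong)
  from lborel.borel_measurable_lebesgue_integral[OF this]
  show ?thesis unfolding V_def[abs_def] by (intro borel_measurable_max borel_measurable_min borel_measurable_const)
qed

lemma V_eq:
  assumes t: "t \<in> {0<..<T}" and sb: "slice_bound C \<beta> (\<theta> t)"
  shows "V (t, a) = U t a"
proof -
  have cont: "continuous_on halfplane (\<theta> t)" using t by (intro classical_solution_continuous(2)[OF sol]) auto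
  have "F (t, y) - F (t, reflect y) = odd_ext (\<theta> t) y" for y
    using t by (simp add: F_def odd_ext_eq indicator_def)
  then have eq: "V (t, a) = max (- A) (min A (U t a))"
    by (simp add: V_def U_def conv_def)
  have "\<bar>U t a\<bar> \<le> 2 * C * (LINT z|lborel. \<bar>near p (0, 1) z\<bar>) + 2 * C"
    unfolding U_def by (rule conv_ker_bound[OF bdd_int_odd_ext[OF slice_bound_bdd_int[OF sb cont C]] norm_e2 p(1,3)])
  \<comment> \<open>\<open>A\<close> also dominates the sup norm of the boundary velocity, so
    truncating at \<open>A\<close> changes nothing for good times.\<close>
  also have "\<dots> \<le> 2 * C * (LINT z|lborel. \<bar>near p (0, 1) z\<bar>) + (1 + p) * (2 * C)"
    using C p by simp
  also have "\<dots> \<le> A" unfolding A_def using C p by (intro vel_const_bounds) auto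
  finally show ?thesis unfolding eq by simp
qed

end

section \<open>The transport equation near the boundary\<close>

lemma tendsto_powr_0_at_right: "a > 0 \<Longrightarrow> ((\<lambda>h :: real. (2 * h) powr a) \<longlongrightarrow> 0) (at_right 0)"
proof -
  assume a: "a > 0"
  have "((\<lambda>h :: real. 2 * h) \<longlongrightarrow> 2 * 0) (at_right 0)" by (intro tendsto_intros)
  moreover have "eventually (\<lambda>h :: real. 0 \<le> 2 * h) (at_right 0)"
    using eventually_at_right_less[of 0] by eventually_elim simp
  ultimately have "((\<lambda>h :: real. (2 * h) powr a) \<longlongrightarrow> (2 * 0) powr a) (at_right 0)"
    using a by (intro tendsto_powr' tendsto_const) auto
  then show ?thesis by simp
qed

context boundary_shear
begin

definition E where "E s = (LINT z|lborel. layer_err (2 * C) K (1 - \<beta>) p s z)"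

lemma E_nonneg: "s > 0 \<Longrightarrow> E s \<ge> 0"
  unfolding E_def using C K by (intro Bochner_Integration.integral_nonneg layer_err_nonneg) auto

text \<open>Lets the error throughout a strip be evaluated at its top.\<close>

lemma E_mono: "0 < s \<Longrightarrow> s \<le> s' \<Longrightarrow> E s \<le> E s'"
  unfolding E_def using C K \<beta>1 p by (intro integral_mono integrable_layer_err layer_err_mono) auto

lemma E_tendsto: "(E \<longlongrightarrow> 0) (at_right 0)"
  unfolding E_def using layer_err_tendsto[of p "2 * C" K "1 - \<beta>"] p C K \<beta>1 by auto

text \<open>The equation with the horizontal velocity replaced by boundary value plus shear. The
  vertical term is at most (A s)(2 C s^(-\<beta>)), of order s^(1-\<beta>), and the remainder of the
  shear expansion keeps its factor \<open>E\<close>, which tends to 0.\<close>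

lemma transport_equation:
  "AE q in lborel. q \<in> {0<..<T} \<times> halfplane \<longrightarrow> snd (snd q) \<le> 1 \<longrightarrow>
     \<bar>ddir F (0, 1, 0) q\<bar> \<le> C \<and>
     \<bar>ddir F (1, 0) q + V (base q) * ddir F (0, 1, 0) q + trace_const p * (F q * snd (snd q) powr (1 - 2 * \<alpha>) * ddir F (0, 1, 0) q)\<bar>
       \<le> 2 * A * C * snd (snd q) powr (1 - \<beta>) + C * snd (snd q) powr (1 - 2 * \<alpha>) * E (snd (snd q))"
  using F_has_derivative AE_slices
proof eventually_elim
  case (elim q)
  show ?case
  proof (intro impI)
    assume q: "q \<in> {0<..<T} \<times> halfplane" and s1: "snd (snd q) \<le> 1"
    obtain t a s where qq: "q = (t, a, s)" by (metis prod.collapse)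
    have t: "t \<in> {0<..<T}" and s: "s > 0" using q by (auto simp: qq halfplane_iff)
    have s1': "s \<le> 1" using s1 by (simp add: qq)
    have sb: "slice_bound C \<beta> (\<theta> t)" using elim(2) t by (simp add: qq)
    have cont: "continuous_on halfplane (\<theta> t)" using t by (intro classical_solution_continuous(2)[OF sol]) auto
    define u where "u = gsqg_velocity \<alpha> (\<theta> t) (a, s)"
    obtain D where D: "(F has_derivative D) (at q)" "D (1, 0) + D (0, u) = 0"
      using elim(1) q by (auto simp: qq u_def)
    interpret D: bounded_linear D using D(1) by (rule has_derivative_bounded_linear)
    define d1 where "d1 = D (0, 1, 0)"
    define d2 where "d2 = D (0, 0, 1)"
    have "(0 :: real, u) = fst u *\<^sub>R (0, 1, 0) + snd u *\<^sub>R (0, 0, 1)" by (simp add: prod_eq_iff)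
    then have Du: "D (0, u) = fst u * d1 + snd u * d2" by (simp only: D.add D.scaleR d1_def d2_def real_scaleR_def)
    have H: "(a, s) \<in> halfplane" using s by (simp add: halfplane_iff)
    have d1: "\<bar>d1\<bar> \<le> C" unfolding d1_def
    proof (rule ddir_lipschitz_bound[OF D(1)], intro always_eventually allI)
      fix k
      have "\<bar>\<theta> t ((a, s) + (k, 0)) - \<theta> t (a, s)\<bar> \<le> C * \<bar>k\<bar>" using sb H unfolding slice_bound_def by blast
      then show "\<bar>F (q + k *\<^sub>R (0, 1, 0)) - F q\<bar> \<le> C * \<bar>k\<bar>" using t s by (simp add: qq F_eq)
    qed
    have d2: "\<bar>d2\<bar> \<le> 2 * C * s powr - \<beta>"
    proof -
      have "\<bar>d2\<bar> \<le> C * max 1 ((s / 2) powr - \<beta>)" unfolding d2_def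
      proof (rule ddir_lipschitz_bound[OF D(1)])
        show "eventually (\<lambda>k. \<bar>F (q + k *\<^sub>R (0, 0, 1)) - F q\<bar> \<le> C * max 1 ((s / 2) powr - \<beta>) * \<bar>k\<bar>) (at_right 0)"
          using eventually_at_right_less[of 0]
        proof eventually_elim
          case (elim k)
          have "\<bar>\<theta> t ((a, s) + (0, k)) - \<theta> t (a, s)\<bar> \<le> C * max 1 ((snd (a, s) / 2) powr - \<beta>) * k"
            using sb H elim unfolding slice_bound_def by (meson less_imp_le)
          then show ?case using t s elim by (simp add: qq F_eq)
        qed
      qed
      also have "max 1 ((s / 2) powr - \<beta>) = (s / 2) powr - \<beta>"
        using s s1' \<beta> powr_mono2'[of "- \<beta>" "s / 2" 1] by (simp add: max_def)
      also have "(s / 2) powr - \<beta> = 2 powr \<beta> * s powr - \<beta>"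
        using s by (simp add: powr_divide powr_minus divide_simps)
      also have "C * (2 powr \<beta> * s powr - \<beta>) \<le> C * (2 * s powr - \<beta>)"
        using C \<beta>1 powr_mono[of \<beta> 1 "2::real"] by (intro mult_left_mono mult_right_mono) auto
      finally show ?thesis by simp
    qed
    note sv = slice_velocity[OF \<alpha> sb C cont \<beta>(1) \<beta>1, folded p_def K_def A_def, of s a]
    have u2: "\<bar>snd u\<bar> \<le> A * s" using sv(2)[OF s] by (simp add: u_def)
    have u1: "\<bar>fst u - U t a - trace_const p * s powr (1 - 2 * \<alpha>) * \<theta> t (a, s)\<bar> \<le> s powr (1 - 2 * \<alpha>) * E s"
      using sv(3)[OF s] by (simp add: u_def U_def E_def)
    \<comment> \<open>The remainder of the shear expansion; it multiplies the horizontal derivative,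
      which is at most \<open>C\<close>.\<close>
    define r where "r = fst u - U t a - trace_const p * s powr (1 - 2 * \<alpha>) * \<theta> t (a, s)"
    have "D (1, 0) = - (fst u * d1 + snd u * d2)" using D(2) Du by linarith
    then have "D (1, 0) + U t a * d1 + trace_const p * (\<theta> t (a, s) * s powr (1 - 2 * \<alpha>) * d1) = - (r * d1 + snd u * d2)"
      by (simp add: r_def algebra_simps)
    then have "\<bar>D (1, 0) + U t a * d1 + trace_const p * (\<theta> t (a, s) * s powr (1 - 2 * \<alpha>) * d1)\<bar> \<le> \<bar>snd u\<bar> * \<bar>d2\<bar> + \<bar>r\<bar> * \<bar>d1\<bar>"
      using abs_triangle_ineq[of "r * d1" "snd u * d2"] by (simp add: abs_mult del: minus_add_distrib)
    also have "\<dots> \<le> (A * s) * (2 * C * s powr - \<beta>) + (s powr (1 - 2 * \<alpha>) * E s) * C"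
      using u2 d2 d1 u1[folded r_def] A s C E_nonneg[OF s] by (intro add_mono mult_mono) auto
    also have "(A * s) * (2 * C * s powr - \<beta>) = 2 * A * C * s powr (1 - \<beta>)"
      using s by (simp add: powr_diff powr_minus divide_inverse)
    finally have "\<bar>D (1, 0) + U t a * d1 + trace_const p * (\<theta> t (a, s) * s powr (1 - 2 * \<alpha>) * d1)\<bar>
       \<le> 2 * A * C * s powr (1 - \<beta>) + C * s powr (1 - 2 * \<alpha>) * E s" by (simp add: mult_ac)
    then show "\<bar>ddir F (0, 1, 0) q\<bar> \<le> C \<and>
     \<bar>ddir F (1, 0) q + V (base q) * ddir F (0, 1, 0) q + trace_const p * (F q * snd (snd q) powr (1 - 2 * \<alpha>) * ddir F (0, 1, 0) q)\<bar>
       \<le> 2 * A * C * snd (snd q) powr (1 - \<beta>) + C * snd (snd q) powr (1 - 2 * \<alpha>) * E (snd (snd q))"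
      using d1 unfolding ddir_eq[OF D(1)] d1_def[symmetric] by (simp add: qq base_def V_eq[OF t sb] F_eq[OF t s])
  qed
qed

end

text \<open>Centred at time \<open>t1\<close> and at x_1 = -1/2, supported where the datum
  \<open>tent2 0\<close> rises linearly in x_1. The width in time is proportional to
  \<open>t1\<close>, hence the constant 2/t1 for time shifts.\<close>

definition cutoff :: "real \<Rightarrow> real \<times> real \<Rightarrow> real" where
  "cutoff t1 s = tent (2 * (fst s - t1) / t1) * tent (4 * (snd s + 1/2))"

lemma cutoff_measurable [measurable]: "cutoff t1 \<in> borel_measurable borel"
  unfolding cutoff_def[abs_def] by measurable

lemma cutoff_bounds: "cutoff t1 s \<ge> 0" "cutoff t1 s \<le> 1"
  by (auto simp: cutoff_def mult_le_one)

lemma cutoff_support: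
  assumes t1: "t1 > 0" and s: "s \<notin> cbox (t1/2, -3/4) (3*t1/2, -1/4)"
  shows "cutoff t1 s = 0"
proof -
  have "\<bar>fst s - t1\<bar> > t1/2 \<or> \<bar>snd s + 1/2\<bar> > 1/4"
  proof (rule ccontr)
    assume "\<not> ?thesis"
    then have "\<bar>fst s - t1\<bar> \<le> t1/2" "\<bar>snd s + 1/2\<bar> \<le> 1/4" by (auto simp: not_less)
    then have "t1/2 \<le> fst s \<and> fst s \<le> 3*t1/2" "-3/4 \<le> snd s \<and> snd s \<le> -1/4" by linarith+
    then have "s \<in> cbox (t1/2, -3/4) (3*t1/2, -1/4)" by (simp add: cbox_Pair_eq mem_Times_iff)
    then show False using s by blast
  qed
  then have "\<bar>2 * (fst s - t1) / t1\<bar> \<ge> 1 \<or> \<bar>4 * (snd s + 1/2)\<bar> \<ge> 1"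
  proof -
    have e1: "\<bar>2 * (fst s - t1) / t1\<bar> = 2 * \<bar>fst s - t1\<bar> / t1"
      unfolding abs_divide abs_mult using t1 by simp
    have e2: "\<bar>4 * (snd s + 1/2)\<bar> = 4 * \<bar>snd s + 1/2\<bar>" unfolding abs_mult by simp
    assume "\<bar>fst s - t1\<bar> > t1/2 \<or> \<bar>snd s + 1/2\<bar> > 1/4"
    then show ?thesis unfolding e1 e2 using t1 by (auto simp: le_divide_eq)
  qed
  then show ?thesis by (auto simp: cutoff_def tent_eq_0)
qed

lemma cutoff_lipschitz:
  assumes t1: "t1 > 0"
  shows "\<bar>cutoff t1 (s - k *\<^sub>R b) - cutoff t1 s\<bar> \<le> (2 / t1 * \<bar>fst b\<bar> + 4 * \<bar>snd b\<bar>) * \<bar>k\<bar>"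
proof -
  define x x' y y' where "x = tent (2 * (fst s - t1) / t1)" and "x' = tent (2 * (fst (s - k *\<^sub>R b) - t1) / t1)"
    and "y = tent (4 * (snd s + 1/2))" and "y' = tent (4 * (snd (s - k *\<^sub>R b) + 1/2))"
  have "\<bar>x' - x\<bar> \<le> \<bar>2 * (fst (s - k *\<^sub>R b) - t1) / t1 - 2 * (fst s - t1) / t1\<bar>"
    unfolding x_def x'_def by (rule tent_lipschitz)
  also have "2 * (fst (s - k *\<^sub>R b) - t1) / t1 - 2 * (fst s - t1) / t1 = - (2 / t1 * (k * fst b))"
    using t1 by (simp add: field_simps)
  also have "\<bar>\<dots>\<bar> = 2 / t1 * \<bar>fst b\<bar> * \<bar>k\<bar>" using t1 by (simp add: abs_mult)
  finally have x: "\<bar>x' - x\<bar> \<le> 2 / t1 * \<bar>fst b\<bar> * \<bar>k\<bar>" .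
  have "\<bar>y' - y\<bar> \<le> \<bar>4 * (snd (s - k *\<^sub>R b) + 1/2) - 4 * (snd s + 1/2)\<bar>"
    unfolding y_def y'_def by (rule tent_lipschitz)
  also have "4 * (snd (s - k *\<^sub>R b) + 1/2) - 4 * (snd s + 1/2) = - (4 * (k * snd b))" by simp
  also have "\<bar>\<dots>\<bar> = 4 * \<bar>snd b\<bar> * \<bar>k\<bar>" by (simp add: abs_mult)
  finally have y: "\<bar>y' - y\<bar> \<le> 4 * \<bar>snd b\<bar> * \<bar>k\<bar>" .
  have "\<bar>x' * y' - x * y\<bar> = \<bar>(x' - x) * y' + x * (y' - y)\<bar>" by (simp add: algebra_simps)
  also have "\<dots> \<le> \<bar>x' - x\<bar> * \<bar>y'\<bar> + \<bar>x\<bar> * \<bar>y' - y\<bar>" by (metis abs_mult abs_triangle_ineq)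
  also have "\<dots> \<le> (2 / t1 * \<bar>fst b\<bar> * \<bar>k\<bar>) * 1 + 1 * (4 * \<bar>snd b\<bar> * \<bar>k\<bar>)"
    using x y t1 by (intro add_mono mult_mono) (auto simp: x_def y'_def)
  finally show ?thesis by (simp add: cutoff_def x_def x'_def y_def y'_def algebra_simps)
qed

context boundary_shear
begin

text \<open>Multiplying the transport equation by the cutoff and integrating over a strip, the shear term is
  \<open>trace_const p * S t1 h\<close>.  The truncation of \<open>F\<close> is inactive almost everywhere.\<close>

definition S where "S t1 h = (LINT q|lborel. ddir F (0, 1, 0) q *
   (max (- C) (min C (F q)) * snd (snd q) powr (1 - 2 * \<alpha>) * (cutoff t1 (base q) * strip h q)))"

lemma strip_powr_le:
  assumes "h > 0" "0 \<le> a"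
  shows "snd (snd q) powr a * strip h q \<le> (2 * h) powr a * strip h q"
  using assms by (auto simp: strip_def indicator_def intro!: divide_right_mono powr_mono2)

text \<open>The normalisation of the strip cancels the thickness of the box, so the bound does not
  depend on \<open>h\<close>.\<close>

lemma integral_cutoff_strip:
  assumes t1: "t1 > 0" and h: "h > 0" and g: "g \<in> borel_measurable borel" and M: "M \<ge> 0"
    and le: "AE q in lborel. q \<in> cbox (t1/2, -3/4, h) (3*t1/2, -1/4, 2*h) \<longrightarrow> \<bar>g q\<bar> \<le> M"
  shows "\<bar>LINT q|lborel. g q * (cutoff t1 (base q) * strip h q)\<bar> \<le> M * t1"
    "integrable lborel (\<lambda>q. g q * (cutoff t1 (base q) * strip h q))"
proof -
  note g[measurable]
  let ?B = "cbox (t1/2, -3/4, h) (3*t1/2, -1/4, 2*h) :: (real \<times> real \<times> real) set"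
  have b: "AE q in lborel. \<bar>g q * (cutoff t1 (base q) * strip h q)\<bar> \<le> (M / h) * indicator ?B q"
    using le
  proof eventually_elim
    case (elim q)
    show ?case
    proof (cases "q \<in> ?B")
      case True
      have "\<bar>g q\<bar> * (cutoff t1 (base q) * strip h q) \<le> M * (1 * (1 / h))"
        using elim True M cutoff_bounds[of t1 "base q"] strip_nonneg[OF h, of q] strip_le[OF h, of q]
        by (intro mult_mono) auto
      then show ?thesis using True cutoff_bounds(1)[of t1 "base q"] strip_nonneg[OF h, of q] by (simp add: abs_mult)
    next
      case False
      then have "cutoff t1 (base q) * strip h q = 0"
        using strip_support[where \<mu>="cutoff t1", OF _ cutoff_support[OF t1]] by blast
      then show ?thesis using False by simp
    qed
  qed
  have m: "(\<lambda>q. g q * (cutoff t1 (base q) * strip h q)) \<in> borel_measurable borel" by measurable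
  have Mh: "M / h \<ge> 0" using M h by simp
  show "integrable lborel (\<lambda>q. g q * (cutoff t1 (base q) * strip h q))"
    by (rule integral_abs_le_box(1)[OF m b Mh])
  have "\<bar>LINT q|lborel. g q * (cutoff t1 (base q) * strip h q)\<bar> \<le> M / h * measure lborel ?B"
    by (rule integral_abs_le_box(2)[OF m b Mh])
  also have "measure lborel ?B = t1 * (1/2 * h)" using t1 h by (subst content_cbox3) auto
  also have "M / h * (t1 * (1/2 * h)) \<le> M * t1" using M t1 h by simp
  finally show "\<bar>LINT q|lborel. g q * (cutoff t1 (base q) * strip h q)\<bar> \<le> M * t1" .
qed

text \<open>The averaged equation on the strip at \<open>h\<close> is compared with the one at
  \<open>g \<le> h\<close>. The time derivative and the boundary transport differ by
  O(h^(1-\<beta>)), while the shear and the remainder at \<open>g\<close> vanish as \<open>g\<close>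
  tends to 0. What is left bounds the shear at \<open>h\<close> alone.\<close>

lemma S_upper:
  assumes t1: "0 < t1" "2 * t1 < T" and h: "0 < h" "h \<le> 1/2"
  defines "B \<equiv> K * (2 / t1 + 4 + (A + A * (2 / t1 + 4))) * (2 * t1)"
  shows "trace_const p * \<bar>S t1 h\<bar> \<le> B * (2 * h) powr (1 - \<beta>)
     + (2 * A * C * (2 * h) powr (1 - \<beta>) + C * (2 * h) powr (1 - 2 * \<alpha>) * E (2 * h)) * t1"
proof -
  have c0: "trace_const p > 0" unfolding trace_const_def by (rule integral_sgn_qker_pos[OF p(2,3)])
  define e1 :: "real \<times> real \<times> real" where "e1 = (0, 1, 0)"
  define Fc where "Fc q = max (- C) (min C (F q))" for q
  have Fcm[measurable]: "Fc \<in> borel_measurable borel" unfolding Fc_def[abs_def] by measurable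
  have Fc: "AE q in lborel. Fc q = F q" using F_bound by eventually_elim (auto simp: Fc_def abs_le_iff)
  define m where "m = cutoff t1"
  have [measurable]: "m \<in> borel_measurable borel" by (simp add: m_def)
  define P where "P g = (LINT q|lborel. ddir F (1, 0) q * (m (base q) * strip g q))" for g
  define J where "J g = (LINT q|lborel. ddir F e1 q * ((V (base q) * m (base q)) * strip g q))" for g
  \<comment> \<open>The right-hand side of the transport equation evaluated at the top
    \<open>2 * g\<close> of the strip.\<close>
  define R where "R g = 2 * A * C * (2 * g) powr (1 - \<beta>) + C * (2 * g) powr (1 - 2 * \<alpha>) * E (2 * g)" for g
  have R0: "R g \<ge> 0" if "g > 0" for g
    using A C E_nonneg[of "2 * g"] that by (auto simp: R_def intro!: add_nonneg_nonneg mult_nonneg_nonneg)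
  have ddb: "AE q in lborel. q \<in> cbox (t1/2, -3/4, g) (3*t1/2, -1/4, 2*g) \<longrightarrow>
      \<bar>ddir F e1 q\<bar> \<le> C \<and> \<bar>ddir F (1, 0) q + V (base q) * ddir F e1 q + trace_const p * (Fc q * snd (snd q) powr (1 - 2 * \<alpha>) * ddir F e1 q)\<bar> \<le> R g"
    if g: "0 < g" "g \<le> 1/2" for g
    using transport_equation Fc
  proof eventually_elim
    case (elim q)
    show ?case
    proof
      assume qB: "q \<in> cbox (t1/2, -3/4, g) (3*t1/2, -1/4, 2*g)"
      obtain t a s where qq: "q = (t, a, s)" by (metis prod.collapse)
      have s: "g \<le> s" "s \<le> 2 * g" and t: "t \<in> {0<..<T}" using qB t1 by (auto simp: qq cbox_Pair_eq)
      have qH: "q \<in> {0<..<T} \<times> halfplane" using t s g by (simp add: qq halfplane_iff)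
      have s1: "snd (snd q) \<le> 1" using s g by (simp add: qq)
      have "2 * A * C * s powr (1 - \<beta>) + C * s powr (1 - 2 * \<alpha>) * E s \<le> R g"
        unfolding R_def using s g A C E_nonneg[of s] E_mono[of s "2 * g"] \<beta>1 \<alpha>
        by (intro add_mono mult_mono mult_left_mono powr_mono2) auto
      then show "\<bar>ddir F e1 q\<bar> \<le> C \<and> \<bar>ddir F (1, 0) q + V (base q) * ddir F e1 q + trace_const p * (Fc q * snd (snd q) powr (1 - 2 * \<alpha>) * ddir F e1 q)\<bar> \<le> R g"
        using elim(1)[rule_format, OF qH s1] unfolding e1_def elim(2) by (simp add: qq)
    qed
  qed
  have supp: "m s = 0" if "s \<notin> cbox (t1/2, -3/4) (3*t1/2, -1/4)" for s
    using cutoff_support[OF t1(1) that] by (simp add: m_def)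
  have iP: "integrable lborel (\<lambda>q. ddir F v q * (\<mu> (base q) * strip g q))"
    if g: "0 < g" and \<mu>: "\<mu> \<in> borel_measurable borel" "\<And>s. \<bar>\<mu> s\<bar> \<le> b" "\<And>s. s \<notin> cbox (t1/2, -3/4) (3*t1/2, -1/4) \<Longrightarrow> \<mu> s = 0" for g v \<mu> b
  proof (rule diff_quotient_F(1)[OF t1 g, where B="b * (1 / g)"])
    note \<mu>(1)[measurable]
    show "(\<lambda>q. \<mu> (base q) * strip g q) \<in> borel_measurable borel" by measurable
    show "\<bar>\<mu> (base q) * strip g q\<bar> \<le> b * (1 / g)" for q
      unfolding abs_mult using \<mu>(2)[of "base q"] strip_nonneg[OF g, of q] strip_le[OF g, of q]
      by (intro mult_mono) auto
    show "\<mu> (base q) * strip g q = 0" if "q \<notin> cbox (t1/2, -3/4, g) (3*t1/2, -1/4, 2*g)" for q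
      using that strip_support[where \<mu>=\<mu>, OF _ \<mu>(3)] by blast
  qed
  have mb: "\<bar>m s\<bar> \<le> 1" for s using cutoff_bounds[of t1 s] by (simp add: m_def)
  have Vmb: "\<bar>V s * m s\<bar> \<le> A * 1" for s unfolding abs_mult using V_bound[of s] mb[of s] A by (intro mult_mono) auto
  have iP1: "integrable lborel (\<lambda>q. ddir F (1, 0) q * (m (base q) * strip g q))" if "0 < g" for g
    by (rule iP[OF that _ mb supp]) auto
  have iJ: "integrable lborel (\<lambda>q. ddir F e1 q * ((V (base q) * m (base q)) * strip g q))" if "0 < g" for g
    by (rule iP[OF that _ Vmb]) (auto simp: supp)
  have Sg: "S t1 g = (LINT q|lborel. (ddir F e1 q * (Fc q * snd (snd q) powr (1 - 2 * \<alpha>))) * (m (base q) * strip g q))" for g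
    unfolding S_def e1_def Fc_def m_def by (simp add: mult_ac)
  have Sle: "AE q in lborel. q \<in> cbox (t1/2, -3/4, g) (3*t1/2, -1/4, 2*g) \<longrightarrow>
      \<bar>ddir F e1 q * (Fc q * snd (snd q) powr (1 - 2 * \<alpha>))\<bar> \<le> C * (C * (2 * g) powr (1 - 2 * \<alpha>))" if g: "0 < g" "g \<le> 1/2" for g
    using ddb[OF g]
  proof eventually_elim
    case (elim q)
    show ?case
    proof
      assume qB: "q \<in> cbox (t1/2, -3/4, g) (3*t1/2, -1/4, 2*g)"
      then have "snd (snd q) powr (1 - 2 * \<alpha>) \<le> (2 * g) powr (1 - 2 * \<alpha>)"
        using \<alpha> g by (cases q) (auto simp: cbox_Pair_eq intro!: powr_mono2)
      moreover have "\<bar>Fc q\<bar> \<le> C" using C by (auto simp: Fc_def)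
      ultimately show "\<bar>ddir F e1 q * (Fc q * snd (snd q) powr (1 - 2 * \<alpha>))\<bar> \<le> C * (C * (2 * g) powr (1 - 2 * \<alpha>))"
        unfolding abs_mult using elim qB C by (intro mult_mono) auto
    qed
  qed
  have S1: "\<bar>S t1 g\<bar> \<le> C * (C * (2 * g) powr (1 - 2 * \<alpha>)) * t1"
    and iS: "integrable lborel (\<lambda>q. (ddir F e1 q * (Fc q * snd (snd q) powr (1 - 2 * \<alpha>))) * (m (base q) * strip g q))"
    if g: "0 < g" "g \<le> 1/2" for g
    unfolding Sg m_def by (rule integral_cutoff_strip[OF t1(1) g(1) _ _ Sle[OF g]]; use C in simp)+
  have total: "\<bar>P g + J g + trace_const p * S t1 g\<bar> \<le> R g * t1" if g: "0 < g" "g \<le> 1/2" for g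
  proof -
    have "P g + J g + trace_const p * S t1 g = (LINT q|lborel. ddir F (1, 0) q * (m (base q) * strip g q)
        + ddir F e1 q * ((V (base q) * m (base q)) * strip g q)
        + trace_const p * ((ddir F e1 q * (Fc q * snd (snd q) powr (1 - 2 * \<alpha>))) * (m (base q) * strip g q)))"
      unfolding P_def J_def Sg using iP1[OF g(1)] iJ[OF g(1)] iS[OF g] by simp
    also have "\<dots> = (LINT q|lborel. (ddir F (1, 0) q + V (base q) * ddir F e1 q + trace_const p * (Fc q * snd (snd q) powr (1 - 2 * \<alpha>) * ddir F e1 q)) * (m (base q) * strip g q))"
      by (intro Bochner_Integration.integral_cong refl) (simp add: algebra_simps)
    also have "\<bar>\<dots>\<bar> \<le> R g * t1"
      unfolding m_def
    proof (rule integral_cutoff_strip(1)[OF t1(1) g(1) _ R0[OF g(1)]])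
      show "AE q in lborel. q \<in> cbox (t1/2, -3/4, g) (3*t1/2, -1/4, 2*g) \<longrightarrow>
        \<bar>ddir F (1, 0) q + V (base q) * ddir F e1 q + trace_const p * (Fc q * snd (snd q) powr (1 - 2 * \<alpha>) * ddir F e1 q)\<bar> \<le> R g"
        using ddb[OF g] by eventually_elim blast
    qed measurable
    finally show ?thesis .
  qed
  \<comment> \<open>A Lipschitz constant for the cutoff along both the time and the x_1
    direction.\<close>
  define \<Lambda> where "\<Lambda> = 2 / t1 + 4"
  have \<Lambda>: "\<Lambda> \<ge> 0" using t1 by (simp add: \<Lambda>_def)
  have cmpP: "\<bar>P h - P g\<bar> \<le> K * (2 * h) powr (1 - \<beta>) * \<Lambda> * (2 * t1)" if g: "0 < g" "g \<le> h" for g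
    unfolding P_def
  proof (rule strip_compare[OF t1 g _ mb supp _ \<Lambda>])
    show "AE q in lborel. \<bar>m (base q - k *\<^sub>R base (1, 0)) - m (base q)\<bar> \<le> \<Lambda> * \<bar>k\<bar>" for k
    proof (intro always_eventually allI)
      fix q :: "real \<times> real \<times> real"
      have "\<bar>m (base q - k *\<^sub>R base (1, 0)) - m (base q)\<bar> \<le> 2 / t1 * \<bar>k\<bar>"
        unfolding m_def using cutoff_lipschitz[OF t1(1), of "base q" k "base (1, 0)"] by (simp add: base_def)
      also have "\<dots> \<le> \<Lambda> * \<bar>k\<bar>" by (intro mult_right_mono) (auto simp: \<Lambda>_def)
      finally show "\<bar>m (base q - k *\<^sub>R base (1, 0)) - m (base q)\<bar> \<le> \<Lambda> * \<bar>k\<bar>" .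
    qed
  qed auto
  have cmpJ: "\<bar>J h - J g\<bar> \<le> K * (2 * h) powr (1 - \<beta>) * (A + A * \<Lambda>) * (2 * t1)" if g: "0 < g" "g \<le> h" for g
    unfolding J_def
  proof (rule strip_compare[OF t1 g _ Vmb])
    show "V s * m s = 0" if "s \<notin> cbox (t1/2, -3/4) (3*t1/2, -1/4)" for s by (simp add: supp[OF that])
    \<comment> \<open>Only the x_1 shift is taken, along which the boundary velocity is Lipschitz at
      almost every time; the product rule gives \<open>A + A * \<Lambda>\<close>.\<close>
    show "AE q in lborel. \<bar>V (base q - k *\<^sub>R base e1) * m (base q - k *\<^sub>R base e1) - V (base q) * m (base q)\<bar> \<le> (A + A * \<Lambda>) * \<bar>k\<bar>" for k
      using AE_slices
    proof eventually_elim
      case (elim q)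
      obtain t a s where qq: "q = (t, a, s)" by (metis prod.collapse)
      have bq: "base q = (t, a)" "base q - k *\<^sub>R base e1 = (t, a - k)" by (simp_all add: qq base_def e1_def)
      show ?case
      proof (cases "t \<in> {0<..<T}")
        case True
        have sb: "slice_bound C \<beta> (\<theta> t)" using elim True by (simp add: qq)
        have cont: "continuous_on halfplane (\<theta> t)" using True by (intro classical_solution_continuous(2)[OF sol]) auto
        have "\<bar>U t (a + (- k)) - U t a\<bar> \<le> A * \<bar>- k\<bar>"
          unfolding U_def A_def p_def by (rule slice_velocity(1)[OF \<alpha> sb C cont \<beta>(1) \<beta>1])
        then have V: "\<bar>V (t, a - k) - V (t, a)\<bar> \<le> A * \<bar>k\<bar>" by (simp add: V_eq[OF True sb])
        have "\<bar>V (t, a - k) * m (t, a - k) - V (t, a) * m (t, a)\<bar>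
          = \<bar>(V (t, a - k) - V (t, a)) * m (t, a - k) + V (t, a) * (m (t, a - k) - m (t, a))\<bar>" by (simp add: algebra_simps)
        also have "\<dots> \<le> \<bar>V (t, a - k) - V (t, a)\<bar> * \<bar>m (t, a - k)\<bar> + \<bar>V (t, a)\<bar> * \<bar>m (t, a - k) - m (t, a)\<bar>"
          by (metis abs_mult abs_triangle_ineq)
        also have "\<dots> \<le> (A * \<bar>k\<bar>) * 1 + A * (\<Lambda> * \<bar>k\<bar>)"
        proof (intro add_mono mult_mono V mb V_bound)
          have "\<bar>m (t, a - k) - m (t, a)\<bar> \<le> 4 * \<bar>k\<bar>"
            unfolding m_def using cutoff_lipschitz[OF t1(1), of "(t, a)" k "(0, 1)"] by simp
          also have "\<dots> \<le> \<Lambda> * \<bar>k\<bar>" using t1 by (intro mult_right_mono) (auto simp: \<Lambda>_def)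
          finally show "\<bar>m (t, a - k) - m (t, a)\<bar> \<le> \<Lambda> * \<bar>k\<bar>" .
        qed (use A in auto)
        finally show ?thesis unfolding bq(2) unfolding bq(1) by (simp add: algebra_simps)
      next
        case False
        then have "m (t, a - k) = 0" "m (t, a) = 0" using t1 by (auto intro!: supp simp: cbox_Pair_eq)
        then show ?thesis unfolding bq(2) unfolding bq(1) using A \<Lambda> by simp
      qed
    qed
    show "A + A * \<Lambda> \<ge> 0" using A \<Lambda> by simp
    show "(\<lambda>s. V s * m s) \<in> borel_measurable borel" by measurable
  qed (auto simp: e1_def)
  have step: "trace_const p * \<bar>S t1 h\<bar> - B * (2 * h) powr (1 - \<beta>) - R h * t1 \<le>
      trace_const p * (C * (C * (2 * g) powr (1 - 2 * \<alpha>)) * t1) + R g * t1" if g: "0 < g" "g \<le> h" for g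
  proof -
    have g2: "g \<le> 1/2" using g h by simp
    have B: "B * (2 * h) powr (1 - \<beta>) = K * (2 * h) powr (1 - \<beta>) * \<Lambda> * (2 * t1) + K * (2 * h) powr (1 - \<beta>) * (A + A * \<Lambda>) * (2 * t1)"
      unfolding B_def \<Lambda>_def by (simp add: algebra_simps)
    have "\<bar>trace_const p * S t1 g\<bar> \<le> trace_const p * (C * (C * (2 * g) powr (1 - 2 * \<alpha>)) * t1)"
      unfolding abs_mult using S1[OF g(1) g2] c0 by (simp add: mult_left_mono)
    moreover have "\<bar>trace_const p * S t1 h\<bar> = trace_const p * \<bar>S t1 h\<bar>" using c0 by (simp add: abs_mult)
    ultimately show ?thesis
      using total[OF h] total[OF g(1) g2] cmpP[OF g] cmpJ[OF g] unfolding B by linarith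
  qed
  have lim: "((\<lambda>g. trace_const p * (C * (C * (2 * g) powr (1 - 2 * \<alpha>)) * t1) + R g * t1) \<longlongrightarrow>
     trace_const p * (C * (C * 0) * t1) + (2 * A * C * 0 + C * 0 * 0) * t1) (at_right 0)"
  proof -
    have "filterlim (\<lambda>g. 2 * g) (at_right (0::real)) (at_right 0)"
      by (rule filterlim_times_pos[of "\<lambda>g. g" 0 _ 2]) (auto simp: filterlim_ident)
    from filterlim_compose[OF E_tendsto this]
    show ?thesis unfolding R_def using \<alpha> \<beta>1 by (intro tendsto_intros tendsto_powr_0_at_right) auto
  qed
  have "eventually (\<lambda>g. trace_const p * \<bar>S t1 h\<bar> - B * (2 * h) powr (1 - \<beta>) - R h * t1 \<le>
      trace_const p * (C * (C * (2 * g) powr (1 - 2 * \<alpha>)) * t1) + R g * t1) (at_right 0)"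
    unfolding eventually_at_right_field using step h by (intro exI[of _ h]) auto
  from tendsto_lowerbound[OF lim this] show ?thesis by (simp add: R_def)
qed

end

section \<open>Part (a)\<close>

lemma tent2_0_vertical: "\<bar>tent2 0 (a, s) - tent2 0 (a, s')\<bar> \<le> \<bar>s - s'\<bar>"
proof -
  have "\<bar>tent2 0 (a, s) - tent2 0 (a, s')\<bar> = \<bar>tent a\<bar> * \<bar>tent s - tent s'\<bar>"
    by (simp add: tent2_def right_diff_distrib[symmetric] abs_mult)
  also have "\<dots> \<le> 1 * \<bar>s - s'\<bar>" using tent_lipschitz[of s s'] by (intro mult_mono) auto
  finally show ?thesis by simp
qed

context boundary_shear
begin

text \<open>Continuity in time is not uniform up to the boundary, so the comparison passes through
  the fixed height \<open>h0\<close>: Hoelder continuity leads there, uniform continuity on a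
  compact segment goes back to time 0, and the datum is Lipschitz in height.\<close>

lemma initial_closeness:
  assumes \<epsilon>: "\<epsilon> > 0"
  shows "\<exists>h0>0. \<exists>t0>0. h0 \<le> 1/2 \<and> (\<forall>t. 0 < t \<longrightarrow> t < t0 \<longrightarrow> t < T \<longrightarrow> slice_bound C \<beta> (\<theta> t) \<longrightarrow>
    (\<forall>a s. -1 \<le> a \<longrightarrow> a \<le> 0 \<longrightarrow> 0 < s \<longrightarrow> s \<le> h0 \<longrightarrow> \<bar>\<theta> t (a, s) - tent2 0 (a, s)\<bar> \<le> \<epsilon>))"
proof -
  have "((\<lambda>h. K * (2 * h) powr (1 - \<beta>)) \<longlongrightarrow> K * 0) (at_right 0)"
    using \<beta>1 by (intro tendsto_mult tendsto_const tendsto_powr_0_at_right) auto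
  then have "eventually (\<lambda>h. K * (2 * h) powr (1 - \<beta>) < \<epsilon> / 3) (at_right 0)"
    using \<epsilon> by (intro order_tendstoD(2)[of _ "K * 0"]) auto
  moreover have "eventually (\<lambda>h. h < min (1/2) (\<epsilon> / 3)) (at_right (0::real))"
    using \<epsilon> by (intro eventually_at_right_real[of 0 "min (1/2) (\<epsilon>/3)", THEN eventually_mono]) auto
  ultimately have "eventually (\<lambda>h. K * (2 * h) powr (1 - \<beta>) < \<epsilon> / 3 \<and> h < min (1/2) (\<epsilon> / 3) \<and> 0 < h) (at_right 0)"
    using eventually_at_right_less[of 0] by eventually_elim auto
  then obtain h0 where h0: "K * (2 * h0) powr (1 - \<beta>) < \<epsilon> / 3" "h0 < min (1/2) (\<epsilon> / 3)" "h0 > 0"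
    using eventually_happens'[OF trivial_limit_at_right_real] by blast
  define X where "X = {0..T} \<times> ({-1..0::real} \<times> {h0})"
  have X: "compact X" "X \<subseteq> {0..T} \<times> halfplane"
    using h0 by (auto simp: X_def halfplane_iff intro!: compact_Times)
  have uc: "uniformly_continuous_on X (\<lambda>(t, x). \<theta> t x)"
    by (rule compact_uniformly_continuous[OF continuous_on_subset[OF classical_solution_continuous(1)[OF sol] X(2)] X(1)])
  have \<epsilon>3: "\<epsilon> / 3 > 0" using \<epsilon> by simp
  have "\<exists>d>0. \<forall>x\<in>X. \<forall>y\<in>X. dist y x < d \<longrightarrow> dist ((\<lambda>(t, x). \<theta> t x) y) ((\<lambda>(t, x). \<theta> t x) x) < \<epsilon> / 3"
    using uc[unfolded uniformly_continuous_on_def, THEN spec, of "\<epsilon> / 3"] \<epsilon>3 by (rule mp)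
  then obtain d where d0: "d > 0" and d: "\<forall>x\<in>X. \<forall>y\<in>X. dist y x < d \<longrightarrow> dist ((\<lambda>(t, x). \<theta> t x) y) ((\<lambda>(t, x). \<theta> t x) x) < \<epsilon> / 3"
    by blast
  show ?thesis
  proof (rule exI[of _ h0], rule conjI[OF h0(3)], rule exI[of _ d], intro conjI allI impI)
    fix t a s :: real assume t: "0 < t" "t < d" "t < T" and sb: "slice_bound C \<beta> (\<theta> t)" and a: "-1 \<le> a" "a \<le> 0" and s: "0 < s" "s \<le> h0"
    have "\<bar>F (t, a, s) - F (t, a, h0)\<bar> \<le> K * (max s h0) powr (1 - \<beta>)"
      using t s h0 by (intro F_vertical sb) auto
    also have "\<dots> \<le> K * (2 * h0) powr (1 - \<beta>)" using s h0 K \<beta>1 by (intro mult_left_mono powr_mono2) auto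
    finally have 1: "\<bar>\<theta> t (a, s) - \<theta> t (a, h0)\<bar> < \<epsilon> / 3" using h0 t s by (simp add: F_eq)
    have "dist ((\<lambda>(t, x). \<theta> t x) (t, a, h0)) ((\<lambda>(t, x). \<theta> t x) (0, a, h0)) < \<epsilon> / 3"
      by (rule d[rule_format]) (use t a T in \<open>auto simp: X_def dist_Pair_Pair dist_real_def\<close>)
    then have 2: "\<bar>\<theta> t (a, h0) - tent2 0 (a, h0)\<bar> < \<epsilon> / 3"
      using init[of "(a, h0)"] h0 by (simp add: dist_real_def halfplane_iff)
    have 3: "\<bar>tent2 0 (a, h0) - tent2 0 (a, s)\<bar> < \<epsilon> / 3"
      using tent2_0_vertical[of a h0 s] s h0 by linarith
    show "\<bar>\<theta> t (a, s) - tent2 0 (a, s)\<bar> \<le> \<epsilon>" using 1 2 3 by linarith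
  qed (use h0 d0 in auto)
qed

text \<open>The integrand is half of the x_1 derivative of \<open>F\<close>^2 against a weight.
  Replacing \<open>F\<close>^2 by \<open>F0\<close>^2 costs only the sup norm of their difference
  once the derivative is moved to the cutoff, and the main term, with the explicit datum, is
  positive.\<close>

lemma S_lower:
  assumes t1: "0 < t1" "2 * t1 < T" and h: "0 < h" "3 * h \<le> 1/2"
    and close: "\<And>t a s. 0 < t \<Longrightarrow> t < 2 * t1 \<Longrightarrow> slice_bound C \<beta> (\<theta> t) \<Longrightarrow> -1 \<le> a \<Longrightarrow> a \<le> 0 \<Longrightarrow> 0 < s \<Longrightarrow> s \<le> 2 * h \<Longrightarrow>
       \<bar>\<theta> t (a, s) - tent2 0 (a, s)\<bar> \<le> 1 / (4096 * (C + 1))"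
  shows "S t1 h \<ge> t1 / 1024 * h powr (1 - 2 * \<alpha>)"
proof -
  define \<kappa> where "\<kappa> = 1 - 2 * \<alpha>"
  have \<kappa>: "0 < \<kappa>" "\<kappa> < 1" using \<alpha> by (auto simp: \<kappa>_def)
  define e1 :: "real \<times> real \<times> real" where "e1 = (0, 1, 0)"
  define F0 :: "real \<times> real \<times> real \<Rightarrow> real" where "F0 q = tent2 0 (snd q)" for q
  \<comment> \<open>Both factors of the difference of squares are bounded, by 1/(4096 (C+1)) and by
    C + 1, so \<open>\<bar>W\<bar> \<le> 1/4096\<close>.\<close>
  define W where "W q = (F q)\<^sup>2 - (F0 q)\<^sup>2" for q
  have [measurable]: "tent2 0 \<in> borel_measurable borel"
    by (intro borel_measurable_continuous_onI lipschitz_on_continuous_on[OF tent2_lipschitz])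
  have F0m[measurable]: "F0 \<in> borel_measurable borel" unfolding F0_def[abs_def] by measurable
  have Wm[measurable]: "W \<in> borel_measurable borel" unfolding W_def[abs_def] by measurable
  define \<phi> where "\<phi> q = snd (snd q) powr \<kappa> * (cutoff t1 (base q) * strip h q)" for q
  have \<phi>m[measurable]: "\<phi> \<in> borel_measurable borel" unfolding \<phi>_def[abs_def] by measurable
  have sp: "0 \<le> snd (snd q) powr \<kappa> * strip h q" "snd (snd q) powr \<kappa> * strip h q \<le> (2 * h) powr \<kappa> * (1 / h)" for q
  proof -
    show "0 \<le> snd (snd q) powr \<kappa> * strip h q" using strip_nonneg[OF h(1), of q] by simp
    have "snd (snd q) powr \<kappa> * strip h q \<le> (2 * h) powr \<kappa> * strip h q" by (rule strip_powr_le) (use h \<kappa> in auto)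
    also have "\<dots> \<le> (2 * h) powr \<kappa> * (1 / h)" using strip_le[OF h(1), of q] by (intro mult_left_mono) auto
    finally show "snd (snd q) powr \<kappa> * strip h q \<le> (2 * h) powr \<kappa> * (1 / h)" .
  qed
  have \<phi>eq: "\<phi> q = cutoff t1 (base q) * (snd (snd q) powr \<kappa> * strip h q)" for q by (simp add: \<phi>_def)
  have \<phi>B: "\<bar>\<phi> q\<bar> \<le> 1 * ((2 * h) powr \<kappa> * (1 / h))" for q
  proof -
    have 1: "\<bar>cutoff t1 (base q)\<bar> \<le> 1" using cutoff_bounds[of t1 "base q"] by simp
    have 2: "\<bar>snd (snd q) powr \<kappa> * strip h q\<bar> \<le> (2 * h) powr \<kappa> * (1 / h)"
      unfolding abs_of_nonneg[OF sp(1)] by (rule sp(2))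
    show ?thesis unfolding \<phi>eq abs_mult[of "cutoff t1 (base q)"]
      by (rule mult_mono[OF 1 2]) auto
  qed
  let ?X = "cbox (t1/4, -1, h/2) (2*t1, 0, 3*h) :: (real \<times> real \<times> real) set"
  let ?S = "box (t1/4, -1, h/2) (2*t1, 0, 3*h) :: (real \<times> real \<times> real) set"
  let ?K = "cbox (t1/2, -3/4, h) (3*t1/2, -1/4, 2*h) :: (real \<times> real \<times> real) set"
  have cs0: "cutoff t1 (base q) * strip h q = 0" if "q \<notin> ?K" for q
    using that strip_support[where \<mu>="cutoff t1", OF _ cutoff_support[OF t1(1)]] by blast
  have \<phi>supp: "\<phi> q = 0" if "q \<notin> ?K" for q
    unfolding \<phi>_def cs0[OF that] by simp
  have X: "?X \<subseteq> {0<..<T} \<times> halfplane" using t1 h by (auto simp: cbox_Pair_eq halfplane_iff)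
  have SX: "?S \<subseteq> ?X" by (rule box_subset_cbox)
  have KS: "?K \<subseteq> ?S" using t1 h by (auto simp: mem_box Basis_prod_def zero_prod_def)
  obtain L where L: "L-lipschitz_on ?X F" using F_lipschitz[OF X compact_cbox] by blast
  have "bounded (F ` ?X)"
    using compact_imp_bounded[OF compact_continuous_image[OF lipschitz_on_continuous_on[OF L] compact_cbox]] .
  then obtain M where M: "\<forall>q\<in>?X. \<bar>F q\<bar> \<le> M" by (auto simp: bounded_iff)
  have "L-lipschitz_on ?S F" by (rule lipschitz_on_subset[OF L SX])
  from lipschitz_on_power2[OF this, of "\<bar>M\<bar>"] have L1: "(2 * \<bar>M\<bar> * L)-lipschitz_on ?S (\<lambda>q. (F q)\<^sup>2)"
    using M SX by force
  have "2-lipschitz_on ?S F0"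
  proof (rule lipschitz_onI)
    fix x y :: "real \<times> real \<times> real"
    have "dist (F0 x) (F0 y) \<le> 2 * dist (snd x) (snd y)" unfolding F0_def by (rule lipschitz_onD[OF tent2_lipschitz]) auto
    also have "\<dots> \<le> 2 * dist x y" using dist_snd_le[of x y] by simp
    finally show "dist (F0 x) (F0 y) \<le> 2 * dist x y" .
  qed simp
  from lipschitz_on_power2[OF this, of 1] have L2: "(2 * 1 * 2)-lipschitz_on ?S (\<lambda>q. (F0 q)\<^sup>2)"
    using tent2_bounds by (simp add: F0_def)
  have LW: "(2 * \<bar>M\<bar> * L + 2 * 1 * 2)-lipschitz_on ?S W" unfolding W_def[abs_def] by (rule lipschitz_on_diff[OF L1 L2])
  have F0K: "F0 q = (1 + fst (snd q)) * (1 - snd (snd q))"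
    "(F0 has_derivative (\<lambda>v. fst (snd v) * (1 - snd (snd q)) - (1 + fst (snd q)) * snd (snd v))) (at q)"
    if q: "q \<in> ?S" for q
  proof -
    have eq: "F0 x = (1 + fst (snd x)) * (1 - snd (snd x))" if "x \<in> ?S" for x
    proof -
      have "-1 < fst (snd x)" "fst (snd x) < 0" "h / 2 < snd (snd x)" "snd (snd x) < 3 * h"
        using that by (auto simp: mem_box Basis_prod_def zero_prod_def inner_prod_def)
      then have "tent (fst (snd x)) = 1 + fst (snd x)" "tent (snd (snd x)) = 1 - snd (snd x)"
        using h by (auto simp: tent_def)
      then show ?thesis by (simp add: F0_def tent2_def)
    qed
    show "F0 q = (1 + fst (snd q)) * (1 - snd (snd q))" by (rule eq[OF q])
    have "((\<lambda>x. (1 + fst (snd x)) * (1 - snd (snd x))) has_derivative (\<lambda>v. fst (snd v) * (1 - snd (snd q)) - (1 + fst (snd q)) * snd (snd v))) (at q)"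
      by (auto intro!: derivative_eq_intros)
    from has_derivative_transform_within_open[OF this open_box q eq[symmetric]]
    show "(F0 has_derivative (\<lambda>v. fst (snd v) * (1 - snd (snd q)) - (1 + fst (snd q)) * snd (snd v))) (at q)" .
  qed
  have Wd: "AE q in lborel. q \<in> ?K \<longrightarrow> (\<exists>D. (W has_derivative D) (at q)) \<and>
      ddir W e1 q = 2 * (F q * ddir F e1 q) - 2 * (F0 q * (1 - snd (snd q)))"
    using F_has_derivative
  proof eventually_elim
    case (elim q)
    show ?case
    proof
      assume "q \<in> ?K"
      then have q: "q \<in> ?S" "q \<in> {0<..<T} \<times> halfplane" using KS SX X by blast+
      then obtain D where D: "(F has_derivative D) (at q)" using elim by blast
      have "(W has_derivative (\<lambda>v. 2 * (F q * D v) - 2 * (F0 q * (fst (snd v) * (1 - snd (snd q)) - (1 + fst (snd q)) * snd (snd v))))) (at q)"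
        unfolding W_def[abs_def] power2_eq_square
        by (rule derivative_eq_intros D F0K(2)[OF q(1)] refl)+ (simp add: fun_eq_iff algebra_simps)
      from this ddir_eq[OF this, of e1] ddir_eq[OF D, of e1]
      show "(\<exists>D. (W has_derivative D) (at q)) \<and> ddir W e1 q = 2 * (F q * ddir F e1 q) - 2 * (F0 q * (1 - snd (snd q)))"
        by (auto simp: e1_def)
    qed
  qed
  have Wdiff: "AE q in lborel. q \<in> ?K \<longrightarrow> (\<exists>D. (W has_derivative D) (at q))"
    using Wd by eventually_elim blast
  have DQ: "integrable lborel (\<lambda>q. ddir W e1 q * \<phi> q)"
    "((\<lambda>k. LINT q|lborel. W q * ((\<phi> (q - k *\<^sub>R e1) - \<phi> q) / k)) \<longlongrightarrow> (LINT q|lborel. ddir W e1 q * \<phi> q)) (at 0)"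
    by (rule integral_diff_quotient_tendsto[OF Wm LW open_box \<phi>m \<phi>B compact_cbox KS _ Wdiff]; rule \<phi>supp; assumption)+
  \<comment> \<open>The bound on \<open>W\<close> times the Lipschitz constant 4 of the cutoff in
    x_1 times the bound on the remaining factors of \<phi>; multiplied by the volume t1 h it gives
    (2 h)^\<kappa> t1 / 1024.\<close>
  define c where "c = 1 / 4096 * (4 * ((2 * h) powr \<kappa> * (1 / h)))"
  have c: "c \<ge> 0" using h by (simp add: c_def)
  have bound: "\<bar>LINT q|lborel. W q * ((\<phi> (q - k *\<^sub>R e1) - \<phi> q) / k)\<bar> \<le> 1 / 1024 * (2 * h) powr \<kappa> * t1"
    if k: "k \<noteq> 0" "\<bar>k\<bar> < 1/4" for k
  proof -
    have dphi: "\<phi> (q - k *\<^sub>R e1) - \<phi> q = (cutoff t1 (base q - k *\<^sub>R (0, 1)) - cutoff t1 (base q)) * (snd (snd q) powr \<kappa> * strip h q)" for q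
      by (simp add: \<phi>eq base_diff strip_def e1_def base_def left_diff_distrib diff_divide_distrib)
    have "AE q in lborel. \<bar>W q * ((\<phi> (q - k *\<^sub>R e1) - \<phi> q) / k)\<bar> \<le> c * indicator (cbox (t1/2, -1, h) (3*t1/2, 0, 2*h)) q"
      using AE_slices
    proof eventually_elim
      case (elim q)
      obtain t a s where qq: "q = (t, a, s)" by (metis prod.collapse)
      show ?case
      proof (cases "(\<phi> (q - k *\<^sub>R e1) - \<phi> q) = 0")
        case True
        then show ?thesis using c by simp
      next
        case False
        then have s: "h \<le> s" "s \<le> 2 * h" and "cutoff t1 (t, a - k) \<noteq> 0 \<or> cutoff t1 (t, a) \<noteq> 0"
          unfolding dphi by (auto simp: qq base_def strip_def indicator_def split: if_splits)
        then have "(t, a - k) \<in> cbox (t1/2, -3/4) (3*t1/2, -1/4) \<or> (t, a) \<in> cbox (t1/2, -3/4) (3*t1/2, -1/4)"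
          using cutoff_support[OF t1(1)] by blast
        then have t: "t1/2 \<le> t" "t \<le> 3*t1/2" and a: "-1 \<le> a" "a \<le> 0" using k by (auto simp: cbox_Pair_eq abs_less_iff)
        have tT: "t \<in> {0<..<T}" "t < 2 * t1" using t t1 by auto
        have sb: "slice_bound C \<beta> (\<theta> t)" using elim tT by (simp add: qq)
        have s0: "s > 0" using s h by simp
        have "\<bar>F q - F0 q\<bar> \<le> 1 / (4096 * (C + 1))"
          using close[of t a s] tT sb a s s0 by (simp add: qq F_eq F0_def)
        moreover have "\<bar>F q + F0 q\<bar> \<le> C + 1"
        proof -
          have "\<bar>F q\<bar> \<le> C" using sb tT s0 by (simp add: qq F_eq slice_bound_def halfplane_iff)
          moreover have "\<bar>F0 q\<bar> \<le> 1" unfolding F0_def by (rule tent2_bounds)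
          ultimately show ?thesis by linarith
        qed
        ultimately have "\<bar>F q - F0 q\<bar> * \<bar>F q + F0 q\<bar> \<le> 1 / (4096 * (C + 1)) * (C + 1)"
          using C by (intro mult_mono) auto
        moreover have "1 / (4096 * (C + 1)) * (C + 1) = 1 / 4096" using C by (simp add: divide_simps)
        moreover have "\<bar>W q\<bar> = \<bar>F q - F0 q\<bar> * \<bar>F q + F0 q\<bar>"
          by (simp add: W_def abs_mult[symmetric] power2_eq_square algebra_simps)
        ultimately have Wb: "\<bar>W q\<bar> \<le> 1 / 4096" by linarith
        have "\<bar>cutoff t1 (base q - k *\<^sub>R (0, 1)) - cutoff t1 (base q)\<bar> \<le> 4 * \<bar>k\<bar>"
          using cutoff_lipschitz[OF t1(1), of "base q" k "(0, 1)"] by simp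
        then have "\<bar>\<phi> (q - k *\<^sub>R e1) - \<phi> q\<bar> \<le> (4 * \<bar>k\<bar>) * ((2 * h) powr \<kappa> * (1 / h))"
          unfolding dphi abs_mult[of "_ - _"] using sp[of q] by (intro mult_mono) auto
        then have "\<bar>(\<phi> (q - k *\<^sub>R e1) - \<phi> q) / k\<bar> \<le> 4 * ((2 * h) powr \<kappa> * (1 / h))"
          using k by (simp add: abs_div divide_le_eq mult_ac)
        then have "\<bar>W q\<bar> * \<bar>(\<phi> (q - k *\<^sub>R e1) - \<phi> q) / k\<bar> \<le> c"
          unfolding c_def using Wb by (intro mult_mono) auto
        moreover have "q \<in> cbox (t1/2, -1, h) (3*t1/2, 0, 2*h)" using t a s by (simp add: qq cbox_Pair_eq)
        ultimately show ?thesis by (simp add: abs_mult)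
      qed
    qed
    moreover have "(\<lambda>q. W q * ((\<phi> (q - k *\<^sub>R e1) - \<phi> q) / k)) \<in> borel_measurable borel"
    proof -
      have "(\<lambda>q. q - k *\<^sub>R e1) \<in> borel_measurable borel" by measurable
      note measurable_compose[OF this \<phi>m, measurable]
      show ?thesis by measurable
    qed
    ultimately have "\<bar>LINT q|lborel. W q * ((\<phi> (q - k *\<^sub>R e1) - \<phi> q) / k)\<bar> \<le> c * measure lborel (cbox (t1/2, -1, h) (3*t1/2, 0, 2*h) :: (real \<times> real \<times> real) set)"
      using c by (intro integral_abs_le_box(2))
    also have "measure lborel (cbox (t1/2, -1, h) (3*t1/2, 0, 2*h) :: (real \<times> real \<times> real) set) = t1 * h"
      using t1 h by (subst content_cbox3) auto
    also have "c * (t1 * h) = 1 / 1024 * (2 * h) powr \<kappa> * t1" using h by (simp add: c_def)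
    finally show ?thesis .
  qed
  have I1: "\<bar>LINT q|lborel. ddir W e1 q * \<phi> q\<bar> \<le> 1 / 1024 * (2 * h) powr \<kappa> * t1"
  proof (rule tendsto_upperbound[OF tendsto_rabs[OF DQ(2)]])
    show "eventually (\<lambda>k. \<bar>LINT q|lborel. W q * ((\<phi> (q - k *\<^sub>R e1) - \<phi> q) / k)\<bar> \<le> 1 / 1024 * (2 * h) powr \<kappa> * t1) (at 0)"
      unfolding eventually_at using bound by (intro exI[of _ "1/4"]) (auto simp: dist_real_def)
  qed simp
  have "(2 * h) powr \<kappa> = 2 powr \<kappa> * h powr \<kappa>" using h by (simp add: powr_mult)
  also have "\<dots> \<le> 2 * h powr \<kappa>" using \<kappa> powr_mono[of \<kappa> 1 "2::real"] by (intro mult_right_mono) auto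
  finally have "1 / 1024 * (2 * h) powr \<kappa> * t1 \<le> 1 / 1024 * (2 * h powr \<kappa>) * t1"
    using t1 by (intro mult_right_mono mult_left_mono) auto
  from order_trans[OF I1 this] have I1': "\<bar>LINT q|lborel. ddir W e1 q * \<phi> q\<bar> \<le> 1 / 512 * (h powr \<kappa> * t1)"
    by simp
  \<comment> \<open>This is \<open>F0\<close> times its x_1 derivative times the height power. On
    the support, 1 + a is at least 1/4 and (1 - s)^2 at least 1/4, hence the constant 1/16.\<close>
  define g where "g q = F0 q * (1 - snd (snd q)) * snd (snd q) powr \<kappa>" for q
  have gm[measurable]: "g \<in> borel_measurable borel" unfolding g_def[abs_def] by measurable
  have gK: "1 / 16 * h powr \<kappa> \<le> g q \<and> g q \<le> 1" if qK: "q \<in> ?K" for q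
  proof -
    obtain t a s where qq: "q = (t, a, s)" by (metis prod.collapse)
    have q: "-3/4 \<le> a" "a \<le> -1/4" "h \<le> s" "s \<le> 2 * h" using qK by (auto simp: qq cbox_Pair_eq)
    have F0q: "F0 q = (1 + a) * (1 - s)" using F0K(1)[OF subsetD[OF KS qK]] by (simp add: qq)
    have s: "0 \<le> s" "s \<le> 1/2" using q h by auto
    have "1/4 * (1/2) * (1/2) * h powr \<kappa> \<le> (1 + a) * (1 - s) * (1 - s) * s powr \<kappa>"
      using q s h \<kappa> by (intro mult_mono powr_mono2) auto
    moreover have "(1 + a) * (1 - s) * (1 - s) * s powr \<kappa> \<le> 1 * 1 * 1 * 1"
      using q s h \<kappa> by (intro mult_mono powr_le1) auto
    ultimately show ?thesis by (simp add: g_def F0q) (simp add: qq)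
  qed
  have i2: "integrable lborel (\<lambda>q. g q * (cutoff t1 (base q) * strip h q))"
  proof (rule integral_cutoff_strip(2)[OF t1(1) h(1) gm zero_le_one], intro always_eventually allI impI)
    fix q assume "q \<in> ?K"
    from gK[OF this] show "\<bar>g q\<bar> \<le> 1" using powr_ge_zero[of h \<kappa>] by linarith
  qed
  have Seq: "S t1 h = (LINT q|lborel. 1/2 * (ddir W e1 q * \<phi> q) + g q * (cutoff t1 (base q) * strip h q))"
    unfolding S_def e1_def[symmetric] \<kappa>_def[symmetric]
  proof (rule integral_cong_AE)
    show "AE q in lborel. ddir F e1 q * (max (- C) (min C (F q)) * snd (snd q) powr \<kappa> * (cutoff t1 (base q) * strip h q)) =
        1/2 * (ddir W e1 q * \<phi> q) + g q * (cutoff t1 (base q) * strip h q)"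
      using Wd F_bound
    proof eventually_elim
      case (elim q)
      show ?case
      proof (cases "q \<in> ?K")
        case True
        have m: "max (- C) (min C (F q)) = F q" using elim(2) by (auto simp: abs_le_iff)
        have w: "ddir W e1 q = 2 * (F q * ddir F e1 q) - 2 * (F0 q * (1 - snd (snd q)))"
          using elim(1) True by blast
        show ?thesis unfolding m w \<phi>_def g_def by (simp add: algebra_simps)
      next
        case False
        show ?thesis unfolding cs0[OF False] \<phi>supp[OF False] by simp
      qed
    qed
  qed measurable
  have S2: "S t1 h = 1/2 * (LINT q|lborel. ddir W e1 q * \<phi> q) + (LINT q|lborel. g q * (cutoff t1 (base q) * strip h q))"
    unfolding Seq using DQ(1) i2 by simp
  \<comment> \<open>On this smaller box each tent of the cutoff is at least 1/2.\<close>
  let ?B = "cbox (3*t1/4, -5/8, h) (5*t1/4, -3/8, 2*h) :: (real \<times> real \<times> real) set"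
  define b where "b = 1/16 * h powr \<kappa> * (1/4 * (1 / h))"
  have "b * measure lborel ?B = (LINT q|lborel. b * indicator ?B q)" by simp
  also have "\<dots> \<le> (LINT q|lborel. g q * (cutoff t1 (base q) * strip h q))"
  proof (rule integral_mono[OF _ i2])
    show "integrable lborel (\<lambda>q. b * indicator ?B q)"
      by (intro integrable_mult_right integrable_real_indicator[OF _ emeasure_lborel_cbox_finite]) auto
    fix q :: "real \<times> real \<times> real"
    obtain t a s where qq: "q = (t, a, s)" by (metis prod.collapse)
    show "b * indicator ?B q \<le> g q * (cutoff t1 (base q) * strip h q)"
    proof (cases "q \<in> ?B")
      case True
      then have q: "3*t1/4 \<le> t" "t \<le> 5*t1/4" "-5/8 \<le> a" "a \<le> -3/8" "h \<le> s" "s \<le> 2*h" by (auto simp: qq cbox_Pair_eq)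
      have "\<bar>t - t1\<bar> \<le> t1/4" using q by linarith
      then have "2 * \<bar>t - t1\<bar> / t1 \<le> 1/2" using t1 by (simp add: divide_le_eq)
      moreover have "\<bar>2 * (t - t1) / t1\<bar> = 2 * \<bar>t - t1\<bar> / t1"
        unfolding abs_divide abs_mult using t1 by simp
      ultimately have "\<bar>2 * (t - t1) / t1\<bar> \<le> 1/2" by simp
      moreover have "\<bar>4 * (a + 1/2)\<bar> \<le> 1/2"
      proof (rule abs_leI)
        show "4 * (a + 1/2) \<le> 1/2" using q(4) by (simp add: field_simps)
        show "- (4 * (a + 1/2)) \<le> 1/2" using q(3) by (simp add: field_simps)
      qed
      ultimately have "1/2 * (1/2) \<le> cutoff t1 (base q)"
        unfolding cutoff_def by (intro mult_mono) (auto simp: qq base_def tent_def)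
      then have "1/4 * (1/h) \<le> cutoff t1 (base q) * (1/h)" using h by (intro mult_right_mono) auto
      moreover have "strip h q = 1 / h" using q by (simp add: qq strip_def)
      ultimately have "1/4 * (1/h) \<le> cutoff t1 (base q) * strip h q" by simp
      moreover have "q \<in> ?K" using q t1 by (auto simp: qq cbox_Pair_eq)
      from gK[OF this] have "1/16 * h powr \<kappa> \<le> g q" "0 \<le> g q"
        using powr_ge_zero[of h \<kappa>] by linarith+
      ultimately have "(1/16 * h powr \<kappa>) * (1/4 * (1/h)) \<le> g q * (cutoff t1 (base q) * strip h q)"
        using h by (intro mult_mono[of "1/16 * h powr \<kappa>" "g q" "1/4 * (1/h)"]) auto
      then have "b \<le> g q * (cutoff t1 (base q) * strip h q)" by (simp add: b_def)
      then show ?thesis using True by simp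
    next
      case False
      have "0 \<le> g q * (cutoff t1 (base q) * strip h q)"
      proof (cases "q \<in> ?K")
        case True
        have "g q \<ge> 0" using gK[OF True] powr_ge_zero[of h \<kappa>] by linarith
        then show ?thesis using cutoff_bounds(1)[of t1 "base q"] strip_nonneg[OF h(1), of q] by simp
      next
        case F: False
        show ?thesis unfolding cs0[OF F] by simp
      qed
      then show ?thesis using False by simp
    qed
  qed
  finally have *: "b * measure lborel ?B \<le> (LINT q|lborel. g q * (cutoff t1 (base q) * strip h q))" .
  have mB: "measure lborel ?B = t1/2 * (1/4 * h)" using t1 h by (subst content_cbox3) auto
  have "b * (t1/2 * (1/4 * h)) = 1/512 * (h powr \<kappa> * t1)" using h by (simp add: b_def)
  then have "1/512 * (h powr \<kappa> * t1) \<le> (LINT q|lborel. g q * (cutoff t1 (base q) * strip h q))"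
    using * unfolding mB by linarith
  \<comment> \<open>Main term 1/512 minus half of the error 1/512.\<close>
  then have "S t1 h \<ge> 1/1024 * (h powr \<kappa> * t1)" unfolding S2 using I1' by linarith
  then show ?thesis by (simp add: \<kappa>_def mult_ac)
qed

text \<open>After division by h^(1-2\<alpha>) the lower bound is a positive constant, while the
  upper bound tends to 0. The time \<open>t1\<close> is fixed before \<open>h\<close> tends to 0,
  because the constant \<open>B\<close> depends on it.\<close>

lemma boundary_shear_impossible: False
proof -
  have "1 / (4096 * (C + 1)) > 0" using C by simp
  from initial_closeness[OF this] obtain h0 t0 where h0: "h0 > 0" "h0 \<le> 1/2" and t0: "t0 > 0"
    and close: "\<forall>t. 0 < t \<longrightarrow> t < t0 \<longrightarrow> t < T \<longrightarrow> slice_bound C \<beta> (\<theta> t) \<longrightarrow>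
    (\<forall>a s. -1 \<le> a \<longrightarrow> a \<le> 0 \<longrightarrow> 0 < s \<longrightarrow> s \<le> h0 \<longrightarrow> \<bar>\<theta> t (a, s) - tent2 0 (a, s)\<bar> \<le> 1 / (4096 * (C + 1)))" by blast
  \<comment> \<open>The quarter keeps the support of the cutoff, which lies below 2 t1, inside both
    the closeness window and the time interval.\<close>
  define t1 where "t1 = min t0 T / 4"
  have t1: "0 < t1" "2 * t1 < T" "2 * t1 < t0" using t0 T by (auto simp: t1_def)
  have c0: "trace_const p > 0" unfolding trace_const_def by (rule integral_sgn_qker_pos[OF p(2,3)])
  define B where "B = K * (2 / t1 + 4 + (A + A * (2 / t1 + 4))) * (2 * t1)"
  have B: "B \<ge> 0" using K A t1 by (auto simp: B_def intro!: mult_nonneg_nonneg add_nonneg_nonneg)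
  define \<kappa> where "\<kappa> = 1 - 2 * \<alpha>"
  have \<kappa>: "0 < \<kappa>" "\<kappa> < 1" using \<alpha> by (auto simp: \<kappa>_def)
  \<comment> \<open>The surplus of 1 - \<beta> over 1 - 2\<alpha>, positive exactly in the range of
    (a).\<close>
  define \<delta> where "\<delta> = 2 * \<alpha> - \<beta>"
  have \<delta>: "\<delta> > 0" using \<beta> by (simp add: \<delta>_def)
  have ineq: "trace_const p * (t1 / 1024) \<le> 2 * (B * (2 * h) powr \<delta> + (2 * A * C * (2 * h) powr \<delta> + C * E (2 * h)) * t1)"
    if h: "0 < h" "h < h0 / 3" for h
  proof -
    have h3: "3 * h \<le> 1/2" "h \<le> 1/2" using h h0 by auto
    have "t1 / 1024 * h powr \<kappa> \<le> S t1 h"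
      unfolding \<kappa>_def
    proof (rule S_lower[OF t1(1,2) h(1) h3(1)])
      fix t a s :: real
      assume "0 < t" "t < 2 * t1" "slice_bound C \<beta> (\<theta> t)" "-1 \<le> a" "a \<le> 0" "0 < s" "s \<le> 2 * h"
      then show "\<bar>\<theta> t (a, s) - tent2 0 (a, s)\<bar> \<le> 1 / (4096 * (C + 1))"
        using close[rule_format, of t a s] t1 h by simp
    qed
    then have "trace_const p * (t1 / 1024 * h powr \<kappa>) \<le> trace_const p * \<bar>S t1 h\<bar>" using c0 by (intro mult_left_mono) auto
    also have "\<dots> \<le> B * (2 * h) powr (1 - \<beta>) + (2 * A * C * (2 * h) powr (1 - \<beta>) + C * (2 * h) powr \<kappa> * E (2 * h)) * t1"
      unfolding B_def \<kappa>_def by (rule S_upper[OF t1(1,2) h(1) h3(2)])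
    also have "(2 * h) powr (1 - \<beta>) = (2 * h) powr \<delta> * (2 * h) powr \<kappa>"
      by (simp add: \<delta>_def \<kappa>_def powr_add[symmetric])
    also have "B * ((2 * h) powr \<delta> * (2 * h) powr \<kappa>) + (2 * A * C * ((2 * h) powr \<delta> * (2 * h) powr \<kappa>) + C * (2 * h) powr \<kappa> * E (2 * h)) * t1
      = (2 * h) powr \<kappa> * (B * (2 * h) powr \<delta> + (2 * A * C * (2 * h) powr \<delta> + C * E (2 * h)) * t1)"
      by (simp add: algebra_simps)
    also have "\<dots> \<le> (2 * h powr \<kappa>) * (B * (2 * h) powr \<delta> + (2 * A * C * (2 * h) powr \<delta> + C * E (2 * h)) * t1)"
    proof (rule mult_right_mono)
      have "(2 * h) powr \<kappa> = 2 powr \<kappa> * h powr \<kappa>" using h by (simp add: powr_mult)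
      also have "\<dots> \<le> 2 * h powr \<kappa>" using \<kappa> powr_mono[of \<kappa> 1 "2::real"] by (intro mult_right_mono) auto
      finally show "(2 * h) powr \<kappa> \<le> 2 * h powr \<kappa>" .
      show "0 \<le> B * (2 * h) powr \<delta> + (2 * A * C * (2 * h) powr \<delta> + C * E (2 * h)) * t1"
        using B A C E_nonneg[of "2 * h"] h t1 by (intro add_nonneg_nonneg mult_nonneg_nonneg) auto
    qed
    finally have le: "trace_const p * (t1 / 1024 * h powr \<kappa>) \<le> 2 * h powr \<kappa> * (B * (2 * h) powr \<delta> + (2 * A * C * (2 * h) powr \<delta> + C * E (2 * h)) * t1)" .
    define Y where "Y = B * (2 * h) powr \<delta> + (2 * A * C * (2 * h) powr \<delta> + C * E (2 * h)) * t1"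
    have "h powr \<kappa> * (trace_const p * (t1 / 1024)) \<le> h powr \<kappa> * (2 * Y)"
      using le unfolding Y_def[symmetric] by (simp only: mult_ac)
    then have "trace_const p * (t1 / 1024) \<le> 2 * Y" using h by simp
    then show ?thesis unfolding Y_def .
  qed
  have "filterlim (\<lambda>g. 2 * g) (at_right (0::real)) (at_right 0)"
    by (rule filterlim_times_pos[of "\<lambda>g. g" 0 _ 2]) (auto simp: filterlim_ident)
  from filterlim_compose[OF E_tendsto this]
  have "((\<lambda>h. 2 * (B * (2 * h) powr \<delta> + (2 * A * C * (2 * h) powr \<delta> + C * E (2 * h)) * t1)) \<longlongrightarrow> 2 * (B * 0 + (2 * A * C * 0 + C * 0) * t1)) (at_right 0)"
    by (intro tendsto_intros tendsto_powr_0_at_right \<delta>)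
  moreover have "eventually (\<lambda>h. trace_const p * (t1 / 1024) \<le> 2 * (B * (2 * h) powr \<delta> + (2 * A * C * (2 * h) powr \<delta> + C * E (2 * h)) * t1)) (at_right 0)"
    unfolding eventually_at_right_field using ineq h0 by (intro exI[of _ "h0 / 3"]) auto
  ultimately have "trace_const p * (t1 / 1024) \<le> 2 * (B * 0 + (2 * A * C * 0 + C * 0) * t1)"
    by (rule tendsto_lowerbound) simp
  then show False using c0 t1 by (simp add: mult_le_0_iff)
qed

end

lemma ill_posed_a:
  assumes \<alpha>: "0 < \<alpha>" "\<alpha> < 1/2" and \<beta>: "0 \<le> \<beta>" "\<beta> < 2 * \<alpha>"
  shows "\<exists>\<theta>0\<in>X_space \<beta>. \<not> (\<exists>T>0. \<exists>\<theta>\<in>LinfX_space T \<beta>. classical_solution \<alpha> T \<theta> \<and> has_initial_data \<theta> \<theta>0)"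
proof (intro bexI[of _ "tent2 0"] notI, elim exE bexE conjE)
  show "tent2 0 \<in> X_space \<beta>"
    by (rule lipschitz_compact_support_X_space(1)[OF tent2_lipschitz tent2_AE_differentiable tent2_bounds(2) tent2_eq_0])
  fix T \<theta> assume T: "T > 0" and sol: "\<theta> \<in> LinfX_space T \<beta>" "classical_solution \<alpha> T \<theta>" and init: "has_initial_data \<theta> (tent2 0)"
  obtain C where C: "C > 0" "AE t in lborel. t \<in> {0..T} \<longrightarrow> slice_bound C \<beta> (\<theta> t)"
    using LinfX_space_slice_bound[OF sol \<beta>(1)] by blast
  have "\<theta> 0 x = tent2 0 x" if "x \<in> halfplane" for x
    by (rule initial_data_eq[OF sol(2) T init continuous_on_subset[OF lipschitz_on_continuous_on[OF tent2_lipschitz] subset_UNIV] that])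
  then interpret boundary_shear \<alpha> \<beta> T C \<theta>
    using \<alpha> \<beta> T C sol by unfold_locales
  show False by (rule boundary_shear_impossible)
qed

theorem theorem1p2:
  fixes \<alpha> \<beta> :: real
  assumes "\<alpha> \<in> {0<..<1/2}"
    and "\<beta> \<in> {0..<1} - {2 * \<alpha>..1 - 2 * \<alpha>}"
  shows "(\<beta> \<in> {0..<2 * \<alpha>} \<longrightarrow>
           (\<exists>\<theta>0\<in>X_space \<beta>. \<not> (\<exists>T>0. \<exists>\<theta>\<in>LinfX_space T \<beta>.
              classical_solution \<alpha> T \<theta> \<and> has_initial_data \<theta> \<theta>0)))
       \<and> (\<beta> \<in> {1 - 2 * \<alpha><..<1} \<longrightarrow>
           (\<exists>\<theta>0\<in>X_space \<beta>. \<exists>\<theta>0n :: nat \<Rightarrow> real \<times> real \<Rightarrow> real.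
              (\<forall>n\<ge>1. \<theta>0n n \<in> X_space \<beta>)
            \<and> (\<lambda>n. X_norm \<beta> (\<lambda>x. \<theta>0n n x - \<theta>0 x)) \<longlonglongrightarrow> 0
            \<and> \<not> (\<exists>T>0. \<exists>\<theta>\<in>LinfX_space T \<beta>. \<exists>\<theta>n :: nat \<Rightarrow> real \<Rightarrow> real \<times> real \<Rightarrow> real.
                  classical_solution \<alpha> T \<theta> \<and> has_initial_data \<theta> \<theta>0
                \<and> (\<forall>n\<ge>1. \<theta>n n \<in> LinfX_space T \<beta> \<and> classical_solution \<alpha> T (\<theta>n n)
                        \<and> has_initial_data (\<theta>n n) (\<theta>0n n))
                \<and> (\<lambda>n. LinfX_norm T \<beta> (\<lambda>t x. \<theta>n n t x - \<theta> t x)) \<longlonglongrightarrow> 0)))"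
proof (intro conjI impI)
  assume "\<beta> \<in> {0..<2 * \<alpha>}"
  then show "\<exists>\<theta>0\<in>X_space \<beta>. \<not> (\<exists>T>0. \<exists>\<theta>\<in>LinfX_space T \<beta>.
      classical_solution \<alpha> T \<theta> \<and> has_initial_data \<theta> \<theta>0)"
    using assms by (intro ill_posed_a) auto
qed (rule ill_posed_b; use assms in auto)

end
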